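(* Let $\mathcal C$ be an additive monoidal category that has equalizers and coequalizers which are preserved by all functors of the form $-\otimes X$ and $X\otimes-$. Let $H$ be a braided bialgebra in $\mathcal C$ with operator $\lambda_H$. Let $\mathrm{eq}:P(H)\to H$ be the equalizer of $\Delta$ and $\eta\otimes H+H\otimes\eta$, and $\mathrm{coeq}:H\to Q(H)$ the coequalizer of $\mu$ and $\epsilon\otimes H+H\otimes\epsilon$. Then: (i) $(P(H),\lambda_{P(H)},\Lambda_{P(H)})$ is a YB-Lie algebra in $\mathcal C$ and $\mathrm{eq}:P(H)\to\mathcal L(H)$ is a YB-Lie algebra morphism, where $\lambda_{P(H)}$ and $\Lambda_{P(H)}$ are the unique morphisms with $(\mathrm{eq}\otimes\mathrm{eq})\circ\lambda_{P(H)}=\lambda_H\circ(\mathrm{eq}\otimes\mathrm{eq})$ and $\mathrm{eq}\circ\Lambda_{P(H)}=\Lambda_H\circ(\mathrm{eq}\otimes\mathrm{eq})$; (ii) $(Q(H),\gamma_{Q(H)},\Gamma_{Q(H)})$ is a YB-Lie coalgebra in $\mathcal C$ and $\mathrm{coeq}:\mathcal L^c(H)\to Q(H)$ is a YB-Lie coalgebra morphism, where $\gamma_{Q(H)}$ and $\Gamma_{Q(H)}$ are the unique morphisms with $\gamma_{Q(H)}\circ(\mathrm{coeq}\otimes\mathrm{coeq})=(\mathrm{coeq}\otimes\mathrm{coeq})\circ\lambda_H$ and $\Gamma_{Q(H)}\circ\mathrm{coeq}=(\mathrm{coeq}\otimes\mathrm{coeq})\circ\Gamma_H$. Furthermore,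 these constructions yield functors $P:\mathsf{BiAlg}\to\mathsf{YBLieAlg}$ and $Q:\mathsf{BiAlg}\to\mathsf{YBLieCoAlg}$ from the category of braided bialgebras in $\mathcal C$ to the categories of YB-Lie algebras and YB-Lie coalgebras in $\mathcal C$.
   Context: Conventions: the tensor product is additive in each variable; associativity and unit constraints are suppressed; $I$ is the unit object; an object also denotes its identity morphism. For $c:V\otimes V\to V\otimes V$ put $t_c=(c\otimes V)(V\otimes c)$, $w_c=(V\otimes c)(c\otimes V)$. An involutive (symmetric) Yang-Baxter operator on $V$ is $c:V\otimes V\to V\otimes V$ with $c\circ c=1$ and $(c\otimes V)(V\otimes c)(c\otimes V)=(V\otimes c)(c\otimes V)(V\otimes c)$. A YB-Lie algebra is $(L,\lambda,\Lambda)$ with $\lambda$ such an operator on $L$ and $\Lambda:L\otimes L\to L$ with $\Lambda(1+\lambda)=0$, $\Lambda(L\otimes\Lambda)(1+t_\lambda+w_\lambda)=0$, $\lambda(\Lambda\otimes L)=(L\otimes\Lambda)t_\lambda$; morphisms are $\phi$ with $\Lambda'(\phi\otimes\phi)=\phi\Lambda$ and $\lambda'(\phi\otimes\phi)=(\phi\otimes\phi)\lambda$. A YB-Lie coalgebra is $(C,\gamma,\Upsilon)$ with $\gamma$ such an operator on $C$ and $\Upsilon:C\to C\otimes C$ with $\Upsilon+\gamma\Upsilon=0$, $(1+w_\gamma+t_\gamma)(C\otimes\Upsilon)\Upsilon=0$, $(\Upsilon\otimes C)\gamma=w_\gamma(C\otimes\Upsilon)$; morphisms are $\psi$ with $\Upsilon'\psi=(\psi\otimes\psi)\Upsilon$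 and $\gamma'(\psi\otimes\psi)=(\psi\otimes\psi)\gamma$. A braided bialgebra in $\mathcal C$ is $(H,\mu,\eta,\Delta,\epsilon,\lambda)$, with $\lambda$ also written $\lambda_H$, such that: $(H,\mu,\eta)$ is an algebra; $(H,\Delta,\epsilon)$ is a coalgebra; $\lambda$ is an involutive Yang-Baxter operator on $H$; $\lambda$ is compatible with the structure maps, i.e. $\lambda(\mu\otimes H)=(H\otimes\mu)t_\lambda$, $\lambda(H\otimes\mu)=(\mu\otimes H)w_\lambda$, $\lambda(\eta\otimes H)=H\otimes\eta$, $\lambda(H\otimes\eta)=\eta\otimes H$, $(H\otimes\Delta)\lambda=t_\lambda(\Delta\otimes H)$, $(\Delta\otimes H)\lambda=w_\lambda(H\otimes\Delta)$, $(\epsilon\otimes H)\lambda=H\otimes\epsilon$, $(H\otimes\epsilon)\lambda=\epsilon\otimes H$; $\epsilon$ is an algebra morphism, $\eta$ is a coalgebra morphism, and $(\mu\otimes\mu)(H\otimes\lambda\otimes H)(\Delta\otimes\Delta)=\Delta\mu$. Morphisms of braided bialgebras are algebra and coalgebra morphisms $f$ with $\lambda'(f\otimes f)=(f\otimes f)\lambda$. $\mathcal L(H)=(H,\lambda_H,\Lambda_H)$ with $\Lambda_H=\mu\circ(H\otimes H-\lambda_H)$ is the commutator YB-Lie algebra of $H$; $\mathcal L^c(H)=(H,\lambda_H,\Gamma_H)$ with $\Gamma_H=(H\otimes H-\lambda_H)\circ\Delta$ is the cocommutator YB-Lie coalgebra of $H$. *)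

theory Defs
  imports "HOL-Algebra.Group"
begin

section \<open>Categories and functors\<close>

record ('o, 'm) category =
  Obj :: "'o set"
  Arr :: "'m set"
  Dom :: "'m \<Rightarrow> 'o"
  Cod :: "'m \<Rightarrow> 'o"
  Ide :: "'o \<Rightarrow> 'm"  ("\<i>\<index>")
  Comp :: "'m \<Rightarrow> 'm \<Rightarrow> 'm"  (infixr "\<cdot>\<index>" 70)

definition Hom :: "('o, 'm, 'z) category_scheme \<Rightarrow> 'o \<Rightarrow> 'o \<Rightarrow> 'm set" where
  "Hom C A B = {f \<in> Arr C. Dom C f = A \<and> Cod C f = B}"

locale category =
  fixes C (structure)
  assumes dom_obj: "f \<in> Arr C \<Longrightarrow> Dom C f \<in> Obj C"
    and cod_obj: "f \<in> Arr C \<Longrightarrow> Cod C f \<in> Obj C"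
    and ide_hom: "A \<in> Obj C \<Longrightarrow> \<i> A \<in> Hom C A A"
    and comp_hom: "\<lbrakk>f \<in> Arr C; g \<in> Arr C; Cod C f = Dom C g\<rbrakk> \<Longrightarrow> g \<cdot> f \<in> Hom C (Dom C f) (Cod C g)"
    and comp_ide_right: "f \<in> Arr C \<Longrightarrow> f \<cdot> \<i> (Dom C f) = f"
    and comp_ide_left: "f \<in> Arr C \<Longrightarrow> \<i> (Cod C f) \<cdot> f = f"
    and comp_assoc: "\<lbrakk>f \<in> Arr C; g \<in> Arr C; h \<in> Arr C; Cod C f = Dom C g; Cod C g = Dom C h\<rbrakk>
        \<Longrightarrow> (h \<cdot> g) \<cdot> f = h \<cdot> (g \<cdot> f)"

locale category_functor = source: category C + target: category D
  for C (structure) and D (structure) +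
  fixes FO and FA
  assumes map_obj: "A \<in> Obj C \<Longrightarrow> FO A \<in> Obj D"
    and map_hom: "f \<in> Arr C \<Longrightarrow> FA f \<in> Hom D (FO (Dom C f)) (FO (Cod C f))"
    and map_ide: "A \<in> Obj C \<Longrightarrow> FA (Ide C A) = Ide D (FO A)"
    and map_comp: "\<lbrakk>f \<in> Arr C; g \<in> Arr C; Cod C f = Dom C g\<rbrakk>
        \<Longrightarrow> FA (Comp C g f) = Comp D (FA g) (FA f)"

definition is_iso :: "('o, 'm, 'z) category_scheme \<Rightarrow> 'm \<Rightarrow> bool" where
  "is_iso C f \<longleftrightarrow> f \<in> Arr C \<and>
     (\<exists>g \<in> Hom C (Cod C f) (Dom C f). g \<cdot> f = \<i> (Dom C f) \<and> f \<cdot> g = \<i> (Cod C f))"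
  for C (structure)

definition Inv :: "('o, 'm, 'z) category_scheme \<Rightarrow> 'm \<Rightarrow> 'm"  ("Inv\<index> _" [81] 80) where
  "Inv\<^bsub>C\<^esub> f = (THE g. g \<in> Hom C (Cod C f) (Dom C f) \<and> g \<cdot> f = \<i> (Dom C f) \<and> f \<cdot> g = \<i> (Cod C f))"
  for C (structure)

definition is_equalizer :: "('o, 'm, 'z) category_scheme \<Rightarrow> 'o \<Rightarrow> 'm \<Rightarrow> 'm \<Rightarrow> 'm \<Rightarrow> bool" where
  "is_equalizer C E e f g \<longleftrightarrow>
     f \<in> Arr C \<and> g \<in> Hom C (Dom C f) (Cod C f) \<and>
     e \<in> Hom C E (Dom C f) \<and> f \<cdot> e = g \<cdot> e \<and>
     (\<forall>X. \<forall>x \<in> Hom C X (Dom C f). f \<cdot> x = g \<cdot> x \<longrightarrow> (\<exists>!u. u \<in> Hom C X E \<and> e \<cdot> u = x))"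
  for C (structure)

definition is_coequalizer :: "('o, 'm, 'z) category_scheme \<Rightarrow> 'o \<Rightarrow> 'm \<Rightarrow> 'm \<Rightarrow> 'm \<Rightarrow> bool" where
  "is_coequalizer C Q q f g \<longleftrightarrow>
     f \<in> Arr C \<and> g \<in> Hom C (Dom C f) (Cod C f) \<and>
     q \<in> Hom C (Cod C f) Q \<and> q \<cdot> f = q \<cdot> g \<and>
     (\<forall>X. \<forall>x \<in> Hom C (Cod C f) X. x \<cdot> f = x \<cdot> g \<longrightarrow> (\<exists>!u. u \<in> Hom C Q X \<and> u \<cdot> q = x))"
  for C (structure)


section \<open>Additive monoidal categories\<close>

record ('o, 'm) monoidal_category = "('o, 'm) category" +
  TensorO :: "'o \<Rightarrow> 'o \<Rightarrow> 'o"  (infixl "\<boxdot>\<index>" 75)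
  Tensor :: "'m \<Rightarrow> 'm \<Rightarrow> 'm"  (infixl "\<boxtimes>\<index>" 75)
  UnitO :: 'o  ("\<I>\<index>")
  Assoc :: "'o \<Rightarrow> 'o \<Rightarrow> 'o \<Rightarrow> 'm"  ("\<a>\<index>[_, _, _]")
  LUnit :: "'o \<Rightarrow> 'm"  ("\<l>\<index>[_]")
  RUnit :: "'o \<Rightarrow> 'm"  ("\<r>\<index>[_]")

locale monoidal_category = category C for C (structure) +
  assumes tensor_obj: "\<lbrakk>A \<in> Obj C; B \<in> Obj C\<rbrakk> \<Longrightarrow> A \<boxdot> B \<in> Obj C"
    and tensor_hom: "\<lbrakk>f \<in> Arr C; g \<in> Arr C\<rbrakk>
        \<Longrightarrow> f \<boxtimes> g \<in> Hom C (Dom C f \<boxdot> Dom C g) (Cod C f \<boxdot> Cod C g)"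
    and tensor_ide: "\<lbrakk>A \<in> Obj C; B \<in> Obj C\<rbrakk> \<Longrightarrow> \<i> A \<boxtimes> \<i> B = \<i> (A \<boxdot> B)"
    and tensor_comp: "\<lbrakk>f \<in> Arr C; g \<in> Arr C; f' \<in> Arr C; g' \<in> Arr C; Cod C f = Dom C g; Cod C f' = Dom C g'\<rbrakk>
        \<Longrightarrow> (g \<cdot> f) \<boxtimes> (g' \<cdot> f') = (g \<boxtimes> g') \<cdot> (f \<boxtimes> f')"
    and unit_obj: "\<I> \<in> Obj C"
    and assoc_hom: "\<lbrakk>A \<in> Obj C; B \<in> Obj C; D \<in> Obj C\<rbrakk>
        \<Longrightarrow> \<a>[A, B, D] \<in> Hom C (A \<boxdot> B \<boxdot> D) (A \<boxdot> (B \<boxdot> D))"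
    and assoc_iso: "\<lbrakk>A \<in> Obj C; B \<in> Obj C; D \<in> Obj C\<rbrakk> \<Longrightarrow> is_iso C \<a>[A, B, D]"
    and assoc_natural: "\<lbrakk>f \<in> Arr C; g \<in> Arr C; h \<in> Arr C\<rbrakk>
        \<Longrightarrow> \<a>[Cod C f, Cod C g, Cod C h] \<cdot> (f \<boxtimes> g \<boxtimes> h) = (f \<boxtimes> (g \<boxtimes> h)) \<cdot> \<a>[Dom C f, Dom C g, Dom C h]"
    and lunit_hom: "A \<in> Obj C \<Longrightarrow> \<l>[A] \<in> Hom C (\<I> \<boxdot> A) A"
    and lunit_iso: "A \<in> Obj C \<Longrightarrow> is_iso C \<l>[A]"
    and lunit_natural: "f \<in> Arr C \<Longrightarrow> \<l>[Cod C f] \<cdot> (\<i> \<I> \<boxtimes> f) = f \<cdot> \<l>[Dom C f]"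
    and runit_hom: "A \<in> Obj C \<Longrightarrow> \<r>[A] \<in> Hom C (A \<boxdot> \<I>) A"
    and runit_iso: "A \<in> Obj C \<Longrightarrow> is_iso C \<r>[A]"
    and runit_natural: "f \<in> Arr C \<Longrightarrow> \<r>[Cod C f] \<cdot> (f \<boxtimes> \<i> \<I>) = f \<cdot> \<r>[Dom C f]"
    and pentagon: "\<lbrakk>A \<in> Obj C; B \<in> Obj C; D \<in> Obj C; E \<in> Obj C\<rbrakk>
        \<Longrightarrow> \<a>[A, B, D \<boxdot> E] \<cdot> \<a>[A \<boxdot> B, D, E]
          = (\<i> A \<boxtimes> \<a>[B, D, E]) \<cdot> \<a>[A, B \<boxdot> D, E] \<cdot> (\<a>[A, B, D] \<boxtimes> \<i> E)"
    and triangle: "\<lbrakk>A \<in> Obj C; B \<in> Obj C\<rbrakk>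
        \<Longrightarrow> (\<i> A \<boxtimes> \<l>[B]) \<cdot> \<a>[A, \<I>, B] = \<r>[A] \<boxtimes> \<i> B"

record ('o, 'm) additive_monoidal_category = "('o, 'm) monoidal_category" +
  Add :: "'m \<Rightarrow> 'm \<Rightarrow> 'm"  (infixl "\<boxplus>\<index>" 65)
  Zero :: "'o \<Rightarrow> 'o \<Rightarrow> 'm"

definition hom_group :: "('o, 'm, 'z) additive_monoidal_category_scheme \<Rightarrow> 'o \<Rightarrow> 'o \<Rightarrow> 'm monoid" where
  "hom_group C A B = \<lparr>carrier = Hom C A B, mult = Add C, one = Zero C A B\<rparr>"

definition Minus :: "('o, 'm, 'z) additive_monoidal_category_scheme \<Rightarrow> 'm \<Rightarrow> 'm \<Rightarrow> 'm"  (infixl "\<boxminus>\<index>" 65) where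
  "f \<boxminus>\<^bsub>C\<^esub> g = f \<boxplus> inv\<^bsub>hom_group C (Dom C f) (Cod C f)\<^esub> g"
  for C (structure)

locale additive_monoidal_category = monoidal_category C for C (structure) +
  assumes hom_comm_group: "\<lbrakk>A \<in> Obj C; B \<in> Obj C\<rbrakk> \<Longrightarrow> comm_group (hom_group C A B)"
    and comp_add_right: "\<lbrakk>f \<in> Hom C A B; g \<in> Hom C A B; h \<in> Hom C B D\<rbrakk>
        \<Longrightarrow> h \<cdot> (f \<boxplus> g) = h \<cdot> f \<boxplus> h \<cdot> g"
    and comp_add_left: "\<lbrakk>f \<in> Hom C B D; g \<in> Hom C B D; h \<in> Hom C A B\<rbrakk>
        \<Longrightarrow> (f \<boxplus> g) \<cdot> h = f \<cdot> h \<boxplus> g \<cdot> h"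
    and zero_object: "\<exists>Z \<in> Obj C. \<forall>A \<in> Obj C. (\<exists>!f. f \<in> Hom C A Z) \<and> (\<exists>!f. f \<in> Hom C Z A)"
    and biproducts: "\<lbrakk>A \<in> Obj C; B \<in> Obj C\<rbrakk> \<Longrightarrow>
        \<exists>S \<in> Obj C. \<exists>i \<in> Hom C A S. \<exists>j \<in> Hom C B S. \<exists>p \<in> Hom C S A. \<exists>q \<in> Hom C S B.
          p \<cdot> i = \<i> A \<and> q \<cdot> j = \<i> B \<and> p \<cdot> j = Zero C B A \<and> q \<cdot> i = Zero C A B \<and>
          i \<cdot> p \<boxplus> j \<cdot> q = \<i> S"
    and tensor_add_left: "\<lbrakk>f \<in> Hom C A B; g \<in> Hom C A B; h \<in> Arr C\<rbrakk>
        \<Longrightarrow> (f \<boxplus> g) \<boxtimes> h = f \<boxtimes> h \<boxplus> g \<boxtimes> h"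
    and tensor_add_right: "\<lbrakk>f \<in> Hom C A B; g \<in> Hom C A B; h \<in> Arr C\<rbrakk>
        \<Longrightarrow> h \<boxtimes> (f \<boxplus> g) = h \<boxtimes> f \<boxplus> h \<boxtimes> g"

definition has_preserved_equalizers :: "('o, 'm, 'z) additive_monoidal_category_scheme \<Rightarrow> bool" where
  "has_preserved_equalizers C \<longleftrightarrow>
     (\<forall>f \<in> Arr C. \<forall>g \<in> Hom C (Dom C f) (Cod C f). \<exists>E e. is_equalizer C E e f g) \<and>
     (\<forall>E e f g. \<forall>X \<in> Obj C. is_equalizer C E e f g \<longrightarrow>
        is_equalizer C (E \<boxdot> X) (e \<boxtimes> \<i> X) (f \<boxtimes> \<i> X) (g \<boxtimes> \<i> X) \<and>
        is_equalizer C (X \<boxdot> E) (\<i> X \<boxtimes> e) (\<i> X \<boxtimes> f) (\<i> X \<boxtimes> g))"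
  for C (structure)

definition has_preserved_coequalizers :: "('o, 'm, 'z) additive_monoidal_category_scheme \<Rightarrow> bool" where
  "has_preserved_coequalizers C \<longleftrightarrow>
     (\<forall>f \<in> Arr C. \<forall>g \<in> Hom C (Dom C f) (Cod C f). \<exists>Q q. is_coequalizer C Q q f g) \<and>
     (\<forall>Q q f g. \<forall>X \<in> Obj C. is_coequalizer C Q q f g \<longrightarrow>
        is_coequalizer C (Q \<boxdot> X) (q \<boxtimes> \<i> X) (f \<boxtimes> \<i> X) (g \<boxtimes> \<i> X) \<and>
        is_coequalizer C (X \<boxdot> Q) (\<i> X \<boxtimes> q) (\<i> X \<boxtimes> f) (\<i> X \<boxtimes> g))"
  for C (structure)


section \<open>Yang-Baxter operators\<close>

text \<open>The constraints that the usual notation suppresses are written out. Threefold tensor powers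
  are bracketed to the left, so an operator on the last two factors is conjugated by the
  associator.\<close>

definition on12 :: "('o, 'm, 'z) additive_monoidal_category_scheme \<Rightarrow> 'o \<Rightarrow> 'm \<Rightarrow> 'm" where
  "on12 C V c = c \<boxtimes> \<i> V"
  for C (structure)

definition on23 :: "('o, 'm, 'z) additive_monoidal_category_scheme \<Rightarrow> 'o \<Rightarrow> 'm \<Rightarrow> 'm" where
  "on23 C V c = Inv \<a>[V, V, V] \<cdot> (\<i> V \<boxtimes> c) \<cdot> \<a>[V, V, V]"
  for C (structure)

definition t_op :: "('o, 'm, 'z) additive_monoidal_category_scheme \<Rightarrow> 'o \<Rightarrow> 'm \<Rightarrow> 'm" where
  "t_op C V c = on12 C V c \<cdot> on23 C V c"
  for C (structure)

definition w_op :: "('o, 'm, 'z) additive_monoidal_category_scheme \<Rightarrow> 'o \<Rightarrow> 'm \<Rightarrow> 'm" where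
  "w_op C V c = on23 C V c \<cdot> on12 C V c"
  for C (structure)

definition involutive_YB_operator :: "('o, 'm, 'z) additive_monoidal_category_scheme \<Rightarrow> 'o \<Rightarrow> 'm \<Rightarrow> bool" where
  "involutive_YB_operator C V c \<longleftrightarrow>
     V \<in> Obj C \<and> c \<in> Hom C (V \<boxdot> V) (V \<boxdot> V) \<and>
     c \<cdot> c = \<i> (V \<boxdot> V) \<and>
     on12 C V c \<cdot> on23 C V c \<cdot> on12 C V c = on23 C V c \<cdot> on12 C V c \<cdot> on23 C V c"
  for C (structure)


section \<open>YB-Lie algebras and YB-Lie coalgebras\<close>

record ('o, 'm) yb_lie_algebra =
  lie_obj :: 'o
  lie_op :: 'm
  bracket :: 'm

definition is_YB_Lie_algebra ::
  "('o, 'm, 'z) additive_monoidal_category_scheme \<Rightarrow> ('o, 'm) yb_lie_algebra \<Rightarrow> bool" where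
  "is_YB_Lie_algebra C A \<longleftrightarrow>
     (let L = lie_obj A; c = lie_op A; b = bracket A in
       involutive_YB_operator C L c \<and>
       b \<in> Hom C (L \<boxdot> L) L \<and>
       b \<cdot> (\<i> (L \<boxdot> L) \<boxplus> c) = Zero C (L \<boxdot> L) L \<and>
       b \<cdot> (\<i> L \<boxtimes> b) \<cdot> \<a>[L, L, L] \<cdot> (\<i> (L \<boxdot> L \<boxdot> L) \<boxplus> t_op C L c \<boxplus> w_op C L c)
         = Zero C (L \<boxdot> L \<boxdot> L) L \<and>
       c \<cdot> (b \<boxtimes> \<i> L) = (\<i> L \<boxtimes> b) \<cdot> \<a>[L, L, L] \<cdot> t_op C L c)"
  for C (structure)

definition is_YB_Lie_algebra_hom ::
  "('o, 'm, 'z) additive_monoidal_category_scheme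
    \<Rightarrow> ('o, 'm) yb_lie_algebra \<Rightarrow> ('o, 'm) yb_lie_algebra \<Rightarrow> 'm \<Rightarrow> bool" where
  "is_YB_Lie_algebra_hom C A B \<phi> \<longleftrightarrow>
     is_YB_Lie_algebra C A \<and> is_YB_Lie_algebra C B \<and>
     \<phi> \<in> Hom C (lie_obj A) (lie_obj B) \<and>
     bracket B \<cdot> (\<phi> \<boxtimes> \<phi>) = \<phi> \<cdot> bracket A \<and>
     lie_op B \<cdot> (\<phi> \<boxtimes> \<phi>) = (\<phi> \<boxtimes> \<phi>) \<cdot> lie_op A"
  for C (structure)

record ('o, 'm) yb_lie_coalgebra =
  colie_obj :: 'o
  colie_op :: 'm
  cobracket :: 'm

definition is_YB_Lie_coalgebra ::
  "('o, 'm, 'z) additive_monoidal_category_scheme \<Rightarrow> ('o, 'm) yb_lie_coalgebra \<Rightarrow> bool" where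
  "is_YB_Lie_coalgebra C A \<longleftrightarrow>
     (let K = colie_obj A; c = colie_op A; d = cobracket A in
       involutive_YB_operator C K c \<and>
       d \<in> Hom C K (K \<boxdot> K) \<and>
       d \<boxplus> c \<cdot> d = Zero C K (K \<boxdot> K) \<and>
       (\<i> (K \<boxdot> K \<boxdot> K) \<boxplus> w_op C K c \<boxplus> t_op C K c) \<cdot> Inv \<a>[K, K, K] \<cdot> (\<i> K \<boxtimes> d) \<cdot> d
         = Zero C K (K \<boxdot> K \<boxdot> K) \<and>
       (d \<boxtimes> \<i> K) \<cdot> c = w_op C K c \<cdot> Inv \<a>[K, K, K] \<cdot> (\<i> K \<boxtimes> d))"
  for C (structure)

definition is_YB_Lie_coalgebra_hom ::
  "('o, 'm, 'z) additive_monoidal_category_scheme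
    \<Rightarrow> ('o, 'm) yb_lie_coalgebra \<Rightarrow> ('o, 'm) yb_lie_coalgebra \<Rightarrow> 'm \<Rightarrow> bool" where
  "is_YB_Lie_coalgebra_hom C A B \<psi> \<longleftrightarrow>
     is_YB_Lie_coalgebra C A \<and> is_YB_Lie_coalgebra C B \<and>
     \<psi> \<in> Hom C (colie_obj A) (colie_obj B) \<and>
     cobracket B \<cdot> \<psi> = (\<psi> \<boxtimes> \<psi>) \<cdot> cobracket A \<and>
     colie_op B \<cdot> (\<psi> \<boxtimes> \<psi>) = (\<psi> \<boxtimes> \<psi>) \<cdot> colie_op A"
  for C (structure)


section \<open>Braided bialgebras\<close>

definition is_algebra :: "('o, 'm, 'z) additive_monoidal_category_scheme \<Rightarrow> 'o \<Rightarrow> 'm \<Rightarrow> 'm \<Rightarrow> bool" where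
  "is_algebra C A m u \<longleftrightarrow>
     A \<in> Obj C \<and> m \<in> Hom C (A \<boxdot> A) A \<and> u \<in> Hom C \<I> A \<and>
     m \<cdot> (m \<boxtimes> \<i> A) = m \<cdot> (\<i> A \<boxtimes> m) \<cdot> \<a>[A, A, A] \<and>
     m \<cdot> (u \<boxtimes> \<i> A) = \<l>[A] \<and>
     m \<cdot> (\<i> A \<boxtimes> u) = \<r>[A]"
  for C (structure)

definition is_coalgebra :: "('o, 'm, 'z) additive_monoidal_category_scheme \<Rightarrow> 'o \<Rightarrow> 'm \<Rightarrow> 'm \<Rightarrow> bool" where
  "is_coalgebra C A d e \<longleftrightarrow>
     A \<in> Obj C \<and> d \<in> Hom C A (A \<boxdot> A) \<and> e \<in> Hom C A \<I> \<and>
     \<a>[A, A, A] \<cdot> (d \<boxtimes> \<i> A) \<cdot> d = (\<i> A \<boxtimes> d) \<cdot> d \<and>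
     \<l>[A] \<cdot> (e \<boxtimes> \<i> A) \<cdot> d = \<i> A \<and>
     \<r>[A] \<cdot> (\<i> A \<boxtimes> e) \<cdot> d = \<i> A"
  for C (structure)

definition is_algebra_hom ::
  "('o, 'm, 'z) additive_monoidal_category_scheme
    \<Rightarrow> 'o \<Rightarrow> 'm \<Rightarrow> 'm \<Rightarrow> 'o \<Rightarrow> 'm \<Rightarrow> 'm \<Rightarrow> 'm \<Rightarrow> bool" where
  "is_algebra_hom C A m u A' m' u' f \<longleftrightarrow>
     f \<in> Hom C A A' \<and> f \<cdot> m = m' \<cdot> (f \<boxtimes> f) \<and> f \<cdot> u = u'"
  for C (structure)

definition is_coalgebra_hom ::
  "('o, 'm, 'z) additive_monoidal_category_scheme
    \<Rightarrow> 'o \<Rightarrow> 'm \<Rightarrow> 'm \<Rightarrow> 'o \<Rightarrow> 'm \<Rightarrow> 'm \<Rightarrow> 'm \<Rightarrow> bool" where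
  "is_coalgebra_hom C A d e A' d' e' f \<longleftrightarrow>
     f \<in> Hom C A A' \<and> d' \<cdot> f = (f \<boxtimes> f) \<cdot> d \<and> e' \<cdot> f = e"
  for C (structure)

record ('o, 'm) bialgebra =
  bobj :: 'o
  mul :: 'm
  unit :: 'm
  comul :: 'm
  counit :: 'm
  braid :: 'm

text \<open>The insertions of the unit and counit between \<open>H\<close> and \<open>H \<otimes> H\<close>, that is \<open>\<eta> \<otimes> H\<close>, \<open>H \<otimes> \<eta>\<close>,
  \<open>\<epsilon> \<otimes> H\<close> and \<open>H \<otimes> \<epsilon>\<close> with the unit constraints \<open>I \<otimes> H \<cong> H \<cong> H \<otimes> I\<close> composed in.\<close>

definition unit_left :: "('o, 'm, 'z) additive_monoidal_category_scheme \<Rightarrow> ('o, 'm) bialgebra \<Rightarrow> 'm" where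
  "unit_left C H = (unit H \<boxtimes> \<i> (bobj H)) \<cdot> Inv \<l>[bobj H]"
  for C (structure)

definition unit_right :: "('o, 'm, 'z) additive_monoidal_category_scheme \<Rightarrow> ('o, 'm) bialgebra \<Rightarrow> 'm" where
  "unit_right C H = (\<i> (bobj H) \<boxtimes> unit H) \<cdot> Inv \<r>[bobj H]"
  for C (structure)

definition counit_left :: "('o, 'm, 'z) additive_monoidal_category_scheme \<Rightarrow> ('o, 'm) bialgebra \<Rightarrow> 'm" where
  "counit_left C H = \<l>[bobj H] \<cdot> (counit H \<boxtimes> \<i> (bobj H))"
  for C (structure)

definition counit_right :: "('o, 'm, 'z) additive_monoidal_category_scheme \<Rightarrow> ('o, 'm) bialgebra \<Rightarrow> 'm" where
  "counit_right C H = \<r>[bobj H] \<cdot> (\<i> (bobj H) \<boxtimes> counit H)"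
  for C (structure)

text \<open>The operator \<open>V \<otimes> c \<otimes> V\<close> on \<open>(V \<otimes> V) \<otimes> (V \<otimes> V)\<close>.\<close>

definition on_middle :: "('o, 'm, 'z) additive_monoidal_category_scheme \<Rightarrow> 'o \<Rightarrow> 'm \<Rightarrow> 'm" where
  "on_middle C V c =
     Inv \<a>[V, V, V \<boxdot> V]
     \<cdot> (\<i> V \<boxtimes> (\<a>[V, V, V] \<cdot> (c \<boxtimes> \<i> V) \<cdot> Inv \<a>[V, V, V]))
     \<cdot> \<a>[V, V, V \<boxdot> V]"
  for C (structure)

definition is_braided_bialgebra ::
  "('o, 'm, 'z) additive_monoidal_category_scheme \<Rightarrow> ('o, 'm) bialgebra \<Rightarrow> bool" where
  "is_braided_bialgebra C B \<longleftrightarrow>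
     (let H = bobj B; m = mul B; u = unit B; d = comul B; e = counit B; c = braid B in
       is_algebra C H m u \<and>
       is_coalgebra C H d e \<and>
       involutive_YB_operator C H c \<and>
       c \<cdot> (m \<boxtimes> \<i> H) = (\<i> H \<boxtimes> m) \<cdot> \<a>[H, H, H] \<cdot> t_op C H c \<and>
       c \<cdot> (\<i> H \<boxtimes> m) \<cdot> \<a>[H, H, H] = (m \<boxtimes> \<i> H) \<cdot> w_op C H c \<and>
       c \<cdot> unit_left C B = unit_right C B \<and>
       c \<cdot> unit_right C B = unit_left C B \<and>
       Inv \<a>[H, H, H] \<cdot> (\<i> H \<boxtimes> d) \<cdot> c = t_op C H c \<cdot> (d \<boxtimes> \<i> H) \<and>
       (d \<boxtimes> \<i> H) \<cdot> c = w_op C H c \<cdot> Inv \<a>[H, H, H] \<cdot> (\<i> H \<boxtimes> d) \<and>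
       counit_left C B \<cdot> c = counit_right C B \<and>
       counit_right C B \<cdot> c = counit_left C B \<and>
       is_algebra_hom C H m u \<I> \<l>[\<I>] (\<i> \<I>) e \<and>
       is_coalgebra_hom C \<I> (Inv \<l>[\<I>]) (\<i> \<I>) H d e u \<and>
       (m \<boxtimes> m) \<cdot> on_middle C H c \<cdot> (d \<boxtimes> d) = d \<cdot> m)"
  for C (structure)

definition is_braided_bialgebra_hom ::
  "('o, 'm, 'z) additive_monoidal_category_scheme
    \<Rightarrow> ('o, 'm) bialgebra \<Rightarrow> ('o, 'm) bialgebra \<Rightarrow> 'm \<Rightarrow> bool" where
  "is_braided_bialgebra_hom C H K f \<longleftrightarrow>
     is_braided_bialgebra C H \<and> is_braided_bialgebra C K \<and>
     is_algebra_hom C (bobj H) (mul H) (unit H) (bobj K) (mul K) (unit K) f \<and>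
     is_coalgebra_hom C (bobj H) (comul H) (counit H) (bobj K) (comul K) (counit K) f \<and>
     braid K \<cdot> (f \<boxtimes> f) = (f \<boxtimes> f) \<cdot> braid H"
  for C (structure)

definition commutator_lie ::
  "('o, 'm, 'z) additive_monoidal_category_scheme \<Rightarrow> ('o, 'm) bialgebra \<Rightarrow> ('o, 'm) yb_lie_algebra" where
  "commutator_lie C H =
     \<lparr>lie_obj = bobj H, lie_op = braid H,
      bracket = mul H \<cdot> (\<i> (bobj H \<boxdot> bobj H) \<boxminus> braid H)\<rparr>"
  for C (structure)

definition cocommutator_colie ::
  "('o, 'm, 'z) additive_monoidal_category_scheme \<Rightarrow> ('o, 'm) bialgebra \<Rightarrow> ('o, 'm) yb_lie_coalgebra" where
  "cocommutator_colie C H =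
     \<lparr>colie_obj = bobj H, colie_op = braid H,
      cobracket = (\<i> (bobj H \<boxdot> bobj H) \<boxminus> braid H) \<cdot> comul H\<rparr>"
  for C (structure)


section \<open>The categories of structured objects\<close>

text \<open>An arrow of such a category is an underlying arrow tagged with its source and target
  structures, since the underlying arrow does not determine them.\<close>

definition structured_category ::
  "('o, 'm, 'z) additive_monoidal_category_scheme \<Rightarrow> ('s \<Rightarrow> 'o) \<Rightarrow> ('s \<Rightarrow> bool)
    \<Rightarrow> ('s \<Rightarrow> 's \<Rightarrow> 'm \<Rightarrow> bool) \<Rightarrow> ('s, 's \<times> 's \<times> 'm) category" where
  "structured_category C U is_obj is_hom =
     \<lparr>Obj = {X. is_obj X},
      Arr = {(X, Y, f). is_obj X \<and> is_obj Y \<and> is_hom X Y f},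
      Dom = (\<lambda>(X, Y, f). X),
      Cod = (\<lambda>(X, Y, f). Y),
      Ide = (\<lambda>X. (X, X, Ide C (U X))),
      Comp = (\<lambda>(Y, Z, g) (X, Y', f). (X, Z, Comp C g f))\<rparr>"

definition BiAlg where
  "BiAlg C = structured_category C bobj (is_braided_bialgebra C) (is_braided_bialgebra_hom C)"

definition YBLieAlg where
  "YBLieAlg C = structured_category C lie_obj (is_YB_Lie_algebra C) (is_YB_Lie_algebra_hom C)"

definition YBLieCoAlg where
  "YBLieCoAlg C = structured_category C colie_obj (is_YB_Lie_coalgebra C) (is_YB_Lie_coalgebra_hom C)"


section \<open>Primitives and indecomposables\<close>

definition is_primitives ::
  "('o, 'm, 'z) additive_monoidal_category_scheme \<Rightarrow> ('o, 'm) bialgebra \<Rightarrow> 'o \<Rightarrow> 'm \<Rightarrow> bool" where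
  "is_primitives C H P e \<longleftrightarrow> is_equalizer C P e (comul H) (unit_left C H \<boxplus> unit_right C H)"
  for C (structure)

definition is_indecomposables ::
  "('o, 'm, 'z) additive_monoidal_category_scheme \<Rightarrow> ('o, 'm) bialgebra \<Rightarrow> 'o \<Rightarrow> 'm \<Rightarrow> bool" where
  "is_indecomposables C H Q q \<longleftrightarrow> is_coequalizer C Q q (mul H) (counit_left C H \<boxplus> counit_right C H)"
  for C (structure)

definition is_restricted_op ::
  "('o, 'm, 'z) additive_monoidal_category_scheme \<Rightarrow> ('o, 'm) bialgebra \<Rightarrow> 'o \<Rightarrow> 'm \<Rightarrow> 'm \<Rightarrow> bool" where
  "is_restricted_op C H P e c \<longleftrightarrow>
     c \<in> Hom C (P \<boxdot> P) (P \<boxdot> P) \<and> (e \<boxtimes> e) \<cdot> c = braid H \<cdot> (e \<boxtimes> e)"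
  for C (structure)

definition is_restricted_bracket ::
  "('o, 'm, 'z) additive_monoidal_category_scheme \<Rightarrow> ('o, 'm) bialgebra \<Rightarrow> 'o \<Rightarrow> 'm \<Rightarrow> 'm \<Rightarrow> bool" where
  "is_restricted_bracket C H P e b \<longleftrightarrow>
     b \<in> Hom C (P \<boxdot> P) P \<and> e \<cdot> b = bracket (commutator_lie C H) \<cdot> (e \<boxtimes> e)"
  for C (structure)

definition is_induced_op ::
  "('o, 'm, 'z) additive_monoidal_category_scheme \<Rightarrow> ('o, 'm) bialgebra \<Rightarrow> 'o \<Rightarrow> 'm \<Rightarrow> 'm \<Rightarrow> bool" where
  "is_induced_op C H Q q c \<longleftrightarrow>
     c \<in> Hom C (Q \<boxdot> Q) (Q \<boxdot> Q) \<and> c \<cdot> (q \<boxtimes> q) = (q \<boxtimes> q) \<cdot> braid H"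
  for C (structure)

definition is_induced_cobracket ::
  "('o, 'm, 'z) additive_monoidal_category_scheme \<Rightarrow> ('o, 'm) bialgebra \<Rightarrow> 'o \<Rightarrow> 'm \<Rightarrow> 'm \<Rightarrow> bool" where
  "is_induced_cobracket C H Q q d \<longleftrightarrow>
     d \<in> Hom C Q (Q \<boxdot> Q) \<and> d \<cdot> q = (q \<boxtimes> q) \<cdot> cobracket (cocommutator_colie C H)"
  for C (structure)

definition primitive_lie ::
  "('o, 'm, 'z) additive_monoidal_category_scheme \<Rightarrow> ('o, 'm) bialgebra \<Rightarrow> 'o \<Rightarrow> 'm \<Rightarrow> ('o, 'm) yb_lie_algebra" where
  "primitive_lie C H P e =
     \<lparr>lie_obj = P, lie_op = (THE c. is_restricted_op C H P e c),
      bracket = (THE b. is_restricted_bracket C H P e b)\<rparr>"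

definition indecomposable_colie ::
  "('o, 'm, 'z) additive_monoidal_category_scheme \<Rightarrow> ('o, 'm) bialgebra \<Rightarrow> 'o \<Rightarrow> 'm \<Rightarrow> ('o, 'm) yb_lie_coalgebra" where
  "indecomposable_colie C H Q q =
     \<lparr>colie_obj = Q, colie_op = (THE c. is_induced_op C H Q q c),
      cobracket = (THE d. is_induced_cobracket C H Q q d)\<rparr>"

text \<open>The functors depend on a choice of an equalizer \<open>e H : P H \<rightarrow> H\<close>, respectively of a
  coequalizer \<open>q H : H \<rightarrow> Q H\<close>, for every braided bialgebra \<open>H\<close>.
  On arrows they are given by the universal property.\<close>

definition P_obj where
  "P_obj C P e H = primitive_lie C H (P H) (e H)"

definition is_P_map where
  "is_P_map C P e H K f g \<longleftrightarrow> g \<in> Hom C (P H) (P K) \<and> e K \<cdot> g = f \<cdot> e H"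
  for C (structure)

definition P_arr where
  "P_arr C P e = (\<lambda>(H, K, f). (P_obj C P e H, P_obj C P e K, THE g. is_P_map C P e H K f g))"

definition Q_obj where
  "Q_obj C Q q H = indecomposable_colie C H (Q H) (q H)"

definition is_Q_map where
  "is_Q_map C Q q H K f g \<longleftrightarrow> g \<in> Hom C (Q H) (Q K) \<and> g \<cdot> q H = q K \<cdot> f"
  for C (structure)

definition Q_arr where
  "Q_arr C Q q = (\<lambda>(H, K, f). (Q_obj C Q q H, Q_obj C Q q K, THE g. is_Q_map C Q q H K f g))"

end

theory Submission
  imports Defs
begin

text \<open>For primitive \<open>x\<close> and \<open>y\<close> one has \<open>\<Delta>(xy) = xy \<otimes> 1 + 1 \<otimes> xy + x \<otimes> y + \<lambda>(x \<otimes> y)\<close>, and the last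
  two summands form a \<open>\<lambda>\<close>-invariant expression, so they cancel in \<open>\<Delta>(\<mu>(1 - \<lambda>)(x \<otimes> y))\<close>. Hence the commutator
  of primitives is primitive; since tensor powers of an equalizer are monic, the axioms of the
  YB-Lie algebra \<open>\<L>(H)\<close> restrict to \<open>P(H)\<close>. The opposite category interchanges
  \<open>t\<^sub>c\<close> with \<open>w\<^sub>c\<close>, algebras with coalgebras and equalizers with coequalizers, which reduces
  the statements about \<open>Q(H)\<close> to those about \<open>P(H)\<close>.\<close>

section \<open>Categories and monoidal coherence\<close>

text \<open>Before the bracket can restrict, the operator has to: \<open>\<lambda>\<close> applied
  to primitive arguments must land in \<open>P(H) \<otimes> P(H)\<close>. Two facts make this work.
  Inside \<open>H \<otimes> H\<close>, the object \<open>P(H) \<otimes> P(H)\<close> is cut out by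
  one equalizer condition in each factor, so preservation of equalizers is used for the existence of
  factorizations as well as for monicity. And the map sending x to
  \<open>1 \<otimes> x + x \<otimes> 1\<close> has the same compatibility with
  \<open>\<lambda>\<close> as \<open>\<Delta>\<close>; moving either of them across
  \<open>\<lambda>\<close> and exchanging the two on a primitive argument verifies both conditions.
  The bracket then depends on the restricted operator, because the formula for
  \<open>\<Delta>(xy)\<close> must also be applied to \<open>\<lambda>(x \<otimes> y)\<close>. The
  other obstacle is that no constraint is suppressed. Units get inserted at various places of
  threefold and fourfold tensor products, and each insertion has to be shown independent of the
  bracketing. This is where the coherence of the unit constraints with the associator is
  needed.\<close>

context category
begin

lemma in_HomI: "\<lbrakk>f \<in> Arr C; Dom C f = A; Cod C f = B\<rbrakk> \<Longrightarrow> f \<in> Hom C A B"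
  by (simp add: Hom_def)

lemma in_HomD:
  assumes "f \<in> Hom C A B"
  shows "f \<in> Arr C" "Dom C f = A" "Cod C f = B" "A \<in> Obj C" "B \<in> Obj C"
  using assms dom_obj cod_obj by (auto simp: Hom_def)

lemma arr_obj [simp]:
  assumes "f \<in> Arr C"
  shows "Dom C f \<in> Obj C" "Cod C f \<in> Obj C"
  using assms dom_obj cod_obj by auto

lemma comp_arr [simp]:
  assumes "f \<in> Arr C" "g \<in> Arr C" "Cod C f = Dom C g"
  shows "g \<cdot> f \<in> Arr C" "Dom C (g \<cdot> f) = Dom C f" "Cod C (g \<cdot> f) = Cod C g"
  using comp_hom[OF assms] by (auto simp: Hom_def)

lemma ide_arr [simp]:
  assumes "A \<in> Obj C"
  shows "\<i> A \<in> Arr C" "Dom C (\<i> A) = A" "Cod C (\<i> A) = A"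
  using ide_hom[OF assms] by (auto simp: Hom_def)

lemma comp_ide [simp]:
  assumes "f \<in> Arr C"
  shows "Cod C f = A \<Longrightarrow> \<i> A \<cdot> f = f" "Dom C f = A \<Longrightarrow> f \<cdot> \<i> A = f"
  using assms comp_ide_left comp_ide_right by auto

declare comp_assoc [simp]

text \<open>Simplification nests composites to the right, so a known equation for
  \<open>g \<cdot> f\<close> no longer matches once something follows on the right. This rule
  supplies the version with a tail \<open>x\<close> and is used throughout to make such equations
  applicable again.\<close>

lemma comp_reassoc:
  assumes "g \<cdot> f = k" and "f \<in> Arr C" "g \<in> Arr C" "Cod C f = Dom C g"
    and "x \<in> Arr C" "Cod C x = Dom C f"
  shows "g \<cdot> (f \<cdot> x) = k \<cdot> x"
  using assms comp_assoc[of x f g] by simp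

lemma Inv_equality:
  assumes "f \<in> Arr C" "g \<in> Hom C (Cod C f) (Dom C f)" "g \<cdot> f = \<i> (Dom C f)" "f \<cdot> g = \<i> (Cod C f)"
  shows "Inv f = g"
  unfolding Inv_def
proof (rule the_equality)
  fix k assume k: "k \<in> Hom C (Cod C f) (Dom C f) \<and> k \<cdot> f = \<i> (Dom C f) \<and> f \<cdot> k = \<i> (Cod C f)"
  have "k = (g \<cdot> f) \<cdot> k"
    using k assms(1-3) by (auto simp: Hom_def)
  also have "\<dots> = g"
    using k assms(1,2) by (auto simp: Hom_def)
  finally show "k = g" .
qed (use assms in simp)

lemma Inv_props:
  assumes "is_iso C f"
  shows "Inv f \<in> Arr C" "Dom C (Inv f) = Cod C f" "Cod C (Inv f) = Dom C f"
    "Inv f \<cdot> f = \<i> (Dom C f)" "f \<cdot> Inv f = \<i> (Cod C f)" "f \<in> Arr C"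
    "is_iso C (Inv f)" "Inv (Inv f) = f"
proof -
  obtain g where g: "f \<in> Arr C" "g \<in> Hom C (Cod C f) (Dom C f)" "g \<cdot> f = \<i> (Dom C f)" "f \<cdot> g = \<i> (Cod C f)"
    using assms unfolding is_iso_def by auto
  have "Inv f = g" by (rule Inv_equality[OF g])
  moreover have "Inv g = f" by (rule Inv_equality) (use g in \<open>auto simp: Hom_def\<close>)
  ultimately show "Inv f \<in> Arr C" "Dom C (Inv f) = Cod C f" "Cod C (Inv f) = Dom C f"
    "Inv f \<cdot> f = \<i> (Dom C f)" "f \<cdot> Inv f = \<i> (Cod C f)" "f \<in> Arr C"
    "is_iso C (Inv f)" "Inv (Inv f) = f"
    using g by (auto simp: Hom_def is_iso_def)
qed

lemma Inv_cancel:
  assumes "is_iso C f" "x \<in> Arr C"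
  shows "Cod C x = Dom C f \<Longrightarrow> Inv f \<cdot> (f \<cdot> x) = x" "Cod C x = Cod C f \<Longrightarrow> f \<cdot> (Inv f \<cdot> x) = x"
  using Inv_props[OF assms(1)] assms(2) by (simp_all flip: comp_assoc)

lemma iso_cancel_right:
  assumes "f \<cdot> h = g \<cdot> h" "is_iso C h" "f \<in> Arr C" "g \<in> Arr C" "Dom C f = Cod C h" "Dom C g = Cod C h"
  shows "f = g"
proof -
  have "(f \<cdot> h) \<cdot> Inv h = (g \<cdot> h) \<cdot> Inv h" using assms(1) by simp
  then show ?thesis using assms(3-) Inv_props[OF assms(2)] by simp
qed

lemma iso_cancel_left:
  assumes "h \<cdot> f = h \<cdot> g" "is_iso C h" "f \<in> Arr C" "g \<in> Arr C" "Cod C f = Dom C h" "Cod C g = Dom C h"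
  shows "f = g"
proof -
  have "Inv h \<cdot> (h \<cdot> f) = Inv h \<cdot> (h \<cdot> g)" using assms(1) by simp
  then show ?thesis using assms(3-) Inv_cancel(1)[OF assms(2)] by simp
qed

text \<open>Cancelling \<open>k\<close> on the right reduces the claim to the given square. It
  serves to pass naturality from the constraints to their inverses.\<close>

lemma iso_commute_Inv:
  assumes "h \<cdot> f = g \<cdot> k" "is_iso C h" "is_iso C k" "f \<in> Arr C" "g \<in> Arr C"
    "Cod C f = Dom C h" "Dom C f = Dom C k" "Dom C g = Cod C k" "Cod C g = Cod C h"
  shows "Inv h \<cdot> g = f \<cdot> Inv k"
proof (rule iso_cancel_right[OF _ assms(3)])
  show "(Inv h \<cdot> g) \<cdot> k = (f \<cdot> Inv k) \<cdot> k"
    using assms(4-) Inv_props[OF assms(2)] Inv_props[OF assms(3)] Inv_cancel(1)[OF assms(2)]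
    by (simp flip: assms(1))
qed (use assms(4-) Inv_props[OF assms(2)] Inv_props[OF assms(3)] in auto)

section \<open>Monics and equalizers\<close>

definition monic where
  "monic f \<longleftrightarrow> f \<in> Arr C \<and> (\<forall>g h. g \<in> Arr C \<longrightarrow> h \<in> Arr C \<longrightarrow> Cod C g = Dom C f \<longrightarrow> Cod C h = Dom C f \<longrightarrow>
     f \<cdot> g = f \<cdot> h \<longrightarrow> g = h)"

lemma monicD:
  assumes "monic f" "f \<cdot> g = f \<cdot> h" "g \<in> Arr C" "h \<in> Arr C" "Cod C g = Dom C f" "Cod C h = Dom C f"
  shows "g = h"
  using assms unfolding monic_def by blast

lemma monic_comp:
  assumes "monic f" "monic g" "Cod C g = Dom C f"
  shows "monic (f \<cdot> g)"
  unfolding monic_def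
proof (intro conjI allI impI)
  show "f \<cdot> g \<in> Arr C" using assms by (simp add: monic_def)
next
  fix x y assume *: "x \<in> Arr C" "y \<in> Arr C" "Cod C x = Dom C (f \<cdot> g)" "Cod C y = Dom C (f \<cdot> g)"
    "(f \<cdot> g) \<cdot> x = (f \<cdot> g) \<cdot> y"
  then have "f \<cdot> (g \<cdot> x) = f \<cdot> (g \<cdot> y)" using assms by (simp add: monic_def)
  then have "g \<cdot> x = g \<cdot> y" by (rule monicD[OF assms(1)]) (use * assms in \<open>auto simp: monic_def\<close>)
  then show "x = y" by (rule monicD[OF assms(2)]) (use * assms in \<open>auto simp: monic_def\<close>)
qed

lemma equalizer_props:
  assumes "is_equalizer C E e f g"
  shows "f \<in> Arr C" "g \<in> Arr C" "Dom C g = Dom C f" "Cod C g = Cod C f"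
    "e \<in> Arr C" "Dom C e = E" "Cod C e = Dom C f" "E \<in> Obj C" "f \<cdot> e = g \<cdot> e"
  using assms dom_obj by (auto simp: is_equalizer_def Hom_def)

lemma equalizer_factor:
  assumes "is_equalizer C E e f g" "x \<in> Arr C" "Cod C x = Dom C f" "f \<cdot> x = g \<cdot> x"
  obtains u where "u \<in> Arr C" "Dom C u = Dom C x" "Cod C u = E" "e \<cdot> u = x"
proof -
  have "x \<in> Hom C (Dom C x) (Dom C f)" using assms by (auto intro: in_HomI)
  with assms(1,4) obtain u where "u \<in> Hom C (Dom C x) E" "e \<cdot> u = x"
    unfolding is_equalizer_def by meson
  then show ?thesis using that[of u] by (simp add: Hom_def)
qed

lemma equalizer_monic:
  assumes "is_equalizer C E e f g"
  shows "monic e"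
  unfolding monic_def
proof (intro conjI allI impI)
  note e = equalizer_props[OF assms]
  show "e \<in> Arr C" by (fact e)
  fix x y assume *: "x \<in> Arr C" "y \<in> Arr C" "Cod C x = Dom C e" "Cod C y = Dom C e" "e \<cdot> x = e \<cdot> y"
  have "f \<cdot> (e \<cdot> x) = g \<cdot> (e \<cdot> x)"
    using e * by (simp flip: comp_assoc)
  \<comment> \<open>\<open>monic\<close> compares arrows that share only a codomain; equal
    composites force equal domains, which the uniqueness clause of the equalizer needs.\<close>
  moreover have xy: "Dom C x = Dom C y"
    using arg_cong[OF *(5), of "Dom C"] *(1-4) e by simp
  moreover have "e \<cdot> x \<in> Hom C (Dom C x) (Dom C f)"
    using e *(1-4) by (simp add: Hom_def)
  ultimately have "\<exists>!u. u \<in> Hom C (Dom C x) E \<and> e \<cdot> u = e \<cdot> x"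
    using assms unfolding is_equalizer_def by blast
  moreover have "x \<in> Hom C (Dom C x) E" "y \<in> Hom C (Dom C x) E"
    using * e xy by (auto simp: Hom_def)
  ultimately show "x = y" using * by metis
qed

end

section \<open>Calculus of tensor products and constraints\<close>

context monoidal_category
begin

declare tensor_obj [simp] unit_obj [simp] tensor_ide [simp]

lemma tensor_arr [simp]:
  assumes "f \<in> Arr C" "g \<in> Arr C"
  shows "f \<boxtimes> g \<in> Arr C" "Dom C (f \<boxtimes> g) = Dom C f \<boxdot> Dom C g" "Cod C (f \<boxtimes> g) = Cod C f \<boxdot> Cod C g"
  using tensor_hom[OF assms] by (auto simp: Hom_def)

text \<open>Oriented so that simplification merges neighbouring tensor products. Steps that have to
  split a tensor product, or keep it split, remove the rule locally.\<close>

lemma interchange [simp]: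
  assumes "f \<in> Arr C" "g \<in> Arr C" "f' \<in> Arr C" "g' \<in> Arr C" "Cod C f = Dom C g" "Cod C f' = Dom C g'"
  shows "(g \<boxtimes> g') \<cdot> (f \<boxtimes> f') = (g \<cdot> f) \<boxtimes> (g' \<cdot> f')"
  using tensor_comp[OF assms] by simp

lemma interchange_assoc [simp]:
  assumes "f \<in> Arr C" "g \<in> Arr C" "f' \<in> Arr C" "g' \<in> Arr C" "Cod C f = Dom C g" "Cod C f' = Dom C g'"
    "x \<in> Arr C" "Cod C x = Dom C f \<boxdot> Dom C f'"
  shows "(g \<boxtimes> g') \<cdot> ((f \<boxtimes> f') \<cdot> x) = ((g \<cdot> f) \<boxtimes> (g' \<cdot> f')) \<cdot> x"
  by (rule comp_reassoc[OF interchange]) (use assms in auto)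

lemma assoc_arr [simp]:
  assumes "A \<in> Obj C" "B \<in> Obj C" "D \<in> Obj C"
  shows "\<a>[A, B, D] \<in> Arr C" "Dom C \<a>[A, B, D] = A \<boxdot> B \<boxdot> D" "Cod C \<a>[A, B, D] = A \<boxdot> (B \<boxdot> D)"
    "Inv \<a>[A, B, D] \<in> Arr C" "Dom C (Inv \<a>[A, B, D]) = A \<boxdot> (B \<boxdot> D)" "Cod C (Inv \<a>[A, B, D]) = A \<boxdot> B \<boxdot> D"
    "\<a>[A, B, D] \<cdot> Inv \<a>[A, B, D] = \<i> (A \<boxdot> (B \<boxdot> D))" "Inv \<a>[A, B, D] \<cdot> \<a>[A, B, D] = \<i> (A \<boxdot> B \<boxdot> D)"
    "Inv (Inv \<a>[A, B, D]) = \<a>[A, B, D]"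
  using assoc_hom[OF assms] Inv_props[OF assoc_iso[OF assms]] by (auto simp: Hom_def)

lemma assoc_cancel [simp]:
  assumes "A \<in> Obj C" "B \<in> Obj C" "D \<in> Obj C" "x \<in> Arr C"
  shows "Cod C x = A \<boxdot> (B \<boxdot> D) \<Longrightarrow> \<a>[A, B, D] \<cdot> (Inv \<a>[A, B, D] \<cdot> x) = x"
    "Cod C x = A \<boxdot> B \<boxdot> D \<Longrightarrow> Inv \<a>[A, B, D] \<cdot> (\<a>[A, B, D] \<cdot> x) = x"
  using Inv_cancel[OF assoc_iso[OF assms(1-3)] assms(4)] assms(1-3) by auto

lemma lunit_arr [simp]:
  assumes "A \<in> Obj C"
  shows "\<l>[A] \<in> Arr C" "Dom C \<l>[A] = \<I> \<boxdot> A" "Cod C \<l>[A] = A"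
    "Inv \<l>[A] \<in> Arr C" "Dom C (Inv \<l>[A]) = A" "Cod C (Inv \<l>[A]) = \<I> \<boxdot> A"
    "\<l>[A] \<cdot> Inv \<l>[A] = \<i> A" "Inv \<l>[A] \<cdot> \<l>[A] = \<i> (\<I> \<boxdot> A)" "Inv (Inv \<l>[A]) = \<l>[A]"
  using lunit_hom[OF assms] Inv_props[OF lunit_iso[OF assms]] by (auto simp: Hom_def)

lemma runit_arr [simp]:
  assumes "A \<in> Obj C"
  shows "\<r>[A] \<in> Arr C" "Dom C \<r>[A] = A \<boxdot> \<I>" "Cod C \<r>[A] = A"
    "Inv \<r>[A] \<in> Arr C" "Dom C (Inv \<r>[A]) = A" "Cod C (Inv \<r>[A]) = A \<boxdot> \<I>"
    "\<r>[A] \<cdot> Inv \<r>[A] = \<i> A" "Inv \<r>[A] \<cdot> \<r>[A] = \<i> (A \<boxdot> \<I>)" "Inv (Inv \<r>[A]) = \<r>[A]"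
  using runit_hom[OF assms] Inv_props[OF runit_iso[OF assms]] by (auto simp: Hom_def)

lemma Inv_assoc_natural:
  assumes "f \<in> Arr C" "g \<in> Arr C" "h \<in> Arr C"
  shows "Inv \<a>[Cod C f, Cod C g, Cod C h] \<cdot> (f \<boxtimes> (g \<boxtimes> h)) = (f \<boxtimes> g \<boxtimes> h) \<cdot> Inv \<a>[Dom C f, Dom C g, Dom C h]"
  by (rule iso_commute_Inv[OF assoc_natural]) (use assms in \<open>auto intro: assoc_iso\<close>)

lemma Inv_lunit_natural:
  assumes "f \<in> Arr C"
  shows "Inv \<l>[Cod C f] \<cdot> f = (\<i> \<I> \<boxtimes> f) \<cdot> Inv \<l>[Dom C f]"
  by (rule iso_commute_Inv[OF lunit_natural]) (use assms in \<open>auto intro: lunit_iso\<close>)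

lemma Inv_runit_natural:
  assumes "f \<in> Arr C"
  shows "Inv \<r>[Cod C f] \<cdot> f = (f \<boxtimes> \<i> \<I>) \<cdot> Inv \<r>[Dom C f]"
  by (rule iso_commute_Inv[OF runit_natural]) (use assms in \<open>auto intro: runit_iso\<close>)

lemma tensor_iso:
  assumes "is_iso C f" "is_iso C g"
  shows "is_iso C (f \<boxtimes> g)" "Inv (f \<boxtimes> g) = Inv f \<boxtimes> Inv g"
proof -
  note fg = Inv_props[OF assms(1)] Inv_props[OF assms(2)]
  show "is_iso C (f \<boxtimes> g)"
    unfolding is_iso_def using fg
    by (intro conjI bexI[of _ "Inv f \<boxtimes> Inv g"]) (auto simp: Hom_def)
  show "Inv (f \<boxtimes> g) = Inv f \<boxtimes> Inv g"
    by (rule Inv_equality) (use fg in \<open>auto simp: Hom_def\<close>)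
qed

lemma ide_iso: "A \<in> Obj C \<Longrightarrow> is_iso C (\<i> A)"
  unfolding is_iso_def by (auto intro!: bexI[of _ "\<i> A"] simp: Hom_def)

lemma Inv_ide [simp]: "A \<in> Obj C \<Longrightarrow> Inv (\<i> A) = \<i> A"
  by (rule Inv_equality) (auto simp: Hom_def)

lemma comp_iso:
  assumes "is_iso C f" "is_iso C g" "Cod C f = Dom C g"
  shows "is_iso C (g \<cdot> f)" "Inv (g \<cdot> f) = Inv f \<cdot> Inv g"
proof -
  note fg = Inv_props[OF assms(1)] Inv_props[OF assms(2)] Inv_cancel[OF assms(1)] Inv_cancel[OF assms(2)]
  show "is_iso C (g \<cdot> f)"
    unfolding is_iso_def using fg assms(3)
    by (intro conjI bexI[of _ "Inv f \<cdot> Inv g"]) (auto simp: Hom_def)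
  show "Inv (g \<cdot> f) = Inv f \<cdot> Inv g"
    by (rule Inv_equality) (use fg assms(3) in \<open>auto simp: Hom_def\<close>)
qed

text \<open>Naturality of the unit constraints makes tensoring with the unit object isomorphic to
  the identity functor. The lemma lets coherence equations be proved after an extra unit factor has
  been added.\<close>

lemma unit_tensor_faithful:
  assumes "f \<in> Arr C" "g \<in> Arr C" "Dom C f = Dom C g" "Cod C f = Cod C g"
  shows "\<i> \<I> \<boxtimes> f = \<i> \<I> \<boxtimes> g \<Longrightarrow> f = g" "f \<boxtimes> \<i> \<I> = g \<boxtimes> \<i> \<I> \<Longrightarrow> f = g"
proof -
  assume "\<i> \<I> \<boxtimes> f = \<i> \<I> \<boxtimes> g"
  then have "f \<cdot> \<l>[Dom C f] = g \<cdot> \<l>[Dom C f]"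
    using lunit_natural[of f] lunit_natural[of g] assms by simp
  then show "f = g" by (rule iso_cancel_right) (use assms in \<open>auto intro: lunit_iso\<close>)
next
  assume "f \<boxtimes> \<i> \<I> = g \<boxtimes> \<i> \<I>"
  then have "f \<cdot> \<r>[Dom C f] = g \<cdot> \<r>[Dom C f]"
    using runit_natural[of f] runit_natural[of g] assms by simp
  then show "f = g" by (rule iso_cancel_right) (use assms in \<open>auto intro: runit_iso\<close>)
qed

text \<open>Kelly: the two unit coherences below already follow from the pentagon and the triangle.\<close>

lemma lunit_tensor:
  assumes A: "A \<in> Obj C" and B: "B \<in> Obj C"
  shows "\<l>[A \<boxdot> B] \<cdot> \<a>[\<I>, A, B] = \<l>[A] \<boxtimes> \<i> B"
proof (rule unit_tensor_faithful(1))
  \<comment> \<open>The extra unit on the left brings in the pentagon for \<open>\<I>\<close>,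
    \<open>\<I>\<close>, \<open>A\<close>, \<open>B\<close>. The two associators composed on the
    right complete one side of it and are cancelled at the end as isomorphisms.\<close>
  have "(\<i> \<I> \<boxtimes> (\<l>[A \<boxdot> B] \<cdot> \<a>[\<I>, A, B])) \<cdot> \<a>[\<I>, \<I> \<boxdot> A, B] \<cdot> (\<a>[\<I>, \<I>, A] \<boxtimes> \<i> B)
    = (\<i> \<I> \<boxtimes> \<l>[A \<boxdot> B]) \<cdot> ((\<i> \<I> \<boxtimes> \<a>[\<I>, A, B]) \<cdot> \<a>[\<I>, \<I> \<boxdot> A, B] \<cdot> (\<a>[\<I>, \<I>, A] \<boxtimes> \<i> B))"
    using A B by simp
  also have "\<dots> = ((\<i> \<I> \<boxtimes> \<l>[A \<boxdot> B]) \<cdot> \<a>[\<I>, \<I>, A \<boxdot> B]) \<cdot> \<a>[\<I> \<boxdot> \<I>, A, B]"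
    using A B by (simp flip: pentagon)
  also have "\<dots> = (\<r>[\<I>] \<boxtimes> (\<i> A \<boxtimes> \<i> B)) \<cdot> \<a>[\<I> \<boxdot> \<I>, A, B]"
    using A B by (simp del: comp_assoc add: triangle)
  also have "\<dots> = \<a>[\<I>, A, B] \<cdot> (\<r>[\<I>] \<boxtimes> \<i> A \<boxtimes> \<i> B)"
    using assoc_natural[of "\<r>[\<I>]" "\<i> A" "\<i> B"] A B by simp
  also have "\<dots> = (\<a>[\<I>, A, B] \<cdot> (\<i> \<I> \<boxtimes> \<l>[A] \<boxtimes> \<i> B)) \<cdot> (\<a>[\<I>, \<I>, A] \<boxtimes> \<i> B)"
    using A B by (simp add: triangle)
  also have "\<dots> = (\<i> \<I> \<boxtimes> (\<l>[A] \<boxtimes> \<i> B)) \<cdot> \<a>[\<I>, \<I> \<boxdot> A, B] \<cdot> (\<a>[\<I>, \<I>, A] \<boxtimes> \<i> B)"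
    using assoc_natural[of "\<i> \<I>" "\<l>[A]" "\<i> B"] A B by simp
  finally show "\<i> \<I> \<boxtimes> (\<l>[A \<boxdot> B] \<cdot> \<a>[\<I>, A, B]) = \<i> \<I> \<boxtimes> (\<l>[A] \<boxtimes> \<i> B)"
    by (rule iso_cancel_right)
      (use A B in \<open>auto intro!: comp_iso(1) tensor_iso(1) assoc_iso ide_iso\<close>)
qed (use A B in auto)

lemma runit_tensor:
  assumes A: "A \<in> Obj C" and B: "B \<in> Obj C"
  shows "(\<i> A \<boxtimes> \<r>[B]) \<cdot> \<a>[A, B, \<I>] = \<r>[A \<boxdot> B]"
proof (rule unit_tensor_faithful(2))
  \<comment> \<open>The mirror image: the pentagon for \<open>A\<close>, \<open>B\<close>,
    \<open>\<I>\<close>, \<open>\<I>\<close>, with an associator on the left to be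
    cancelled.\<close>
  have "\<a>[A, B, \<I>] \<cdot> (((\<i> A \<boxtimes> \<r>[B]) \<cdot> \<a>[A, B, \<I>]) \<boxtimes> \<i> \<I>)
    = (\<a>[A, B, \<I>] \<cdot> (\<i> A \<boxtimes> \<r>[B] \<boxtimes> \<i> \<I>)) \<cdot> (\<a>[A, B, \<I>] \<boxtimes> \<i> \<I>)"
    using A B by simp
  also have "\<dots> = (\<i> A \<boxtimes> (\<r>[B] \<boxtimes> \<i> \<I>)) \<cdot> \<a>[A, B \<boxdot> \<I>, \<I>] \<cdot> (\<a>[A, B, \<I>] \<boxtimes> \<i> \<I>)"
    using assoc_natural[of "\<i> A" "\<r>[B]" "\<i> \<I>"] A B by simp
  also have "\<dots> = (\<i> A \<boxtimes> (\<i> B \<boxtimes> \<l>[\<I>])) \<cdot> ((\<i> A \<boxtimes> \<a>[B, \<I>, \<I>]) \<cdot> \<a>[A, B \<boxdot> \<I>, \<I>] \<cdot> (\<a>[A, B, \<I>] \<boxtimes> \<i> \<I>))"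
    using A B by (simp add: triangle)
  also have "\<dots> = ((\<i> A \<boxtimes> (\<i> B \<boxtimes> \<l>[\<I>])) \<cdot> \<a>[A, B, \<I> \<boxdot> \<I>]) \<cdot> \<a>[A \<boxdot> B, \<I>, \<I>]"
    using A B by (simp flip: pentagon)
  also have "\<dots> = \<a>[A, B, \<I>] \<cdot> ((\<i> (A \<boxdot> B) \<boxtimes> \<l>[\<I>]) \<cdot> \<a>[A \<boxdot> B, \<I>, \<I>])"
    using assoc_natural[of "\<i> A" "\<i> B" "\<l>[\<I>]"] A B by (simp flip: comp_assoc)
  also have "\<dots> = \<a>[A, B, \<I>] \<cdot> (\<r>[A \<boxdot> B] \<boxtimes> \<i> \<I>)"
    using A B by (simp add: triangle)
  finally show "((\<i> A \<boxtimes> \<r>[B]) \<cdot> \<a>[A, B, \<I>]) \<boxtimes> \<i> \<I> = \<r>[A \<boxdot> B] \<boxtimes> \<i> \<I>"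
    by (rule iso_cancel_left) (use A B in \<open>auto intro: assoc_iso\<close>)
qed (use A B in auto)

end

section \<open>Unit insertions and additive structure\<close>

context monoidal_category
begin

lemma Inv_lunit_tensor:
  assumes "X \<in> Obj C" "Y \<in> Obj C"
  shows "\<a>[\<I>, X, Y] \<cdot> (Inv \<l>[X] \<boxtimes> \<i> Y) = Inv \<l>[X \<boxdot> Y]"
proof (rule iso_cancel_left)
  show "\<l>[X \<boxdot> Y] \<cdot> (\<a>[\<I>, X, Y] \<cdot> (Inv \<l>[X] \<boxtimes> \<i> Y)) = \<l>[X \<boxdot> Y] \<cdot> Inv \<l>[X \<boxdot> Y]"
    using assms comp_reassoc[OF lunit_tensor[OF assms], of "Inv \<l>[X] \<boxtimes> \<i> Y"] by simp
qed (use assms lunit_iso in auto)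

lemma Inv_runit_tensor:
  assumes "X \<in> Obj C" "Y \<in> Obj C"
  shows "\<a>[X, Y, \<I>] \<cdot> Inv \<r>[X \<boxdot> Y] = \<i> X \<boxtimes> Inv \<r>[Y]"
proof (rule iso_cancel_left)
  show "(\<i> X \<boxtimes> \<r>[Y]) \<cdot> (\<a>[X, Y, \<I>] \<cdot> Inv \<r>[X \<boxdot> Y]) = (\<i> X \<boxtimes> \<r>[Y]) \<cdot> (\<i> X \<boxtimes> Inv \<r>[Y])"
    using assms comp_reassoc[OF runit_tensor[OF assms], of "Inv \<r>[X \<boxdot> Y]"] by simp
  show "is_iso C (\<i> X \<boxtimes> \<r>[Y])"
    using assms by (intro tensor_iso ide_iso runit_iso)
qed (use assms in auto)

lemma Inv_triangle:
  assumes "X \<in> Obj C" "Y \<in> Obj C"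
  shows "\<a>[X, \<I>, Y] \<cdot> (Inv \<r>[X] \<boxtimes> \<i> Y) = \<i> X \<boxtimes> Inv \<l>[Y]"
proof (rule iso_cancel_left)
  show "(\<i> X \<boxtimes> \<l>[Y]) \<cdot> (\<a>[X, \<I>, Y] \<cdot> (Inv \<r>[X] \<boxtimes> \<i> Y)) = (\<i> X \<boxtimes> \<l>[Y]) \<cdot> (\<i> X \<boxtimes> Inv \<l>[Y])"
    using assms comp_reassoc[OF triangle[OF assms], of "Inv \<r>[X] \<boxtimes> \<i> Y"] by simp
  show "is_iso C (\<i> X \<boxtimes> \<l>[Y])"
    using assms by (intro tensor_iso ide_iso lunit_iso)
qed (use assms in auto)

text \<open>For a point \<open>u\<close> these are the maps sending x to
  \<open>u \<otimes> x\<close> and \<open>x \<otimes> u\<close>, with the unit constraint absorbed.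
  The object \<open>X\<close> is a parameter because rebracketing turns an insertion next to
  \<open>H\<close> into one next to \<open>H \<boxdot> H\<close>.\<close>

definition ins_left where "ins_left u X = (u \<boxtimes> \<i> X) \<cdot> Inv \<l>[X]"
definition ins_right where "ins_right u X = (\<i> X \<boxtimes> u) \<cdot> Inv \<r>[X]"

context
  fixes u H
  assumes u: "u \<in> Arr C" "Dom C u = \<I>" "Cod C u = H"
begin

lemma cod_obj_point [simp]: "H \<in> Obj C"
  using u arr_obj by auto

lemma ins_arr [simp]:
  assumes "X \<in> Obj C"
  shows "ins_left u X \<in> Arr C" "Dom C (ins_left u X) = X" "Cod C (ins_left u X) = H \<boxdot> X"
    "ins_right u X \<in> Arr C" "Dom C (ins_right u X) = X" "Cod C (ins_right u X) = X \<boxdot> H"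
  using assms u by (simp_all add: ins_left_def ins_right_def)

lemma ins_left_natural:
  assumes "f \<in> Arr C" "Dom C f = X" "Cod C f = Y"
  shows "(\<i> H \<boxtimes> f) \<cdot> ins_left u X = ins_left u Y \<cdot> f"
proof -
  have "Inv \<l>[Y] \<cdot> f = (\<i> \<I> \<boxtimes> f) \<cdot> Inv \<l>[X]"
    using Inv_lunit_natural[OF assms(1)] assms by simp
  then show ?thesis
    using assms u arr_obj[OF assms(1)] by (simp add: ins_left_def)
qed

lemma ins_right_natural:
  assumes "f \<in> Arr C" "Dom C f = X" "Cod C f = Y"
  shows "(f \<boxtimes> \<i> H) \<cdot> ins_right u X = ins_right u Y \<cdot> f"
proof -
  have "Inv \<r>[Y] \<cdot> f = (f \<boxtimes> \<i> \<I>) \<cdot> Inv \<r>[X]"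
    using Inv_runit_natural[OF assms(1)] assms by simp
  then show ?thesis
    using assms u arr_obj[OF assms(1)] by (simp add: ins_right_def)
qed

text \<open>Naturality of the associator moves \<open>u\<close> out of the way and leaves a
  coherence of the unit constraints: the one for \<open>\<l>\<close> here, the one for
  \<open>\<r>\<close> in \<open>assoc_ins_right\<close>, and the triangle in
  \<open>assoc_ins_middle\<close>. Together they make the insertion of a point independent of the
  bracketing.\<close>

lemma assoc_ins_left:
  assumes "X \<in> Obj C" "Y \<in> Obj C"
  shows "\<a>[H, X, Y] \<cdot> (ins_left u X \<boxtimes> \<i> Y) = ins_left u (X \<boxdot> Y)"
proof -
  have "\<a>[H, X, Y] \<cdot> (ins_left u X \<boxtimes> \<i> Y) = (\<a>[H, X, Y] \<cdot> (u \<boxtimes> \<i> X \<boxtimes> \<i> Y)) \<cdot> (Inv \<l>[X] \<boxtimes> \<i> Y)"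
    using assms u by (simp add: ins_left_def)
  also have "\<dots> = (u \<boxtimes> (\<i> X \<boxtimes> \<i> Y)) \<cdot> (\<a>[\<I>, X, Y] \<cdot> (Inv \<l>[X] \<boxtimes> \<i> Y))"
    using assms u assoc_natural[of u "\<i> X" "\<i> Y"] by simp
  finally show ?thesis
    using assms u by (simp add: ins_left_def Inv_lunit_tensor)
qed

lemma assoc_ins_right:
  assumes "X \<in> Obj C" "Y \<in> Obj C"
  shows "\<a>[X, Y, H] \<cdot> ins_right u (X \<boxdot> Y) = \<i> X \<boxtimes> ins_right u Y"
proof -
  have "\<a>[X, Y, H] \<cdot> ins_right u (X \<boxdot> Y) = (\<a>[X, Y, H] \<cdot> (\<i> X \<boxtimes> \<i> Y \<boxtimes> u)) \<cdot> Inv \<r>[X \<boxdot> Y]"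
    using assms u by (simp add: ins_right_def)
  also have "\<dots> = (\<i> X \<boxtimes> (\<i> Y \<boxtimes> u)) \<cdot> (\<a>[X, Y, \<I>] \<cdot> Inv \<r>[X \<boxdot> Y])"
    using assms u assoc_natural[of "\<i> X" "\<i> Y" u] by (simp del: tensor_ide)
  finally show ?thesis
    using assms u by (simp add: ins_right_def Inv_runit_tensor)
qed

lemma assoc_ins_middle:
  assumes "X \<in> Obj C" "Y \<in> Obj C"
  shows "\<a>[X, H, Y] \<cdot> (ins_right u X \<boxtimes> \<i> Y) = \<i> X \<boxtimes> ins_left u Y"
proof -
  have "\<a>[X, H, Y] \<cdot> (ins_right u X \<boxtimes> \<i> Y) = (\<a>[X, H, Y] \<cdot> (\<i> X \<boxtimes> u \<boxtimes> \<i> Y)) \<cdot> (Inv \<r>[X] \<boxtimes> \<i> Y)"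
    using assms u by (simp add: ins_right_def)
  also have "\<dots> = (\<i> X \<boxtimes> (u \<boxtimes> \<i> Y)) \<cdot> (\<a>[X, \<I>, Y] \<cdot> (Inv \<r>[X] \<boxtimes> \<i> Y))"
    using assms u assoc_natural[of "\<i> X" u "\<i> Y"] by simp
  finally show ?thesis
    using assms u by (simp add: ins_left_def Inv_triangle)
qed

end

lemma Inv_assoc_eqI:
  assumes "\<a>[A, B, D] \<cdot> f = g" "A \<in> Obj C" "B \<in> Obj C" "D \<in> Obj C" "f \<in> Arr C" "Cod C f = A \<boxdot> B \<boxdot> D"
  shows "Inv \<a>[A, B, D] \<cdot> g = f"
  using assms(2-) by (simp flip: assms(1))

end

section \<open>The abelian groups of morphisms\<close>

context additive_monoidal_category
begin

lemma comm_group_hom: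
  assumes "f \<in> Arr C"
  shows "comm_group (hom_group C (Dom C f) (Cod C f))"
  using assms by (intro hom_comm_group) auto

lemma add_arr [simp]:
  assumes "f \<in> Arr C" "g \<in> Arr C" "Dom C g = Dom C f" "Cod C g = Cod C f"
  shows "f \<boxplus> g \<in> Arr C" "Dom C (f \<boxplus> g) = Dom C f" "Cod C (f \<boxplus> g) = Cod C f"
proof -
  interpret comm_group "hom_group C (Dom C f) (Cod C f)" by (rule comm_group_hom) fact
  show "f \<boxplus> g \<in> Arr C" "Dom C (f \<boxplus> g) = Dom C f" "Cod C (f \<boxplus> g) = Cod C f"
    using m_closed[of f g] assms by (auto simp: hom_group_def Hom_def)
qed

lemma add_assoc:
  assumes "f \<in> Arr C" "g \<in> Arr C" "h \<in> Arr C" "Dom C g = Dom C f" "Cod C g = Cod C f"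
    "Dom C h = Dom C f" "Cod C h = Cod C f"
  shows "(f \<boxplus> g) \<boxplus> h = f \<boxplus> (g \<boxplus> h)"
proof -
  interpret comm_group "hom_group C (Dom C f) (Cod C f)" by (rule comm_group_hom) fact
  show ?thesis
    using m_assoc[of f g h] assms by (auto simp: hom_group_def Hom_def)
qed

lemma add_commute:
  assumes "f \<in> Arr C" "g \<in> Arr C" "Dom C g = Dom C f" "Cod C g = Cod C f"
  shows "f \<boxplus> g = g \<boxplus> f"
proof -
  interpret comm_group "hom_group C (Dom C f) (Cod C f)" by (rule comm_group_hom) fact
  show ?thesis
    using m_comm[of f g] assms by (auto simp: hom_group_def Hom_def)
qed

lemma add_left_commute:
  assumes "f \<in> Arr C" "g \<in> Arr C" "h \<in> Arr C" "Dom C g = Dom C f" "Cod C g = Cod C f"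
    "Dom C h = Dom C f" "Cod C h = Cod C f"
  shows "f \<boxplus> (g \<boxplus> h) = g \<boxplus> (f \<boxplus> h)"
  using assms add_commute[of f g] by (simp flip: add_assoc)

lemma zero_arr [simp]:
  assumes "A \<in> Obj C" "B \<in> Obj C"
  shows "Zero C A B \<in> Arr C" "Dom C (Zero C A B) = A" "Cod C (Zero C A B) = B"
proof -
  interpret comm_group "hom_group C A B" by (rule hom_comm_group) fact+
  show "Zero C A B \<in> Arr C" "Dom C (Zero C A B) = A" "Cod C (Zero C A B) = B"
    using one_closed by (auto simp: hom_group_def Hom_def)
qed

lemma add_zero [simp]:
  assumes "f \<in> Arr C"
  shows "Zero C (Dom C f) (Cod C f) \<boxplus> f = f"
proof -
  interpret comm_group "hom_group C (Dom C f) (Cod C f)" by (rule comm_group_hom) fact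
  show ?thesis
    using l_one[of f] assms by (auto simp: hom_group_def Hom_def)
qed

lemma minus_arr [simp]:
  assumes "f \<in> Arr C" "g \<in> Arr C" "Dom C g = Dom C f" "Cod C g = Cod C f"
  shows "f \<boxminus> g \<in> Arr C" "Dom C (f \<boxminus> g) = Dom C f" "Cod C (f \<boxminus> g) = Cod C f" "(f \<boxminus> g) \<boxplus> g = f"
proof -
  interpret comm_group "hom_group C (Dom C f) (Cod C f)" by (rule comm_group_hom) fact
  show "f \<boxminus> g \<in> Arr C" "Dom C (f \<boxminus> g) = Dom C f" "Cod C (f \<boxminus> g) = Cod C f" "(f \<boxminus> g) \<boxplus> g = f"
    using m_closed[of f "inv\<^bsub>hom_group C (Dom C f) (Cod C f)\<^esub> g"] inv_closed[of g]
      m_assoc[of f "inv\<^bsub>hom_group C (Dom C f) (Cod C f)\<^esub> g" g] l_inv[of g] r_one[of f] assms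
    by (auto simp: hom_group_def Hom_def Minus_def)
qed

lemma add_right_cancel:
  assumes "f \<boxplus> h = g \<boxplus> h" "f \<in> Arr C" "g \<in> Arr C" "h \<in> Arr C" "Dom C g = Dom C f" "Cod C g = Cod C f"
    "Dom C h = Dom C f" "Cod C h = Cod C f"
  shows "f = g"
proof -
  interpret comm_group "hom_group C (Dom C f) (Cod C f)" by (rule comm_group_hom) fact
  show ?thesis
    using right_cancel[of h f g] assms by (auto simp: hom_group_def Hom_def)
qed

text \<open>Cancellation makes the difference the only solution \<open>k\<close> of
  \<open>f = k \<boxplus> g\<close>. Properties of differences are thereby reduced to properties of
  sums, without handling the group inverse behind \<open>\<boxminus>\<close>.\<close>

lemma minus_eqI:
  assumes "f = k \<boxplus> g" "k \<in> Arr C" "g \<in> Arr C" "Dom C g = Dom C k" "Cod C g = Cod C k"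
  shows "f \<boxminus> g = k"
  by (rule add_right_cancel[where h = g]) (use assms in auto)

lemma minus_self:
  assumes "f \<in> Arr C"
  shows "f \<boxminus> f = Zero C (Dom C f) (Cod C f)"
  by (rule minus_eqI) (use assms in auto)

lemma comp_add:
  assumes "f \<in> Arr C" "g \<in> Arr C" "Dom C g = Dom C f" "Cod C g = Cod C f" "h \<in> Arr C"
  shows "Dom C h = Cod C f \<Longrightarrow> h \<cdot> (f \<boxplus> g) = h \<cdot> f \<boxplus> h \<cdot> g"
    "Cod C h = Dom C f \<Longrightarrow> (f \<boxplus> g) \<cdot> h = f \<cdot> h \<boxplus> g \<cdot> h"
  using assms by (auto intro!: comp_add_left comp_add_right in_HomI)

lemma tensor_add:
  assumes "f \<in> Arr C" "g \<in> Arr C" "Dom C g = Dom C f" "Cod C g = Cod C f" "h \<in> Arr C"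
  shows "h \<boxtimes> (f \<boxplus> g) = h \<boxtimes> f \<boxplus> h \<boxtimes> g" "(f \<boxplus> g) \<boxtimes> h = f \<boxtimes> h \<boxplus> g \<boxtimes> h"
  using assms by (auto intro!: tensor_add_left tensor_add_right in_HomI)

lemma comp_minus:
  assumes "f \<in> Arr C" "g \<in> Arr C" "Dom C g = Dom C f" "Cod C g = Cod C f" "h \<in> Arr C"
  shows "Dom C h = Cod C f \<Longrightarrow> h \<cdot> (f \<boxminus> g) = h \<cdot> f \<boxminus> h \<cdot> g"
    "Cod C h = Dom C f \<Longrightarrow> (f \<boxminus> g) \<cdot> h = f \<cdot> h \<boxminus> g \<cdot> h"
proof -
  assume h: "Dom C h = Cod C f"
  show "h \<cdot> (f \<boxminus> g) = h \<cdot> f \<boxminus> h \<cdot> g"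
    by (rule minus_eqI[symmetric]) (use h assms in \<open>simp_all flip: comp_add\<close>)
next
  assume h: "Cod C h = Dom C f"
  show "(f \<boxminus> g) \<cdot> h = f \<cdot> h \<boxminus> g \<cdot> h"
    by (rule minus_eqI[symmetric]) (use h assms in \<open>simp_all flip: comp_add\<close>)
qed

lemma tensor_minus:
  assumes "f \<in> Arr C" "g \<in> Arr C" "Dom C g = Dom C f" "Cod C g = Cod C f" "h \<in> Arr C"
  shows "h \<boxtimes> (f \<boxminus> g) = h \<boxtimes> f \<boxminus> h \<boxtimes> g" "(f \<boxminus> g) \<boxtimes> h = f \<boxtimes> h \<boxminus> g \<boxtimes> h"
  by (rule minus_eqI[symmetric]; use assms in \<open>simp_all flip: tensor_add\<close>)+

text \<open>The locale assumes additivity of composition only; preservation of zero follows by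
  writing the zero arrow as its difference with itself.\<close>

lemma comp_zero:
  assumes "h \<in> Arr C" "A \<in> Obj C"
  shows "Dom C h = B \<Longrightarrow> h \<cdot> Zero C A B = Zero C A (Cod C h)"
    "Cod C h = B \<Longrightarrow> Zero C B A \<cdot> h = Zero C (Dom C h) A"
proof -
  assume B: "Dom C h = B"
  then have "B \<in> Obj C" using assms by auto
  then have "h \<cdot> Zero C A B = h \<cdot> (Zero C A B \<boxminus> Zero C A B)"
    using assms B by (simp add: minus_self)
  also have "\<dots> = Zero C A (Cod C h)"
    using assms B \<open>B \<in> Obj C\<close> minus_self[of "h \<cdot> Zero C A B"] by (simp del: minus_arr(4) add: comp_minus)
  finally show "h \<cdot> Zero C A B = Zero C A (Cod C h)" .
next
  assume B: "Cod C h = B"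
  then have "B \<in> Obj C" using assms by auto
  then have "Zero C B A \<cdot> h = (Zero C B A \<boxminus> Zero C B A) \<cdot> h"
    using assms B by (simp add: minus_self)
  also have "\<dots> = Zero C (Dom C h) A"
    using assms B \<open>B \<in> Obj C\<close> minus_self[of "Zero C B A \<cdot> h"] by (simp del: minus_arr(4) add: comp_minus)
  finally show "Zero C B A \<cdot> h = Zero C (Dom C h) A" .
qed

end

section \<open>Restriction of YB-Lie structures along equalizers\<close>

context additive_monoidal_category
begin

lemma on_arr [simp]:
  assumes "V \<in> Obj C" "c \<in> Arr C" "Dom C c = V \<boxdot> V" "Cod C c = V \<boxdot> V"
  shows "on12 C V c \<in> Arr C" "Dom C (on12 C V c) = V \<boxdot> V \<boxdot> V" "Cod C (on12 C V c) = V \<boxdot> V \<boxdot> V"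
    "on23 C V c \<in> Arr C" "Dom C (on23 C V c) = V \<boxdot> V \<boxdot> V" "Cod C (on23 C V c) = V \<boxdot> V \<boxdot> V"
    "t_op C V c \<in> Arr C" "Dom C (t_op C V c) = V \<boxdot> V \<boxdot> V" "Cod C (t_op C V c) = V \<boxdot> V \<boxdot> V"
    "w_op C V c \<in> Arr C" "Dom C (w_op C V c) = V \<boxdot> V \<boxdot> V" "Cod C (w_op C V c) = V \<boxdot> V \<boxdot> V"
  using assms by (simp_all add: on12_def on23_def t_op_def w_op_def)

text \<open>For \<open>on23\<close>, which is a conjugate by the associator, the intertwining
  property of \<open>f\<close> is combined with naturality of the associator and of its inverse;
  \<open>t_op\<close> and \<open>w_op\<close> are composites of the two basic cases. These rules
  carry the threefold identities along \<open>f\<close>.\<close>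

lemma on_natural:
  assumes "f \<in> Arr C" "Dom C f = V" "Cod C f = W"
    and "c \<in> Arr C" "Dom C c = V \<boxdot> V" "Cod C c = V \<boxdot> V"
    and "c' \<in> Arr C" "Dom C c' = W \<boxdot> W" "Cod C c' = W \<boxdot> W"
    and eq: "c' \<cdot> (f \<boxtimes> f) = (f \<boxtimes> f) \<cdot> c"
  shows "on12 C W c' \<cdot> (f \<boxtimes> f \<boxtimes> f) = (f \<boxtimes> f \<boxtimes> f) \<cdot> on12 C V c" (is ?on12)
    "on23 C W c' \<cdot> (f \<boxtimes> f \<boxtimes> f) = (f \<boxtimes> f \<boxtimes> f) \<cdot> on23 C V c" (is ?on23)
    "t_op C W c' \<cdot> (f \<boxtimes> f \<boxtimes> f) = (f \<boxtimes> f \<boxtimes> f) \<cdot> t_op C V c"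
    "w_op C W c' \<cdot> (f \<boxtimes> f \<boxtimes> f) = (f \<boxtimes> f \<boxtimes> f) \<cdot> w_op C V c"
proof -
  have VW: "V \<in> Obj C" "W \<in> Obj C" using assms arr_obj by auto
  show 12: ?on12 using assms VW by (simp add: on12_def)
  have "on23 C W c' \<cdot> (f \<boxtimes> f \<boxtimes> f) = Inv \<a>[W, W, W] \<cdot> (\<i> W \<boxtimes> c') \<cdot> (\<a>[W, W, W] \<cdot> (f \<boxtimes> f \<boxtimes> f))"
    using assms VW by (simp add: on23_def)
  also have "\<dots> = (Inv \<a>[W, W, W] \<cdot> (f \<boxtimes> (f \<boxtimes> f))) \<cdot> (\<i> V \<boxtimes> c) \<cdot> \<a>[V, V, V]"
    using assms VW assoc_natural[of f f f] by simp
  also have "\<dots> = (f \<boxtimes> f \<boxtimes> f) \<cdot> on23 C V c"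
    using assms VW Inv_assoc_natural[of f f f] by (simp add: on23_def)
  finally show 23: ?on23 .
  show "t_op C W c' \<cdot> (f \<boxtimes> f \<boxtimes> f) = (f \<boxtimes> f \<boxtimes> f) \<cdot> t_op C V c"
    using 23 comp_reassoc[OF 12, of "on23 C V c"] assms VW by (simp add: t_op_def)
  show "w_op C W c' \<cdot> (f \<boxtimes> f \<boxtimes> f) = (f \<boxtimes> f \<boxtimes> f) \<cdot> w_op C V c"
    using 12 comp_reassoc[OF 23, of "on12 C V c"] assms VW by (simp add: w_op_def)
qed

text \<open>Each axiom is tested after the tensor power of \<open>e\<close> that fits its codomain:
  \<open>e\<close> for antisymmetry and Jacobi, \<open>e \<boxtimes> e\<close> for involutivity and
  the compatibility of operator and bracket, the third power for the Yang-Baxter equation. The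
  powers of \<open>e\<close> then slide through to the right and leave the axiom of
  \<open>A\<close>.\<close>

lemma YB_Lie_algebra_restrict:
  assumes A: "is_YB_Lie_algebra C A"
    and e: "e \<in> Arr C" "Dom C e = P" "Cod C e = lie_obj A"
    and monic: "monic e" "monic (e \<boxtimes> e)" "monic (e \<boxtimes> e \<boxtimes> e)"
    and c: "c \<in> Hom C (P \<boxdot> P) (P \<boxdot> P)" "(e \<boxtimes> e) \<cdot> c = lie_op A \<cdot> (e \<boxtimes> e)"
    and b: "b \<in> Hom C (P \<boxdot> P) P" "e \<cdot> b = bracket A \<cdot> (e \<boxtimes> e)"
  shows "is_YB_Lie_algebra C \<lparr>lie_obj = P, lie_op = c, bracket = b\<rparr>"
    "is_YB_Lie_algebra_hom C \<lparr>lie_obj = P, lie_op = c, bracket = b\<rparr> A e"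
proof -
  define L c' b' where "L = lie_obj A" "c' = lie_op A" "b' = bracket A"
  note defs = L_c'_b'_def
  have obj: "P \<in> Obj C" "L \<in> Obj C" using arr_obj[OF e(1)] e by (auto simp: defs)
  have YB: "involutive_YB_operator C L c'"
    and b'_hom: "b' \<in> Hom C (L \<boxdot> L) L"
    and anti: "b' \<cdot> (\<i> (L \<boxdot> L) \<boxplus> c') = Zero C (L \<boxdot> L) L"
    and jacobi: "b' \<cdot> (\<i> L \<boxtimes> b') \<cdot> \<a>[L, L, L] \<cdot> (\<i> (L \<boxdot> L \<boxdot> L) \<boxplus> t_op C L c' \<boxplus> w_op C L c')
         = Zero C (L \<boxdot> L \<boxdot> L) L"
    and compat: "c' \<cdot> (b' \<boxtimes> \<i> L) = (\<i> L \<boxtimes> b') \<cdot> \<a>[L, L, L] \<cdot> t_op C L c'"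
    using A by (simp_all add: is_YB_Lie_algebra_def defs Let_def)
  have [simp]: "c \<in> Arr C" "Dom C c = P \<boxdot> P" "Cod C c = P \<boxdot> P" "b \<in> Arr C" "Dom C b = P \<boxdot> P" "Cod C b = P"
    "c' \<in> Arr C" "Dom C c' = L \<boxdot> L" "Cod C c' = L \<boxdot> L" "b' \<in> Arr C" "Dom C b' = L \<boxdot> L" "Cod C b' = L"
    "e \<in> Arr C" "Dom C e = P" "Cod C e = L"
    using b(1) c(1) b'_hom YB e by (auto simp: Hom_def involutive_YB_operator_def defs)
  have cc': "c' \<cdot> c' = \<i> (L \<boxdot> L)"
    and YBE': "on12 C L c' \<cdot> on23 C L c' \<cdot> on12 C L c' = on23 C L c' \<cdot> on12 C L c' \<cdot> on23 C L c'"
    using YB by (auto simp: involutive_YB_operator_def)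
  have ec: "c' \<cdot> (e \<boxtimes> e) = (e \<boxtimes> e) \<cdot> c" and eb: "b' \<cdot> (e \<boxtimes> e) = e \<cdot> b"
    using b c by (simp_all add: defs)
  note [simp] = obj
  note ec' = comp_reassoc[OF ec, simplified] and eb' = comp_reassoc[OF eb, simplified]
  note nat = on_natural[of e P L c c', simplified, OF ec]
  note nat' = nat[THEN comp_reassoc, simplified]
  have a: "\<a>[L, L, L] \<cdot> (e \<boxtimes> e \<boxtimes> e) = (e \<boxtimes> (e \<boxtimes> e)) \<cdot> \<a>[P, P, P]"
    using assoc_natural[of e e e] by simp
  note a' = comp_reassoc[OF a, simplified]
  have "c \<cdot> c = \<i> (P \<boxdot> P)"
  proof (rule monicD[OF monic(2)])
    have "(e \<boxtimes> e) \<cdot> (c \<cdot> c) = c' \<cdot> (c' \<cdot> (e \<boxtimes> e))"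
      by (simp add: ec ec')
    also have "\<dots> = (e \<boxtimes> e) \<cdot> \<i> (P \<boxdot> P)"
      using comp_reassoc[OF cc', of "e \<boxtimes> e"] by simp
    finally show "(e \<boxtimes> e) \<cdot> (c \<cdot> c) = (e \<boxtimes> e) \<cdot> \<i> (P \<boxdot> P)" .
  qed simp_all
  moreover have "on12 C P c \<cdot> on23 C P c \<cdot> on12 C P c = on23 C P c \<cdot> on12 C P c \<cdot> on23 C P c"
  proof (rule monicD[OF monic(3)])
    have "(e \<boxtimes> e \<boxtimes> e) \<cdot> (on12 C P c \<cdot> on23 C P c \<cdot> on12 C P c)
        = (on12 C L c' \<cdot> on23 C L c' \<cdot> on12 C L c') \<cdot> (e \<boxtimes> e \<boxtimes> e)"
      by (simp add: nat nat')
    also have "\<dots> = (e \<boxtimes> e \<boxtimes> e) \<cdot> (on23 C P c \<cdot> on12 C P c \<cdot> on23 C P c)"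
      unfolding YBE' by (simp add: nat nat')
    finally show "(e \<boxtimes> e \<boxtimes> e) \<cdot> (on12 C P c \<cdot> on23 C P c \<cdot> on12 C P c)
        = (e \<boxtimes> e \<boxtimes> e) \<cdot> (on23 C P c \<cdot> on12 C P c \<cdot> on23 C P c)" .
  qed simp_all
  moreover have "b \<cdot> (\<i> (P \<boxdot> P) \<boxplus> c) = Zero C (P \<boxdot> P) P"
  proof (rule monicD[OF monic(1)])
    have "e \<cdot> (b \<cdot> (\<i> (P \<boxdot> P) \<boxplus> c)) = (b' \<cdot> (\<i> (L \<boxdot> L) \<boxplus> c')) \<cdot> (e \<boxtimes> e)"
      by (simp add: comp_add ec eb eb')
    then show "e \<cdot> (b \<cdot> (\<i> (P \<boxdot> P) \<boxplus> c)) = e \<cdot> Zero C (P \<boxdot> P) P"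
      unfolding anti by (simp add: comp_zero)
  qed simp_all
  moreover have "b \<cdot> (\<i> P \<boxtimes> b) \<cdot> \<a>[P, P, P] \<cdot> (\<i> (P \<boxdot> P \<boxdot> P) \<boxplus> t_op C P c \<boxplus> w_op C P c)
         = Zero C (P \<boxdot> P \<boxdot> P) P"
  proof (rule monicD[OF monic(1)])
    have N: "(\<i> (L \<boxdot> L \<boxdot> L) \<boxplus> t_op C L c' \<boxplus> w_op C L c') \<cdot> (e \<boxtimes> e \<boxtimes> e)
      = (e \<boxtimes> e \<boxtimes> e) \<cdot> (\<i> (P \<boxdot> P \<boxdot> P) \<boxplus> t_op C P c \<boxplus> w_op C P c)"
      by (simp add: comp_add nat)
    define N where "N = \<i> (P \<boxdot> P \<boxdot> P) \<boxplus> t_op C P c \<boxplus> w_op C P c"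
    have [simp]: "N \<in> Arr C" "Dom C N = P \<boxdot> P \<boxdot> P" "Cod C N = P \<boxdot> P \<boxdot> P"
      by (simp_all add: N_def)
    have "(b' \<cdot> (\<i> L \<boxtimes> b') \<cdot> \<a>[L, L, L] \<cdot> (\<i> (L \<boxdot> L \<boxdot> L) \<boxplus> t_op C L c' \<boxplus> w_op C L c')) \<cdot> (e \<boxtimes> e \<boxtimes> e)
      = b' \<cdot> (\<i> L \<boxtimes> b') \<cdot> \<a>[L, L, L] \<cdot> (e \<boxtimes> e \<boxtimes> e) \<cdot> N"
      by (simp add: N N_def)
    also have "\<dots> = b' \<cdot> (e \<boxtimes> (e \<cdot> b)) \<cdot> \<a>[P, P, P] \<cdot> N"
      by (simp add: a' eb)
    \<comment> \<open>Splitting off \<open>e \<boxtimes> e\<close> exposes the outer bracket, so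
      that \<open>eb\<close> applies a second time.\<close>
    also have "\<dots> = b' \<cdot> (e \<boxtimes> e) \<cdot> (\<i> P \<boxtimes> b) \<cdot> \<a>[P, P, P] \<cdot> N"
      by simp
    also have "\<dots> = e \<cdot> b \<cdot> (\<i> P \<boxtimes> b) \<cdot> \<a>[P, P, P] \<cdot> N"
      by (simp add: eb' del: interchange_assoc)
    finally show "e \<cdot> (b \<cdot> (\<i> P \<boxtimes> b) \<cdot> \<a>[P, P, P] \<cdot> (\<i> (P \<boxdot> P \<boxdot> P) \<boxplus> t_op C P c \<boxplus> w_op C P c))
       = e \<cdot> Zero C (P \<boxdot> P \<boxdot> P) P"
      unfolding jacobi N_def by (simp add: comp_zero)
  qed simp_all
  moreover have "c \<cdot> (b \<boxtimes> \<i> P) = (\<i> P \<boxtimes> b) \<cdot> \<a>[P, P, P] \<cdot> t_op C P c"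
  proof (rule monicD[OF monic(2)])
    have "(e \<boxtimes> e) \<cdot> (c \<cdot> (b \<boxtimes> \<i> P)) = c' \<cdot> (e \<boxtimes> e) \<cdot> (b \<boxtimes> \<i> P)"
      by (simp add: ec' del: interchange)
    also have "\<dots> = (c' \<cdot> (b' \<boxtimes> \<i> L)) \<cdot> (e \<boxtimes> e \<boxtimes> e)"
      by (simp add: eb)
    also have "\<dots> = (\<i> L \<boxtimes> b') \<cdot> \<a>[L, L, L] \<cdot> (e \<boxtimes> e \<boxtimes> e) \<cdot> t_op C P c"
      unfolding compat by (simp add: nat)
    also have "\<dots> = (e \<boxtimes> e) \<cdot> ((\<i> P \<boxtimes> b) \<cdot> \<a>[P, P, P] \<cdot> t_op C P c)"
      by (simp add: a' eb)
    finally show "(e \<boxtimes> e) \<cdot> (c \<cdot> (b \<boxtimes> \<i> P)) = (e \<boxtimes> e) \<cdot> ((\<i> P \<boxtimes> b) \<cdot> \<a>[P, P, P] \<cdot> t_op C P c)" .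
  qed simp_all
  ultimately show "is_YB_Lie_algebra C \<lparr>lie_obj = P, lie_op = c, bracket = b\<rparr>"
    using b(1) c(1) by (simp add: is_YB_Lie_algebra_def involutive_YB_operator_def)
  then show "is_YB_Lie_algebra_hom C \<lparr>lie_obj = P, lie_op = c, bracket = b\<rparr> A e"
    using A b(2) c(2) e by (simp add: is_YB_Lie_algebra_hom_def Hom_def)
qed

text \<open>Tensoring is assumed to preserve equalizers, not monics. So a tensor power of
  \<open>e\<close> is factored into arrows that apply \<open>e\<close> in one place and identities
  elsewhere; each of these is again an equalizer, or obtained from one by tensoring on one side, and
  hence monic.\<close>

lemma equalizer_tensor_monic:
  assumes pres: "has_preserved_equalizers C" and eq: "is_equalizer C P e f g"
  shows "X \<in> Obj C \<Longrightarrow> monic (e \<boxtimes> \<i> X)" "X \<in> Obj C \<Longrightarrow> monic (\<i> X \<boxtimes> e)"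
    and "monic e" "monic (e \<boxtimes> e)" "monic (e \<boxtimes> e \<boxtimes> e)"
proof -
  have l: "is_equalizer C (E \<boxdot> X) (e \<boxtimes> \<i> X) (f \<boxtimes> \<i> X) (g \<boxtimes> \<i> X)"
    and r: "is_equalizer C (X \<boxdot> E) (\<i> X \<boxtimes> e) (\<i> X \<boxtimes> f) (\<i> X \<boxtimes> g)"
    if "is_equalizer C E e f g" "X \<in> Obj C" for E e f g X
    using pres that unfolding has_preserved_equalizers_def by blast+
  note e = equalizer_props[OF eq] and [simp] = arr_obj(1)
  show monic_left: "monic (e \<boxtimes> \<i> X)" and monic_right: "monic (\<i> X \<boxtimes> e)" if "X \<in> Obj C" for X
    using l[OF eq that] r[OF eq that] by (auto intro: equalizer_monic)
  show "monic e" using eq by (rule equalizer_monic)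
  let ?H = "Dom C f"
  have "monic ((e \<boxtimes> \<i> ?H) \<cdot> (\<i> P \<boxtimes> e))"
    by (rule monic_comp[OF monic_left monic_right]) (use e in auto)
  then show "monic (e \<boxtimes> e)" using e by simp
  have "monic (((e \<boxtimes> \<i> ?H \<boxtimes> \<i> ?H) \<cdot> (\<i> P \<boxtimes> e \<boxtimes> \<i> ?H)) \<cdot> (\<i> (P \<boxdot> P) \<boxtimes> e))"
  proof (intro monic_comp monic_right)
    show "monic (e \<boxtimes> \<i> ?H \<boxtimes> \<i> ?H)" "monic (\<i> P \<boxtimes> e \<boxtimes> \<i> ?H)"
      using e by (auto intro!: equalizer_monic[OF l[OF l[OF eq]]] equalizer_monic[OF l[OF r[OF eq]]])
  qed (use e in auto)
  then show "monic (e \<boxtimes> e \<boxtimes> e)" using e by (simp del: tensor_ide)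
qed

text \<open>Inside the tensor square of \<open>Dom C f\<close>, the object
  \<open>P \<boxdot> P\<close> acts as the intersection of the two subobjects that have
  \<open>P\<close> in one factor. The arrow \<open>x\<close> is factored through the second factor,
  then the result through the first. This is the existence half of restricting an operator to
  \<open>P \<boxdot> P\<close>.\<close>

lemma equalizer_tensor_factor:
  assumes pres: "has_preserved_equalizers C" and eq: "is_equalizer C P e f g"
    and x: "x \<in> Arr C" "Cod C x = Dom C f \<boxdot> Dom C f"
    and left: "(f \<boxtimes> \<i> (Dom C f)) \<cdot> x = (g \<boxtimes> \<i> (Dom C f)) \<cdot> x"
    and right: "(\<i> (Dom C f) \<boxtimes> f) \<cdot> x = (\<i> (Dom C f) \<boxtimes> g) \<cdot> x"
  obtains u where "u \<in> Arr C" "Dom C u = Dom C x" "Cod C u = P \<boxdot> P" "(e \<boxtimes> e) \<cdot> u = x"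
proof -
  let ?H = "Dom C f"
  note e = equalizer_props[OF eq]
  have obj: "?H \<in> Obj C" "Cod C f \<in> Obj C" using e by auto
  have eqr: "is_equalizer C (?H \<boxdot> P) (\<i> ?H \<boxtimes> e) (\<i> ?H \<boxtimes> f) (\<i> ?H \<boxtimes> g)"
    and eql: "is_equalizer C (P \<boxdot> P) (e \<boxtimes> \<i> P) (f \<boxtimes> \<i> P) (g \<boxtimes> \<i> P)"
    using pres eq obj e(8) unfolding has_preserved_equalizers_def by blast+
  have "Cod C x = Dom C (\<i> ?H \<boxtimes> f)" using x e obj by simp
  then obtain y where y: "y \<in> Arr C" "Dom C y = Dom C x" "Cod C y = ?H \<boxdot> P" "(\<i> ?H \<boxtimes> e) \<cdot> y = x"
    by (rule equalizer_factor[OF eqr x(1) _ right])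
  have fg: "(f \<boxtimes> \<i> P) \<cdot> y = (g \<boxtimes> \<i> P) \<cdot> y"
  \<comment> \<open>After the monic \<open>\<i> (Cod C f) \<boxtimes> e\<close>, interchange slides
    \<open>e\<close> past \<open>f\<close> and \<open>g\<close> and turns the claim about
    \<open>y\<close> into the hypothesis \<open>left\<close> about \<open>x\<close>.\<close>
  proof (rule monicD[OF equalizer_tensor_monic(2)[OF pres eq]])
    have "(\<i> (Cod C f) \<boxtimes> e) \<cdot> ((f \<boxtimes> \<i> P) \<cdot> y) = (f \<boxtimes> \<i> ?H) \<cdot> ((\<i> ?H \<boxtimes> e) \<cdot> y)"
      using e(1-8) obj y(1-3) by simp
    also have "\<dots> = (g \<boxtimes> \<i> ?H) \<cdot> ((\<i> ?H \<boxtimes> e) \<cdot> y)"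
      unfolding y(4) by (fact left)
    also have "\<dots> = (\<i> (Cod C f) \<boxtimes> e) \<cdot> ((g \<boxtimes> \<i> P) \<cdot> y)"
      using e(1-8) obj y(1-3) by simp
    finally show "(\<i> (Cod C f) \<boxtimes> e) \<cdot> ((f \<boxtimes> \<i> P) \<cdot> y) = (\<i> (Cod C f) \<boxtimes> e) \<cdot> ((g \<boxtimes> \<i> P) \<cdot> y)" .
  qed (use e(1-8) y(1-3) obj in simp_all)
  have "Cod C y = Dom C (f \<boxtimes> \<i> P)" using y e by simp
  then obtain u where u: "u \<in> Arr C" "Dom C u = Dom C y" "Cod C u = P \<boxdot> P" "(e \<boxtimes> \<i> P) \<cdot> u = y"
    by (rule equalizer_factor[OF eql y(1) _ fg])
  have "(e \<boxtimes> e) \<cdot> u = x"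
    using u(1-3) e(1-8) obj by (simp flip: y(4) u(4))
  then show ?thesis using that u y by simp
qed

end

section \<open>The commutator of a braided bialgebra\<close>

locale braided_bialgebra = additive_monoidal_category C for C (structure) +
  fixes B
  assumes bialgebra: "is_braided_bialgebra C B"
begin

abbreviation "H \<equiv> bobj B"
abbreviation "\<mu> \<equiv> mul B"
abbreviation "\<eta> \<equiv> unit B"
abbreviation "\<Delta> \<equiv> comul B"
abbreviation "\<sigma> \<equiv> braid B"
abbreviation "insl \<equiv> ins_left \<eta>"
abbreviation "insr \<equiv> ins_right \<eta>"
abbreviation "t \<equiv> t_op C H \<sigma>"
abbreviation "w \<equiv> w_op C H \<sigma>"

lemma structure_arr [simp]:
  "H \<in> Obj C"
  "\<mu> \<in> Arr C" "Dom C \<mu> = H \<boxdot> H" "Cod C \<mu> = H"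
  "\<eta> \<in> Arr C" "Dom C \<eta> = \<I>" "Cod C \<eta> = H"
  "\<Delta> \<in> Arr C" "Dom C \<Delta> = H" "Cod C \<Delta> = H \<boxdot> H"
  "\<sigma> \<in> Arr C" "Dom C \<sigma> = H \<boxdot> H" "Cod C \<sigma> = H \<boxdot> H"
  using bialgebra
  by (auto simp: is_braided_bialgebra_def Let_def is_algebra_def is_coalgebra_def
      involutive_YB_operator_def Hom_def)

lemmas insl_arr [simp] = ins_arr[of \<eta>, OF structure_arr(5-7)]

lemma unit_left_eq: "unit_left C B = insl H"
  by (simp add: unit_left_def ins_left_def)

lemma unit_right_eq: "unit_right C B = insr H"
  by (simp add: unit_right_def ins_right_def)

lemma structure_eqs:
  shows mul_assoc: "\<mu> \<cdot> (\<mu> \<boxtimes> \<i> H) = \<mu> \<cdot> (\<i> H \<boxtimes> \<mu>) \<cdot> \<a>[H, H, H]"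
    and mul_lunit: "\<mu> \<cdot> (\<eta> \<boxtimes> \<i> H) = \<l>[H]"
    and mul_runit: "\<mu> \<cdot> (\<i> H \<boxtimes> \<eta>) = \<r>[H]"
    and YB_op: "involutive_YB_operator C H \<sigma>"
    and braid_braid: "\<sigma> \<cdot> \<sigma> = \<i> (H \<boxdot> H)"
    and YB_eq: "on12 C H \<sigma> \<cdot> on23 C H \<sigma> \<cdot> on12 C H \<sigma> = on23 C H \<sigma> \<cdot> on12 C H \<sigma> \<cdot> on23 C H \<sigma>"
    and braid_mul_left: "\<sigma> \<cdot> (\<mu> \<boxtimes> \<i> H) = (\<i> H \<boxtimes> \<mu>) \<cdot> \<a>[H, H, H] \<cdot> t"
    and braid_mul_right: "\<sigma> \<cdot> (\<i> H \<boxtimes> \<mu>) \<cdot> \<a>[H, H, H] = (\<mu> \<boxtimes> \<i> H) \<cdot> w"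
    and braid_insl: "\<sigma> \<cdot> insl H = insr H"
    and braid_insr: "\<sigma> \<cdot> insr H = insl H"
    and comul_braid_right: "Inv \<a>[H, H, H] \<cdot> (\<i> H \<boxtimes> \<Delta>) \<cdot> \<sigma> = t \<cdot> (\<Delta> \<boxtimes> \<i> H)"
    and comul_braid_left: "(\<Delta> \<boxtimes> \<i> H) \<cdot> \<sigma> = w \<cdot> Inv \<a>[H, H, H] \<cdot> (\<i> H \<boxtimes> \<Delta>)"
    and comul_mul: "(\<mu> \<boxtimes> \<mu>) \<cdot> on_middle C H \<sigma> \<cdot> (\<Delta> \<boxtimes> \<Delta>) = \<Delta> \<cdot> \<mu>"
  using bialgebra
  by (simp_all add: is_braided_bialgebra_def Let_def is_algebra_def involutive_YB_operator_def
      unit_left_eq unit_right_eq)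

lemma mul_insl: "\<mu> \<cdot> insl H = \<i> H"
  using comp_reassoc[OF mul_lunit, of "Inv \<l>[H]"] by (simp add: ins_left_def)

lemma mul_insr: "\<mu> \<cdot> insr H = \<i> H"
  using comp_reassoc[OF mul_runit, of "Inv \<r>[H]"] by (simp add: ins_right_def)

lemma on_involutive:
  "on12 C H \<sigma> \<cdot> on12 C H \<sigma> = \<i> (H \<boxdot> H \<boxdot> H)" "on23 C H \<sigma> \<cdot> on23 C H \<sigma> = \<i> (H \<boxdot> H \<boxdot> H)"
  by (simp_all add: on12_def on23_def braid_braid)

text \<open>The operators \<open>on12\<close> and \<open>on23\<close> generate an action of the symmetric group on three letters;
  the Jacobi identity holds because the sum \<open>1 + t + w\<close> over the cyclic subgroup absorbs \<open>w\<close>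
  and commutes with \<open>on23\<close>.\<close>

lemma YB_Lie_commutator: "is_YB_Lie_algebra C (commutator_lie C B)"
proof -
  let ?s = "on12 C H \<sigma>" and ?s' = "on23 C H \<sigma>" and ?I = "\<i> (H \<boxdot> H \<boxdot> H)" and ?a = "\<a>[H, H, H]"
  note inv' = on_involutive[THEN comp_reassoc, simplified]
  define b where "b = \<mu> \<cdot> (\<i> (H \<boxdot> H) \<boxminus> \<sigma>)"
  have b [simp]: "b \<in> Arr C" "Dom C b = H \<boxdot> H" "Cod C b = H"
    by (simp_all add: b_def)
  have anti: "b \<cdot> (\<i> (H \<boxdot> H) \<boxplus> \<sigma>) = Zero C (H \<boxdot> H) H"
  proof -
    have "(\<i> (H \<boxdot> H) \<boxminus> \<sigma>) \<cdot> (\<i> (H \<boxdot> H) \<boxplus> \<sigma>) = (\<i> (H \<boxdot> H) \<boxplus> \<sigma>) \<boxminus> \<sigma> \<cdot> (\<i> (H \<boxdot> H) \<boxplus> \<sigma>)"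
      by (simp add: comp_minus)
    also have "\<sigma> \<cdot> (\<i> (H \<boxdot> H) \<boxplus> \<sigma>) = \<i> (H \<boxdot> H) \<boxplus> \<sigma>"
      by (simp add: comp_add braid_braid add_commute[of \<sigma>])
    finally show ?thesis by (simp add: b_def minus_self comp_zero)
  qed
  have right: "(\<i> H \<boxtimes> b) \<cdot> ?a = (\<i> H \<boxtimes> \<mu>) \<cdot> ?a \<cdot> (?I \<boxminus> ?s')"
  proof -
    have "(\<i> H \<boxtimes> b) = (\<i> H \<boxtimes> \<mu>) \<cdot> (\<i> H \<boxtimes> (\<i> (H \<boxdot> H) \<boxminus> \<sigma>))"
      by (simp add: b_def)
    moreover have "(\<i> H \<boxtimes> (\<i> (H \<boxdot> H) \<boxminus> \<sigma>)) \<cdot> ?a = ?a \<cdot> (?I \<boxminus> ?s')"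
      by (simp add: tensor_minus comp_minus on23_def)
    ultimately show ?thesis by (simp del: interchange)
  qed
  note right' = comp_reassoc[OF right, simplified]
  \<comment> \<open>Braiding an element past a product is \<open>w\<close> followed by the product,
    and associativity gives both terms of the outer bracket the same threefold
    multiplication.\<close>
  have left: "b \<cdot> (\<i> H \<boxtimes> \<mu>) \<cdot> ?a = \<mu> \<cdot> (\<mu> \<boxtimes> \<i> H) \<cdot> (?I \<boxminus> w)"
  proof -
    have "b \<cdot> (\<i> H \<boxtimes> \<mu>) \<cdot> ?a = \<mu> \<cdot> ((\<i> H \<boxtimes> \<mu>) \<cdot> ?a \<boxminus> \<sigma> \<cdot> (\<i> H \<boxtimes> \<mu>) \<cdot> ?a)"
      by (simp add: b_def comp_minus)
    also have "\<dots> = \<mu> \<cdot> (\<mu> \<boxtimes> \<i> H) \<boxminus> \<mu> \<cdot> (\<mu> \<boxtimes> \<i> H) \<cdot> w"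
      by (simp add: braid_mul_right comp_minus mul_assoc)
    also have "\<dots> = \<mu> \<cdot> (\<mu> \<boxtimes> \<i> H) \<cdot> (?I \<boxminus> w)"
      by (simp add: comp_minus)
    finally show ?thesis .
  qed
  have jacobi: "b \<cdot> (\<i> H \<boxtimes> b) \<cdot> ?a \<cdot> (?I \<boxplus> t \<boxplus> w) = Zero C (H \<boxdot> H \<boxdot> H) H"
  proof -
    define N where "N = ?I \<boxplus> t \<boxplus> w"
    have [simp]: "N \<in> Arr C" "Dom C N = H \<boxdot> H \<boxdot> H" "Cod C N = H \<boxdot> H \<boxdot> H"
      by (simp_all add: N_def)
    \<comment> \<open>\<open>w\<close> behaves as a 3-cycle: \<open>t\<close> is its inverse by
      involutivity and its square by the Yang-Baxter equation. Multiplication by \<open>w\<close>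
      thus permutes the three summands of \<open>N\<close>.\<close>
    have "w \<cdot> t = ?I"
      by (simp add: t_op_def w_op_def inv' on_involutive)
    moreover have "w \<cdot> w = t"
      using comp_reassoc[OF YB_eq[symmetric], of "?s"]
      by (simp add: t_op_def w_op_def inv' on_involutive)
    ultimately have wN: "w \<cdot> N = N"
      by (simp add: N_def comp_add add_assoc add_commute[of w] add_left_commute[of w])
    have "?s' \<cdot> t = w \<cdot> ?s'" "?s' \<cdot> w = t \<cdot> ?s'"
      by (simp_all add: t_op_def w_op_def inv' on_involutive)
    then have s'N: "?s' \<cdot> N = N \<cdot> ?s'"
      by (simp add: N_def comp_add add_assoc add_commute[of "w \<cdot> ?s'"])
    have "(?I \<boxminus> w) \<cdot> (?I \<boxminus> ?s') \<cdot> N = (?I \<boxminus> w) \<cdot> N \<cdot> (?I \<boxminus> ?s')"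
      by (simp add: comp_minus s'N)
    also have "\<dots> = ((?I \<boxminus> w) \<cdot> N) \<cdot> (?I \<boxminus> ?s')" by simp
    also have "(?I \<boxminus> w) \<cdot> N = Zero C (H \<boxdot> H \<boxdot> H) (H \<boxdot> H \<boxdot> H)"
      by (simp add: comp_minus wN minus_self)
    finally have "(?I \<boxminus> w) \<cdot> (?I \<boxminus> ?s') \<cdot> N = Zero C (H \<boxdot> H \<boxdot> H) (H \<boxdot> H \<boxdot> H)"
      by (simp add: comp_zero)
    moreover have "b \<cdot> (\<i> H \<boxtimes> b) \<cdot> ?a \<cdot> N = (b \<cdot> (\<i> H \<boxtimes> \<mu>) \<cdot> ?a) \<cdot> (?I \<boxminus> ?s') \<cdot> N"
      by (simp add: right')
    ultimately show ?thesis
      unfolding left by (simp add: comp_zero flip: N_def)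
  qed
  have compat: "\<sigma> \<cdot> (b \<boxtimes> \<i> H) = (\<i> H \<boxtimes> b) \<cdot> ?a \<cdot> t"
  proof -
    have "b \<boxtimes> \<i> H = (\<mu> \<boxtimes> \<i> H) \<cdot> (?I \<boxminus> ?s)"
      by (simp add: b_def on12_def tensor_minus comp_minus)
    then have "\<sigma> \<cdot> (b \<boxtimes> \<i> H) = (\<sigma> \<cdot> (\<mu> \<boxtimes> \<i> H)) \<cdot> (?I \<boxminus> ?s)"
      by (simp del: interchange)
    also have "\<dots> = (\<i> H \<boxtimes> \<mu>) \<cdot> ?a \<cdot> t \<cdot> (?I \<boxminus> ?s)"
      by (simp add: braid_mul_left)
    \<comment> \<open>The Yang-Baxter equation reads \<open>t \<cdot> ?s = ?s' \<cdot> t\<close>, so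
      \<open>t\<close> carries the antisymmetrizer of the first two factors to that of the last
      two.\<close>
    also have "t \<cdot> (?I \<boxminus> ?s) = (?I \<boxminus> ?s') \<cdot> t"
      by (simp add: comp_minus t_op_def YB_eq)
    finally show ?thesis by (simp add: right')
  qed
  show ?thesis
    unfolding is_YB_Lie_algebra_def commutator_lie_def Let_def yb_lie_algebra.simps b_def[symmetric]
    using anti jacobi compat YB_op b by (simp add: Hom_def)
qed

end

section \<open>Primitive elements\<close>

context braided_bialgebra
begin

lemmas insl_natural = ins_left_natural[of \<eta>, OF structure_arr(5-7)]
lemmas insr_natural = ins_right_natural[of \<eta>, OF structure_arr(5-7)]
lemmas assoc_insl = assoc_ins_left[of \<eta>, OF structure_arr(5-7)]
lemmas assoc_insr = assoc_ins_right[of \<eta>, OF structure_arr(5-7)]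
lemmas assoc_insm = assoc_ins_middle[of \<eta>, OF structure_arr(5-7)]

lemma Inv_assoc_ins:
  assumes "X \<in> Obj C" "Y \<in> Obj C"
  shows "Inv \<a>[H, X, Y] \<cdot> insl (X \<boxdot> Y) = insl X \<boxtimes> \<i> Y"
    and "Inv \<a>[X, Y, H] \<cdot> (\<i> X \<boxtimes> insr Y) = insr (X \<boxdot> Y)"
    and "Inv \<a>[X, H, Y] \<cdot> (\<i> X \<boxtimes> insl Y) = insr X \<boxtimes> \<i> Y"
  by (rule Inv_assoc_eqI[OF assoc_insl]; use assms in simp)
    (rule Inv_assoc_eqI[OF assoc_insr] Inv_assoc_eqI[OF assoc_insm]; use assms in simp)+

text \<open>The unit crosses \<open>\<sigma>\<close> freely. With a unit in the first, middle or
  last place (\<open>insl H \<boxtimes> \<i> H\<close>, \<open>insr H \<boxtimes> \<i> H\<close>,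
  \<open>insr (H \<boxdot> H)\<close>), an operator that touches the unit only moves it by one
  place, and one that does not touch it braids the two remaining factors.\<close>

lemma on_ins:
  shows on23_insl: "on23 C H \<sigma> \<cdot> (insl H \<boxtimes> \<i> H) = (insl H \<boxtimes> \<i> H) \<cdot> \<sigma>"
    and on12_insl: "on12 C H \<sigma> \<cdot> (insl H \<boxtimes> \<i> H) = insr H \<boxtimes> \<i> H"
    and on12_insr: "on12 C H \<sigma> \<cdot> (insr H \<boxtimes> \<i> H) = insl H \<boxtimes> \<i> H"
    and on23_insr: "on23 C H \<sigma> \<cdot> (insr H \<boxtimes> \<i> H) = insr (H \<boxdot> H)"
    and on23_insr': "on23 C H \<sigma> \<cdot> insr (H \<boxdot> H) = insr H \<boxtimes> \<i> H"
    and on12_insr': "on12 C H \<sigma> \<cdot> insr (H \<boxdot> H) = insr (H \<boxdot> H) \<cdot> \<sigma>"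
proof -
  show "on23 C H \<sigma> \<cdot> (insl H \<boxtimes> \<i> H) = (insl H \<boxtimes> \<i> H) \<cdot> \<sigma>"
    by (simp add: on23_def assoc_insl insl_natural comp_reassoc[OF Inv_assoc_ins(1), simplified])
qed (simp_all add: on23_def on12_def assoc_insl assoc_insr assoc_insm insr_natural Inv_assoc_ins
    braid_insl braid_insr)

abbreviation "S \<equiv> insl H \<boxplus> insr H"

text \<open>\<open>S\<close> imitates \<open>comul_braid_right\<close> here and
  \<open>comul_braid_left\<close> in \<open>w_S\<close>. Since \<open>\<Delta>\<close> and
  \<open>S\<close> pass \<open>\<sigma>\<close> by the same rule, their agreement on primitives
  survives the braiding.\<close>

lemma t_S: "t \<cdot> (S \<boxtimes> \<i> H) = Inv \<a>[H, H, H] \<cdot> (\<i> H \<boxtimes> S) \<cdot> \<sigma>"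
proof -
  have "t \<cdot> (S \<boxtimes> \<i> H) = ((insr H \<boxtimes> \<i> H) \<boxplus> insr (H \<boxdot> H)) \<cdot> \<sigma>"
    by (simp add: t_op_def tensor_add comp_add on_ins comp_reassoc[OF on12_insl, simplified])
  also have "(insr H \<boxtimes> \<i> H) \<boxplus> insr (H \<boxdot> H) = Inv \<a>[H, H, H] \<cdot> (\<i> H \<boxtimes> S)"
    by (simp add: tensor_add comp_add Inv_assoc_ins)
  finally show ?thesis by simp
qed

lemma w_S: "w \<cdot> Inv \<a>[H, H, H] \<cdot> (\<i> H \<boxtimes> S) = (S \<boxtimes> \<i> H) \<cdot> \<sigma>"
proof -
  have "Inv \<a>[H, H, H] \<cdot> (\<i> H \<boxtimes> S) = (insr H \<boxtimes> \<i> H) \<boxplus> insr (H \<boxdot> H)"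
    by (simp add: tensor_add comp_add Inv_assoc_ins)
  then show ?thesis
    by (simp add: w_op_def tensor_add comp_add on_ins comp_reassoc[OF on23_insr', simplified])
qed

text \<open>\<open>(\<mu> \<otimes> \<mu>)(H \<otimes> \<sigma> \<otimes> H)\<close> is the multiplication of \<open>H \<otimes> H\<close>; the four identities evaluate
  \<open>(1 \<otimes> x)(1 \<otimes> y)\<close>, \<open>(1 \<otimes> x)(y \<otimes> 1)\<close>, \<open>(x \<otimes> 1)(1 \<otimes> y)\<close> and \<open>(x \<otimes> 1)(y \<otimes> 1)\<close>.\<close>

lemma mul_middle:
  shows mul_middle_insl_insl: "(\<mu> \<boxtimes> \<mu>) \<cdot> on_middle C H \<sigma> \<cdot> (insl H \<boxtimes> insl H) = insl H \<cdot> \<mu>"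
    and mul_middle_insl_insr: "(\<mu> \<boxtimes> \<mu>) \<cdot> on_middle C H \<sigma> \<cdot> (insl H \<boxtimes> insr H) = \<sigma>"
    and mul_middle_insr_insl: "(\<mu> \<boxtimes> \<mu>) \<cdot> on_middle C H \<sigma> \<cdot> (insr H \<boxtimes> insl H) = \<i> (H \<boxdot> H)"
    and mul_middle_insr_insr: "(\<mu> \<boxtimes> \<mu>) \<cdot> on_middle C H \<sigma> \<cdot> (insr H \<boxtimes> insr H) = insr H \<cdot> \<mu>"
proof -
  let ?a = "\<a>[H, H, H]" and ?M = "on_middle C H \<sigma>"
  define k where "k = ?a \<cdot> (\<sigma> \<boxtimes> \<i> H) \<cdot> Inv ?a"
  have k [simp]: "k \<in> Arr C" "Dom C k = H \<boxdot> (H \<boxdot> H)" "Cod C k = H \<boxdot> (H \<boxdot> H)"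
    by (simp_all add: k_def)
  have M: "?M = Inv \<a>[H, H, H \<boxdot> H] \<cdot> (\<i> H \<boxtimes> k) \<cdot> \<a>[H, H, H \<boxdot> H]"
    by (simp add: on_middle_def k_def)
  have M_arr [simp]: "?M \<in> Arr C" "Dom C ?M = H \<boxdot> H \<boxdot> (H \<boxdot> H)" "Cod C ?M = H \<boxdot> H \<boxdot> (H \<boxdot> H)"
    by (simp_all add: M)
  \<comment> \<open>On \<open>(1 \<otimes> x) \<otimes> (y \<otimes> z)\<close> the leading unit is
    inert, and what remains is \<open>k\<close>, which braids x past y.\<close>
  have Ml: "?M \<cdot> (insl H \<boxtimes> \<i> (H \<boxdot> H)) = (insl H \<boxtimes> \<i> (H \<boxdot> H)) \<cdot> k"
    by (simp add: M assoc_insl insl_natural comp_reassoc[OF Inv_assoc_ins(1), simplified])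
  have kl: "k \<cdot> (\<i> H \<boxtimes> insl H) = insl (H \<boxdot> H)"
    by (simp add: k_def Inv_assoc_ins braid_insr assoc_insl)
  have kr: "k \<cdot> (\<i> H \<boxtimes> insr H) = (\<i> H \<boxtimes> insr H) \<cdot> \<sigma>"
    by (simp add: k_def Inv_assoc_ins insr_natural comp_reassoc[OF assoc_insr, simplified])
  have kl': "k \<cdot> insl (H \<boxdot> H) = \<i> H \<boxtimes> insl H"
    by (simp add: k_def Inv_assoc_ins braid_insl assoc_insm)
  \<comment> \<open>Here the unit itself is braided:
    \<open>(x \<otimes> 1) \<otimes> (y \<otimes> z)\<close> becomes
    \<open>(x \<otimes> y) \<otimes> (1 \<otimes> z)\<close>.\<close>
  have Mr: "?M \<cdot> (insr H \<boxtimes> \<i> (H \<boxdot> H)) = (\<i> (H \<boxdot> H) \<boxtimes> insl H) \<cdot> Inv ?a"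
  proof -
    have "?M \<cdot> (insr H \<boxtimes> \<i> (H \<boxdot> H)) = Inv \<a>[H, H, H \<boxdot> H] \<cdot> (\<i> H \<boxtimes> (\<i> H \<boxtimes> insl H))"
      by (simp add: M assoc_insm kl')
    then show ?thesis
      using Inv_assoc_natural[of "\<i> H" "\<i> H" "insl H"] by simp
  qed
  \<comment> \<open>The second insertion is factored off so that \<open>Ml\<close> and
    \<open>Mr\<close> can act on the first pair alone. The interchange rules would merge the factors
    again, hence they are switched off below.\<close>
  have split: "insl H \<boxtimes> f = (insl H \<boxtimes> \<i> (H \<boxdot> H)) \<cdot> (\<i> H \<boxtimes> f)"
    "insr H \<boxtimes> f = (insr H \<boxtimes> \<i> (H \<boxdot> H)) \<cdot> (\<i> H \<boxtimes> f)"
    if "f \<in> Arr C" "Dom C f = H" "Cod C f = H \<boxdot> H" for f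
    using that by simp_all
  note Ml' = comp_reassoc[OF Ml, simplified] and Mr' = comp_reassoc[OF Mr, simplified]
  note [simp del] = interchange interchange_assoc
  have "?M \<cdot> (insl H \<boxtimes> insl H) = (insl H \<boxtimes> \<i> (H \<boxdot> H)) \<cdot> insl (H \<boxdot> H)"
    by (simp add: split[of "insl H"] Ml' kl)
  then have "(\<mu> \<boxtimes> \<mu>) \<cdot> ?M \<cdot> (insl H \<boxtimes> insl H) = (\<i> H \<boxtimes> \<mu>) \<cdot> insl (H \<boxdot> H)"
    by (simp add: interchange_assoc mul_insl)
  then show "(\<mu> \<boxtimes> \<mu>) \<cdot> ?M \<cdot> (insl H \<boxtimes> insl H) = insl H \<cdot> \<mu>"
    by (simp add: insl_natural)
  have "?M \<cdot> (insl H \<boxtimes> insr H) = (insl H \<boxtimes> insr H) \<cdot> \<sigma>"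
    by (simp add: split[of "insr H"] Ml' kr)
  then show "(\<mu> \<boxtimes> \<mu>) \<cdot> ?M \<cdot> (insl H \<boxtimes> insr H) = \<sigma>"
    by (simp add: interchange_assoc mul_insl mul_insr)
  have "?M \<cdot> (insr H \<boxtimes> insl H) = (\<i> (H \<boxdot> H) \<boxtimes> insl H) \<cdot> (insr H \<boxtimes> \<i> H)"
    by (simp add: split[of "insl H"] Mr' Inv_assoc_ins)
  then show "(\<mu> \<boxtimes> \<mu>) \<cdot> ?M \<cdot> (insr H \<boxtimes> insl H) = \<i> (H \<boxdot> H)"
    by (simp add: interchange interchange_assoc mul_insl mul_insr)
  have "?M \<cdot> (insr H \<boxtimes> insr H) = (\<i> (H \<boxdot> H) \<boxtimes> insl H) \<cdot> insr (H \<boxdot> H)"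
    by (simp add: split[of "insr H"] Mr' Inv_assoc_ins)
  then have "(\<mu> \<boxtimes> \<mu>) \<cdot> ?M \<cdot> (insr H \<boxtimes> insr H) = (\<mu> \<boxtimes> \<i> H) \<cdot> insr (H \<boxdot> H)"
    by (simp add: interchange_assoc mul_insl)
  then show "(\<mu> \<boxtimes> \<mu>) \<cdot> ?M \<cdot> (insr H \<boxtimes> insr H) = insr H \<cdot> \<mu>"
    by (simp add: insr_natural)
qed

lemma on_middle_arr [simp]:
  "on_middle C H \<sigma> \<in> Arr C" "Dom C (on_middle C H \<sigma>) = H \<boxdot> H \<boxdot> (H \<boxdot> H)"
  "Cod C (on_middle C H \<sigma>) = H \<boxdot> H \<boxdot> (H \<boxdot> H)"
  by (simp_all add: on_middle_def)

section \<open>Arrows into \<open>H\<close> with primitive image\<close>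

context
  fixes e P
  assumes e [simp]: "e \<in> Arr C" "Dom C e = P" "Cod C e = H"
    and primitive: "\<Delta> \<cdot> e = S \<cdot> e"
begin

lemma primitive_obj [simp]: "P \<in> Obj C"
  using arr_obj(1)[OF e(1)] by simp

text \<open>Compatibility moves \<open>\<Delta>\<close> to the other side of
  \<open>\<sigma>\<close>, where it meets \<open>e\<close> and may be exchanged for
  \<open>S\<close>; \<open>w_S\<close> moves \<open>S\<close> back. With
  \<open>braid_primitive_right\<close> this yields the two conditions under which
  \<open>\<sigma> \<cdot> (e \<boxtimes> e)\<close> factors through
  \<open>e \<boxtimes> e\<close>.\<close>

lemma braid_primitive_left: "(\<Delta> \<boxtimes> \<i> H) \<cdot> \<sigma> \<cdot> (e \<boxtimes> e) = (S \<boxtimes> \<i> H) \<cdot> \<sigma> \<cdot> (e \<boxtimes> e)"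
proof -
  have "(\<Delta> \<boxtimes> \<i> H) \<cdot> \<sigma> \<cdot> (e \<boxtimes> e) = ((\<Delta> \<boxtimes> \<i> H) \<cdot> \<sigma>) \<cdot> (e \<boxtimes> e)"
    by simp
  also have "\<dots> = (w \<cdot> Inv \<a>[H, H, H] \<cdot> (\<i> H \<boxtimes> S)) \<cdot> (e \<boxtimes> e)"
    unfolding comul_braid_left by (simp add: primitive)
  finally show ?thesis unfolding w_S by simp
qed

lemma braid_primitive_right: "(\<i> H \<boxtimes> \<Delta>) \<cdot> \<sigma> \<cdot> (e \<boxtimes> e) = (\<i> H \<boxtimes> S) \<cdot> \<sigma> \<cdot> (e \<boxtimes> e)"
proof -
  have "(\<i> H \<boxtimes> \<Delta>) \<cdot> \<sigma> \<cdot> (e \<boxtimes> e) = \<a>[H, H, H] \<cdot> (Inv \<a>[H, H, H] \<cdot> (\<i> H \<boxtimes> \<Delta>) \<cdot> \<sigma>) \<cdot> (e \<boxtimes> e)"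
    by simp
  also have "\<dots> = \<a>[H, H, H] \<cdot> (t \<cdot> (S \<boxtimes> \<i> H)) \<cdot> (e \<boxtimes> e)"
    unfolding comul_braid_right by (simp add: primitive)
  finally show ?thesis unfolding t_S by simp
qed

text \<open>Multiplicativity of \<open>\<Delta>\<close> and primitivity reduce the left side to the
  product of \<open>S\<close> with \<open>S\<close> in \<open>H \<otimes> H\<close>. Its four terms
  are those of \<open>mul_middle\<close>: the pure ones combine to \<open>S \<cdot> \<mu>\<close>,
  the mixed ones give the identity and \<open>\<sigma>\<close>.\<close>

lemma comul_mul_primitive:
  "\<Delta> \<cdot> \<mu> \<cdot> (e \<boxtimes> e) = (S \<cdot> \<mu> \<boxplus> (\<sigma> \<boxplus> \<i> (H \<boxdot> H))) \<cdot> (e \<boxtimes> e)"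
proof -
  have "\<Delta> \<cdot> \<mu> \<cdot> (e \<boxtimes> e) = (\<Delta> \<cdot> \<mu>) \<cdot> (e \<boxtimes> e)"
    by simp
  also have "\<dots> = ((\<mu> \<boxtimes> \<mu>) \<cdot> on_middle C H \<sigma> \<cdot> (S \<boxtimes> S)) \<cdot> (e \<boxtimes> e)"
    by (simp add: primitive flip: comul_mul)
  also have "(\<mu> \<boxtimes> \<mu>) \<cdot> on_middle C H \<sigma> \<cdot> (S \<boxtimes> S)
    = (insl H \<cdot> \<mu> \<boxplus> \<i> (H \<boxdot> H)) \<boxplus> (\<sigma> \<boxplus> insr H \<cdot> \<mu>)"
    by (simp add: tensor_add comp_add mul_middle)
  also have "\<dots> = S \<cdot> \<mu> \<boxplus> (\<sigma> \<boxplus> \<i> (H \<boxdot> H))"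
    by (simp add: comp_add add_assoc add_commute[of _ "\<i> (H \<boxdot> H)"] add_left_commute[of _ "\<i> (H \<boxdot> H)"]
        add_commute[of "\<sigma>" "insr H \<cdot> \<mu>"])
  finally show ?thesis .
qed

text \<open>\<open>comul_mul_primitive\<close> speaks about arguments that come through
  \<open>e \<boxtimes> e\<close>; the operator \<open>c\<close> is what brings the braided argument
  into that form. Both products then have the same correction term \<open>?N\<close>, because
  \<open>\<sigma> \<boxplus> \<i> (H \<boxdot> H)\<close> absorbs \<open>\<sigma>\<close>.\<close>

lemma bracket_primitive:
  assumes c: "c \<in> Arr C" "Dom C c = P \<boxdot> P" "Cod C c = P \<boxdot> P" "(e \<boxtimes> e) \<cdot> c = \<sigma> \<cdot> (e \<boxtimes> e)"
  shows "\<Delta> \<cdot> bracket (commutator_lie C B) \<cdot> (e \<boxtimes> e) = S \<cdot> bracket (commutator_lie C B) \<cdot> (e \<boxtimes> e)"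
proof -
  let ?N = "(\<sigma> \<boxplus> \<i> (H \<boxdot> H)) \<cdot> (e \<boxtimes> e)"
  have "(\<sigma> \<boxplus> \<i> (H \<boxdot> H)) \<cdot> \<sigma> = \<sigma> \<boxplus> \<i> (H \<boxdot> H)"
    by (simp add: comp_add braid_braid add_commute[of \<sigma>])
  note N = comp_reassoc[OF this, of "e \<boxtimes> e", simplified]
  have mul: "\<Delta> \<cdot> \<mu> \<cdot> (e \<boxtimes> e) = S \<cdot> \<mu> \<cdot> (e \<boxtimes> e) \<boxplus> ?N"
    unfolding comul_mul_primitive by (subst comp_add) simp_all
  have "\<Delta> \<cdot> \<mu> \<cdot> \<sigma> \<cdot> (e \<boxtimes> e) = (\<Delta> \<cdot> \<mu> \<cdot> (e \<boxtimes> e)) \<cdot> c"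
    using c by simp
  also have "\<dots> = (S \<cdot> \<mu> \<boxplus> (\<sigma> \<boxplus> \<i> (H \<boxdot> H))) \<cdot> (e \<boxtimes> e) \<cdot> c"
    unfolding comul_mul_primitive using c(1-3) by simp
  also have "\<dots> = S \<cdot> \<mu> \<cdot> \<sigma> \<cdot> (e \<boxtimes> e) \<boxplus> ?N"
    unfolding c(4) by (subst comp_add) (simp_all add: N)
  finally have mul_braid: "\<Delta> \<cdot> \<mu> \<cdot> \<sigma> \<cdot> (e \<boxtimes> e) = S \<cdot> \<mu> \<cdot> \<sigma> \<cdot> (e \<boxtimes> e) \<boxplus> ?N" .
  have br: "bracket (commutator_lie C B) \<cdot> (e \<boxtimes> e) = \<mu> \<cdot> (e \<boxtimes> e) \<boxminus> \<mu> \<cdot> \<sigma> \<cdot> (e \<boxtimes> e)"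
    by (simp add: commutator_lie_def comp_minus)
  have "\<Delta> \<cdot> (\<mu> \<cdot> (e \<boxtimes> e) \<boxminus> \<mu> \<cdot> \<sigma> \<cdot> (e \<boxtimes> e)) = \<Delta> \<cdot> \<mu> \<cdot> (e \<boxtimes> e) \<boxminus> \<Delta> \<cdot> \<mu> \<cdot> \<sigma> \<cdot> (e \<boxtimes> e)"
    by (simp add: comp_minus)
  also have "\<dots> = S \<cdot> \<mu> \<cdot> (e \<boxtimes> e) \<boxminus> S \<cdot> \<mu> \<cdot> \<sigma> \<cdot> (e \<boxtimes> e)"
  proof (rule minus_eqI)
    define x y n where "x = S \<cdot> \<mu> \<cdot> (e \<boxtimes> e)" "y = S \<cdot> \<mu> \<cdot> \<sigma> \<cdot> (e \<boxtimes> e)" "n = ?N"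
    have "x \<in> Arr C" "Dom C x = P \<boxdot> P" "Cod C x = H \<boxdot> H" "y \<in> Arr C" "Dom C y = P \<boxdot> P" "Cod C y = H \<boxdot> H"
      "n \<in> Arr C" "Dom C n = P \<boxdot> P" "Cod C n = H \<boxdot> H"
      by (simp_all add: x_y_n_def)
    then have "x \<boxplus> n = (x \<boxminus> y) \<boxplus> (y \<boxplus> n)"
      by (simp flip: add_assoc)
    then show "\<Delta> \<cdot> \<mu> \<cdot> (e \<boxtimes> e) = (S \<cdot> \<mu> \<cdot> (e \<boxtimes> e) \<boxminus> S \<cdot> \<mu> \<cdot> \<sigma> \<cdot> (e \<boxtimes> e)) \<boxplus> \<Delta> \<cdot> \<mu> \<cdot> \<sigma> \<cdot> (e \<boxtimes> e)"
      unfolding mul mul_braid by (simp only: x_y_n_def)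
  qed simp_all
  also have "\<dots> = S \<cdot> (\<mu> \<cdot> (e \<boxtimes> e) \<boxminus> \<mu> \<cdot> \<sigma> \<cdot> (e \<boxtimes> e))"
    by (simp add: comp_minus)
  finally show ?thesis unfolding br .
qed

end

end

section \<open>Morphisms of YB-Lie algebras and of bialgebras\<close>

context additive_monoidal_category
begin

text \<open>The equations for \<open>g\<close> are compared after \<open>e'\<close> and
  \<open>e' \<boxtimes> e'\<close>, where the square \<open>e' \<cdot> g = f \<cdot> e\<close>
  trades \<open>g\<close> for \<open>f\<close>. Monicity is required of the target inclusion
  alone.\<close>

lemma YB_Lie_hom_restrict:
  assumes "is_YB_Lie_algebra_hom C A' A e" "is_YB_Lie_algebra_hom C B' B e'" "is_YB_Lie_algebra_hom C A B f"
    and monic: "monic e'" "monic (e' \<boxtimes> e')"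
    and g: "g \<in> Hom C (lie_obj A') (lie_obj B')" "e' \<cdot> g = f \<cdot> e"
  shows "is_YB_Lie_algebra_hom C A' B' g"
proof -
  define a b where "a = lie_obj A'" "b = lie_obj B'"
  define x y where "x = lie_obj A" "y = lie_obj B"
  note defs = a_b_def x_y_def
  have [simp]: "e \<in> Arr C" "Dom C e = a" "Cod C e = x" "e' \<in> Arr C" "Dom C e' = b" "Cod C e' = y"
    "f \<in> Arr C" "Dom C f = x" "Cod C f = y" "g \<in> Arr C" "Dom C g = a" "Cod C g = b"
    using assms by (auto simp: is_YB_Lie_algebra_hom_def Hom_def defs)
  have arr: "bracket X \<in> Arr C" "Dom C (bracket X) = lie_obj X \<boxdot> lie_obj X" "Cod C (bracket X) = lie_obj X"
    "lie_op X \<in> Arr C" "Dom C (lie_op X) = lie_obj X \<boxdot> lie_obj X" "Cod C (lie_op X) = lie_obj X \<boxdot> lie_obj X"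
    if "is_YB_Lie_algebra C X" for X
    using that by (auto simp: is_YB_Lie_algebra_def involutive_YB_operator_def Let_def Hom_def)
  have "is_YB_Lie_algebra C A" "is_YB_Lie_algebra C B" "is_YB_Lie_algebra C A'" "is_YB_Lie_algebra C B'"
    using assms by (simp_all add: is_YB_Lie_algebra_hom_def)
  note [simp] = this[THEN arr(1)] this[THEN arr(2)] this[THEN arr(3)] this[THEN arr(4)] this[THEN arr(5)] this[THEN arr(6)]
    defs[symmetric]
  have e: "bracket A \<cdot> (e \<boxtimes> e) = e \<cdot> bracket A'" "lie_op A \<cdot> (e \<boxtimes> e) = (e \<boxtimes> e) \<cdot> lie_op A'"
    and e': "bracket B \<cdot> (e' \<boxtimes> e') = e' \<cdot> bracket B'" "lie_op B \<cdot> (e' \<boxtimes> e') = (e' \<boxtimes> e') \<cdot> lie_op B'"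
    and f: "bracket B \<cdot> (f \<boxtimes> f) = f \<cdot> bracket A" "lie_op B \<cdot> (f \<boxtimes> f) = (f \<boxtimes> f) \<cdot> lie_op A"
    using assms by (simp_all add: is_YB_Lie_algebra_hom_def)
  note e'_assoc = e'[THEN comp_reassoc, simplified] and f_assoc = f[THEN comp_reassoc, simplified]
    and g' = comp_reassoc[OF g(2), simplified]
  have [simp]: "a \<in> Obj C" "b \<in> Obj C" "x \<in> Obj C" "y \<in> Obj C"
    using arr_obj[of e] arr_obj[of e'] by simp_all
  note nosimp = interchange interchange_assoc
  have "bracket B' \<cdot> (g \<boxtimes> g) = g \<cdot> bracket A'"
  proof (rule monicD[OF monic(1)])
    have "e' \<cdot> bracket B' \<cdot> (g \<boxtimes> g) = bracket B \<cdot> (e' \<boxtimes> e') \<cdot> (g \<boxtimes> g)"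
      by (simp add: e'_assoc del: nosimp)
    also have "\<dots> = bracket B \<cdot> (f \<boxtimes> f) \<cdot> (e \<boxtimes> e)"
      by (simp add: g)
    also have "\<dots> = e' \<cdot> g \<cdot> bracket A'"
      by (simp add: f_assoc e g' del: nosimp)
    finally show "e' \<cdot> (bracket B' \<cdot> (g \<boxtimes> g)) = e' \<cdot> (g \<cdot> bracket A')" .
  qed simp_all
  moreover have "lie_op B' \<cdot> (g \<boxtimes> g) = (g \<boxtimes> g) \<cdot> lie_op A'"
  proof (rule monicD[OF monic(2)])
    have "(e' \<boxtimes> e') \<cdot> lie_op B' \<cdot> (g \<boxtimes> g) = lie_op B \<cdot> (e' \<boxtimes> e') \<cdot> (g \<boxtimes> g)"
      by (simp add: e'_assoc del: nosimp)
    also have "\<dots> = lie_op B \<cdot> (f \<boxtimes> f) \<cdot> (e \<boxtimes> e)"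
      by (simp add: g)
    also have "\<dots> = (f \<boxtimes> f) \<cdot> (e \<boxtimes> e) \<cdot> lie_op A'"
      by (simp add: f_assoc e del: nosimp)
    also have "\<dots> = (e' \<boxtimes> e') \<cdot> (g \<boxtimes> g) \<cdot> lie_op A'"
      by (simp add: g)
    finally show "(e' \<boxtimes> e') \<cdot> (lie_op B' \<cdot> (g \<boxtimes> g)) = (e' \<boxtimes> e') \<cdot> ((g \<boxtimes> g) \<cdot> lie_op A')" .
  qed simp_all
  ultimately show ?thesis
    using assms(1,2) g(1) by (simp add: is_YB_Lie_algebra_hom_def)
qed

lemma ins_hom:
  assumes "f \<in> Arr C" "Dom C f = H" "Cod C f = K" "u \<in> Arr C" "Dom C u = \<I>" "Cod C u = H"
  shows "(f \<boxtimes> f) \<cdot> ins_left u H = ins_left (f \<cdot> u) K \<cdot> f"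
    "(f \<boxtimes> f) \<cdot> ins_right u H = ins_right (f \<cdot> u) K \<cdot> f"
  using assms arr_obj[OF assms(1)] Inv_lunit_natural[OF assms(1)] Inv_runit_natural[OF assms(1)]
  by (simp_all add: ins_left_def ins_right_def)

lemma bialgebra_homD:
  assumes "is_braided_bialgebra_hom C B K f"
  shows "f \<in> Arr C" "Dom C f = bobj B" "Cod C f = bobj K"
    "f \<cdot> mul B = mul K \<cdot> (f \<boxtimes> f)" "f \<cdot> unit B = unit K"
    "comul K \<cdot> f = (f \<boxtimes> f) \<cdot> comul B" "counit K \<cdot> f = counit B"
    "braid K \<cdot> (f \<boxtimes> f) = (f \<boxtimes> f) \<cdot> braid B"
    "is_braided_bialgebra C B" "is_braided_bialgebra C K"
    "braided_bialgebra C B" "braided_bialgebra C K"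
  using assms additive_monoidal_category_axioms
  by (auto simp: is_braided_bialgebra_hom_def is_algebra_hom_def is_coalgebra_hom_def Hom_def
      braided_bialgebra_def braided_bialgebra_axioms_def)

lemma commutator_lie_hom:
  assumes "is_braided_bialgebra_hom C B K f"
  shows "is_YB_Lie_algebra_hom C (commutator_lie C B) (commutator_lie C K) f"
proof -
  note f = bialgebra_homD[OF assms]
  interpret B: braided_bialgebra C B by (fact f)
  interpret K: braided_bialgebra C K by (fact f)
  note [simp] = f(1-3)
  have mul: "mul K \<cdot> (f \<boxtimes> f) = f \<cdot> mul B" using f(4) by simp
  have "(mul K \<cdot> (\<i> (bobj K \<boxdot> bobj K) \<boxminus> braid K)) \<cdot> (f \<boxtimes> f)
    = mul K \<cdot> (f \<boxtimes> f) \<cdot> (\<i> (bobj B \<boxdot> bobj B) \<boxminus> braid B)"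
    by (simp add: comp_minus f(8))
  also have "\<dots> = f \<cdot> mul B \<cdot> (\<i> (bobj B \<boxdot> bobj B) \<boxminus> braid B)"
    by (simp add: comp_reassoc[OF mul, simplified])
  finally show ?thesis
    using B.YB_Lie_commutator K.YB_Lie_commutator f
    by (simp add: is_YB_Lie_algebra_hom_def commutator_lie_def Hom_def)
qed

end

section \<open>The YB-Lie structure on the primitives\<close>

context braided_bialgebra
begin

lemma primitives_equalizer:
  assumes "is_primitives C B P e"
  shows "is_equalizer C P e \<Delta> S"
  using assms by (simp add: is_primitives_def unit_left_eq unit_right_eq)

text \<open>\<open>primitive_lie\<close> is defined by definite descriptions, so its operator and
  bracket become accessible once existence and uniqueness are settled. Existence comes from the two
  factorization lemmas, that of the bracket building on that of the operator; uniqueness comes from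
  the monics \<open>e \<boxtimes> e\<close> and \<open>e\<close>.\<close>

lemma primitives_lie:
  assumes pres: "has_preserved_equalizers C" and prim: "is_primitives C B P e"
  shows ex1_restricted_op: "\<exists>!c. is_restricted_op C B P e c"
    and ex1_restricted_bracket: "\<exists>!b. is_restricted_bracket C B P e b"
    and primitive_YB_Lie: "is_YB_Lie_algebra C (primitive_lie C B P e)"
    and primitive_inclusion_hom: "is_YB_Lie_algebra_hom C (primitive_lie C B P e) (commutator_lie C B) e"
proof -
  note eq = primitives_equalizer[OF prim]
  note monic = equalizer_tensor_monic(3-5)[OF pres eq]
  have e [simp]: "e \<in> Arr C" "Dom C e = P" "Cod C e = H" and P [simp]: "P \<in> Obj C"
    and primitive: "\<Delta> \<cdot> e = S \<cdot> e"
    using equalizer_props[OF eq] by simp_all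
  obtain c where c: "c \<in> Arr C" "Dom C c = P \<boxdot> P" "Cod C c = P \<boxdot> P" "(e \<boxtimes> e) \<cdot> c = \<sigma> \<cdot> (e \<boxtimes> e)"
  proof (rule equalizer_tensor_factor[OF pres eq, of "\<sigma> \<cdot> (e \<boxtimes> e)"])
    show "(\<Delta> \<boxtimes> \<i> (Dom C \<Delta>)) \<cdot> \<sigma> \<cdot> (e \<boxtimes> e) = (S \<boxtimes> \<i> (Dom C \<Delta>)) \<cdot> \<sigma> \<cdot> (e \<boxtimes> e)"
      using braid_primitive_left[OF e primitive] by simp
    show "(\<i> (Dom C \<Delta>) \<boxtimes> \<Delta>) \<cdot> \<sigma> \<cdot> (e \<boxtimes> e) = (\<i> (Dom C \<Delta>) \<boxtimes> S) \<cdot> \<sigma> \<cdot> (e \<boxtimes> e)"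
      using braid_primitive_right[OF e primitive] by simp
  qed simp_all
  then have c': "is_restricted_op C B P e c"
    by (simp add: is_restricted_op_def Hom_def)
  have br [simp]: "bracket (commutator_lie C B) \<in> Arr C" "Dom C (bracket (commutator_lie C B)) = H \<boxdot> H"
    "Cod C (bracket (commutator_lie C B)) = H"
    by (simp_all add: commutator_lie_def)
  obtain b where "b \<in> Arr C" "Dom C b = Dom C (bracket (commutator_lie C B) \<cdot> (e \<boxtimes> e))" "Cod C b = P"
    "e \<cdot> b = bracket (commutator_lie C B) \<cdot> (e \<boxtimes> e)"
    by (rule equalizer_factor[OF eq _ _ bracket_primitive[OF e primitive c]]) simp_all
  then have b': "is_restricted_bracket C B P e b"
    by (simp add: is_restricted_bracket_def Hom_def)
  have c_unique: "c1 = c" if "is_restricted_op C B P e c1" for c1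
    by (rule monicD[OF monic(2)]) (use that c in \<open>simp_all add: is_restricted_op_def Hom_def\<close>)
  have b_unique: "b1 = b" if "is_restricted_bracket C B P e b1" for b1
    by (rule monicD[OF monic(1)]) (use that b' in \<open>simp_all add: is_restricted_bracket_def Hom_def\<close>)
  show "\<exists>!c. is_restricted_op C B P e c" "\<exists>!b. is_restricted_bracket C B P e b"
    using c' b' c_unique b_unique by blast+
  have "primitive_lie C B P e = \<lparr>lie_obj = P, lie_op = c, bracket = b\<rparr>"
    unfolding primitive_lie_def
    by (simp add: the_equality[of "is_restricted_op C B P e", OF c' c_unique]
        the_equality[of "is_restricted_bracket C B P e", OF b' b_unique])
  moreover have "lie_obj (commutator_lie C B) = H" "lie_op (commutator_lie C B) = \<sigma>"
    by (simp_all add: commutator_lie_def)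
  ultimately show "is_YB_Lie_algebra C (primitive_lie C B P e)"
    "is_YB_Lie_algebra_hom C (primitive_lie C B P e) (commutator_lie C B) e"
    using YB_Lie_algebra_restrict[OF YB_Lie_commutator, of e P c b] c' b' monic
    by (simp_all add: is_restricted_op_def is_restricted_bracket_def)
qed

end

context additive_monoidal_category
begin

text \<open>A bialgebra morphism commutes with the comultiplications and, preserving the unit, also
  with the two versions of \<open>S\<close>. Hence \<open>f \<cdot> e\<close> is primitive for
  \<open>K\<close> and factors through \<open>e'\<close>.\<close>

lemma primitive_map:
  assumes pres: "has_preserved_equalizers C" and f: "is_braided_bialgebra_hom C B K f"
    and e: "is_primitives C B P e" and e': "is_primitives C K P' e'"
  shows ex1_primitive_map: "\<exists>!g. g \<in> Hom C P P' \<and> e' \<cdot> g = f \<cdot> e"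
    and primitive_map_hom: "g \<in> Hom C P P' \<Longrightarrow> e' \<cdot> g = f \<cdot> e \<Longrightarrow>
      is_YB_Lie_algebra_hom C (primitive_lie C B P e) (primitive_lie C K P' e') g"
proof -
  note f' = bialgebra_homD[OF f]
  interpret B: braided_bialgebra C B by (fact f')
  interpret K: braided_bialgebra C K by (fact f')
  note eqB = B.primitives_equalizer[OF e] and eqK = K.primitives_equalizer[OF e']
  note monic = equalizer_tensor_monic(3,4)[OF pres eqK]
  have [simp]: "e \<in> Arr C" "Dom C e = P" "Cod C e = bobj B" "P \<in> Obj C"
    and primitive: "comul B \<cdot> e = B.S \<cdot> e"
    using equalizer_props[OF eqB] by simp_all
  have [simp]: "e' \<in> Arr C" "Dom C e' = P'" "Cod C e' = bobj K" "P' \<in> Obj C"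
    using equalizer_props[OF eqK] by simp_all
  note [simp] = f'(1-3)
  have S: "(f \<boxtimes> f) \<cdot> B.S = K.S \<cdot> f"
    by (simp add: comp_add ins_hom f')
  have "comul K \<cdot> f \<cdot> e = (f \<boxtimes> f) \<cdot> B.S \<cdot> e"
    using comp_reassoc[OF f'(6), of e] by (simp add: primitive)
  also have "\<dots> = K.S \<cdot> f \<cdot> e"
    using comp_reassoc[OF S, of e] by simp
  finally have "comul K \<cdot> (f \<cdot> e) = K.S \<cdot> (f \<cdot> e)" .
  then obtain k where g: "k \<in> Arr C" "Dom C k = Dom C (f \<cdot> e)" "Cod C k = P'" "e' \<cdot> k = f \<cdot> e"
    by (rule equalizer_factor[OF eqK, rotated 2]) simp_all
  show "\<exists>!g. g \<in> Hom C P P' \<and> e' \<cdot> g = f \<cdot> e"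
  proof (rule ex1I[of _ k])
    show "k \<in> Hom C P P' \<and> e' \<cdot> k = f \<cdot> e" using g by (simp add: Hom_def)
    show "h = k" if "h \<in> Hom C P P' \<and> e' \<cdot> h = f \<cdot> e" for h
      by (rule monicD[OF monic(1)]) (use that g in \<open>simp_all add: Hom_def\<close>)
  qed
  assume "g \<in> Hom C P P'" "e' \<cdot> g = f \<cdot> e"
  then show "is_YB_Lie_algebra_hom C (primitive_lie C B P e) (primitive_lie C K P' e') g"
    using YB_Lie_hom_restrict[OF B.primitive_inclusion_hom[OF pres e] K.primitive_inclusion_hom[OF pres e']
        commutator_lie_hom[OF f] monic]
    by (simp add: primitive_lie_def)
qed

end

section \<open>Categories of structured objects\<close>

lemma structured_category_simps:
  "Obj (structured_category C U is_obj is_hom) = {X. is_obj X}"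
  "Arr (structured_category C U is_obj is_hom) = {(X, Y, f). is_obj X \<and> is_obj Y \<and> is_hom X Y f}"
  "Dom (structured_category C U is_obj is_hom) (X, Y, f) = X"
  "Cod (structured_category C U is_obj is_hom) (X, Y, f) = Y"
  "Ide (structured_category C U is_obj is_hom) X = (X, X, Ide C (U X))"
  "Comp (structured_category C U is_obj is_hom) (Y, Z, g) (X, Y', f) = (X, Z, Comp C g f)"
  by (simp_all add: structured_category_def)

context additive_monoidal_category
begin

lemma structured_category:
  assumes hom: "\<And>X Y f. is_hom X Y f \<Longrightarrow> f \<in> Hom C (U X) (U Y)"
    and ide: "\<And>X. is_obj X \<Longrightarrow> is_hom X X (\<i> (U X))"
    and comp: "\<And>X Y Z f g. is_hom X Y f \<Longrightarrow> is_hom Y Z g \<Longrightarrow> is_hom X Z (g \<cdot> f)"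
  shows "category (structured_category C U is_obj is_hom)"
  by (unfold_locales; auto simp: structured_category_simps Hom_def[of "structured_category C U is_obj is_hom"] ide
        intro: comp)
    (auto dest!: hom simp: in_HomD)

text \<open>Uniqueness turns closure into equations: when \<open>R\<close> relates each morphism to
  exactly one induced arrow and is closed under identities and composition, the arrow picked by
  \<open>THE\<close> has to respect both. \<open>R\<close> stands for a universal property, so the
  same scheme serves \<open>P\<close> and \<open>Q\<close>.\<close>

lemma structured_functor:
  assumes C1: "category (structured_category C U is_obj is_hom)"
    and C2: "category (structured_category C U' is_obj' is_hom')"
    and obj: "\<And>X. is_obj X \<Longrightarrow> is_obj' (F X)"
    and ex1: "\<And>X Y f. is_hom X Y f \<Longrightarrow> \<exists>!g. R X Y f g"
    and hom: "\<And>X Y f g. is_hom X Y f \<Longrightarrow> R X Y f g \<Longrightarrow> is_hom' (F X) (F Y) g"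
    and ide: "\<And>X. is_obj X \<Longrightarrow> is_hom X X (\<i> (U X)) \<Longrightarrow> R X X (\<i> (U X)) (\<i> (U' (F X)))"
    and comp: "\<And>X Y Z f g f' g'. is_hom X Y f \<Longrightarrow> is_hom Y Z g \<Longrightarrow> R X Y f f' \<Longrightarrow> R Y Z g g' \<Longrightarrow>
      is_hom X Z (g \<cdot> f) \<Longrightarrow> R X Z (g \<cdot> f) (g' \<cdot> f')"
  shows "category_functor (structured_category C U is_obj is_hom) (structured_category C U' is_obj' is_hom')
    F (\<lambda>(X, Y, f). (F X, F Y, THE g. R X Y f g))"
proof -
  let ?C = "structured_category C U is_obj is_hom" and ?D = "structured_category C U' is_obj' is_hom'"
  interpret C1: category ?C by (fact C1)
  interpret C2: category ?D by (fact C2)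
  have the: "R X Y f (THE g. R X Y f g)" if "is_hom X Y f" for X Y f
    by (rule theI'[OF ex1[OF that]])
  have the_eq: "(THE g. R X Y f g) = g" if "is_hom X Y f" "R X Y f g" for X Y f g
    by (rule the1_equality[OF ex1[OF that(1)] that(2)])
  have ide_hom: "is_hom X X (\<i> (U X))" if "is_obj X" for X
    using C1.ide_hom[of X] that by (simp add: structured_category_simps Hom_def)
  have comp_hom: "is_hom X Z (g \<cdot> f)"
    if "is_obj X" "is_obj Y" "is_obj Z" "is_hom X Y f" "is_hom Y Z g" for X Y Z f g
    using C1.comp_hom[of "(X, Y, f)" "(Y, Z, g)"] that by (simp add: structured_category_simps Hom_def)
  show ?thesis
  proof unfold_locales
    fix X assume "X \<in> Obj ?C"
    then have X: "is_obj X" by (simp add: structured_category_simps)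
    then show "F X \<in> Obj ?D" by (simp add: structured_category_simps obj)
    show "(case Ide ?C X of (X, Y, f) \<Rightarrow> (F X, F Y, THE g. R X Y f g)) = Ide ?D (F X)"
      using X by (simp add: structured_category_simps the_eq[OF ide_hom ide] ide_hom)
  next
    fix f assume "f \<in> Arr ?C"
    then show "(case f of (X, Y, f) \<Rightarrow> (F X, F Y, THE g. R X Y f g)) \<in> Hom ?D (F (Dom ?C f)) (F (Cod ?C f))"
      by (auto simp: structured_category_simps Hom_def obj intro: hom the)
  next
    fix f g assume f: "f \<in> Arr ?C" and g: "g \<in> Arr ?C" and fg: "Cod ?C f = Dom ?C g"
    obtain X Y f' where f_eq: "f = (X, Y, f')" by (cases f)
    obtain Z g' where g_eq: "g = (Y, Z, g')"
      using fg by (cases g) (simp add: f_eq structured_category_simps)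
    have fg': "is_obj X" "is_obj Y" "is_obj Z" "is_hom X Y f'" "is_hom Y Z g'"
      using f g by (simp_all add: f_eq g_eq structured_category_simps)
    show "(case Comp ?C g f of (X, Y, f) \<Rightarrow> (F X, F Y, THE g. R X Y f g))
      = Comp ?D (case g of (X, Y, f) \<Rightarrow> (F X, F Y, THE g. R X Y f g)) (case f of (X, Y, f) \<Rightarrow> (F X, F Y, THE g. R X Y f g))"
      using comp[OF fg'(4,5) the[OF fg'(4)] the[OF fg'(5)] comp_hom[OF fg']]
      by (simp add: f_eq g_eq structured_category_simps the_eq[OF comp_hom[OF fg']])
  qed
qed

section \<open>The categories of bialgebras and YB-Lie algebras, and the functor
  \<open>P\<close>\<close>

lemma bialgebra_arr:
  assumes "is_braided_bialgebra C B"
  shows "bobj B \<in> Obj C" "mul B \<in> Hom C (bobj B \<boxdot> bobj B) (bobj B)" "unit B \<in> Hom C \<I> (bobj B)"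
    "comul B \<in> Hom C (bobj B) (bobj B \<boxdot> bobj B)" "counit B \<in> Hom C (bobj B) \<I>"
    "braid B \<in> Hom C (bobj B \<boxdot> bobj B) (bobj B \<boxdot> bobj B)"
  using assms by (auto simp: is_braided_bialgebra_def Let_def is_algebra_def is_coalgebra_def
      involutive_YB_operator_def)

lemma BiAlg_category: "category (BiAlg C)"
  unfolding BiAlg_def
proof (rule structured_category)
  show "f \<in> Hom C (bobj X) (bobj Y)" if "is_braided_bialgebra_hom C X Y f" for X Y f
    using bialgebra_homD[OF that] by (simp add: Hom_def)
  show "is_braided_bialgebra_hom C X X (\<i> (bobj X))" if "is_braided_bialgebra C X" for X
    using that bialgebra_arr[OF that]
    by (auto simp: is_braided_bialgebra_hom_def is_algebra_hom_def is_coalgebra_hom_def Hom_def)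
  fix X Y Z f g
  assume f: "is_braided_bialgebra_hom C X Y f" and g: "is_braided_bialgebra_hom C Y Z g"
  note fD = bialgebra_homD[OF f] and gD = bialgebra_homD[OF g]
  note [simp] = fD(1-3) gD(1-3)
  have [simp]: "mul A \<in> Arr C" "Dom C (mul A) = bobj A \<boxdot> bobj A" "Cod C (mul A) = bobj A"
    "unit A \<in> Arr C" "Dom C (unit A) = \<I>" "Cod C (unit A) = bobj A"
    "comul A \<in> Arr C" "Dom C (comul A) = bobj A" "Cod C (comul A) = bobj A \<boxdot> bobj A"
    "counit A \<in> Arr C" "Dom C (counit A) = bobj A" "Cod C (counit A) = \<I>"
    "braid A \<in> Arr C" "Dom C (braid A) = bobj A \<boxdot> bobj A" "Cod C (braid A) = bobj A \<boxdot> bobj A"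
    if "A \<in> {X, Y, Z}" for A
    using that bialgebra_arr[OF fD(9)] bialgebra_arr[OF fD(10)] bialgebra_arr[OF gD(10)]
    by (auto simp: Hom_def)
  have "(g \<cdot> f) \<cdot> mul X = mul Z \<cdot> ((g \<cdot> f) \<boxtimes> (g \<cdot> f))"
    using comp_reassoc[OF gD(4), of "f \<boxtimes> f"] by (simp add: fD(4))
  moreover have "comul Z \<cdot> (g \<cdot> f) = ((g \<cdot> f) \<boxtimes> (g \<cdot> f)) \<cdot> comul X"
    using comp_reassoc[OF gD(6), of f] by (simp add: fD(6))
  moreover have "counit Z \<cdot> (g \<cdot> f) = counit X"
    using comp_reassoc[OF gD(7), of f] by (simp add: fD(7))
  moreover have "braid Z \<cdot> ((g \<cdot> f) \<boxtimes> (g \<cdot> f)) = ((g \<cdot> f) \<boxtimes> (g \<cdot> f)) \<cdot> braid X"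
    using comp_reassoc[OF gD(8), of "f \<boxtimes> f"] by (simp add: fD(8))
  ultimately show "is_braided_bialgebra_hom C X Z (g \<cdot> f)"
    using fD gD by (simp add: is_braided_bialgebra_hom_def is_algebra_hom_def is_coalgebra_hom_def Hom_def)
qed

lemma YBLieAlg_category: "category (YBLieAlg C)"
  unfolding YBLieAlg_def
proof (rule structured_category)
  show "f \<in> Hom C (lie_obj X) (lie_obj Y)" if "is_YB_Lie_algebra_hom C X Y f" for X Y f
    using that by (simp add: is_YB_Lie_algebra_hom_def)
  have arr: "bracket A \<in> Arr C" "Dom C (bracket A) = lie_obj A \<boxdot> lie_obj A" "Cod C (bracket A) = lie_obj A"
    "lie_op A \<in> Arr C" "Dom C (lie_op A) = lie_obj A \<boxdot> lie_obj A" "Cod C (lie_op A) = lie_obj A \<boxdot> lie_obj A"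
    "lie_obj A \<in> Obj C"
    if "is_YB_Lie_algebra C A" for A
    using that by (auto simp: is_YB_Lie_algebra_def involutive_YB_operator_def Let_def Hom_def)
  show "is_YB_Lie_algebra_hom C X X (\<i> (lie_obj X))" if "is_YB_Lie_algebra C X" for X
    using that arr[OF that] by (auto simp: is_YB_Lie_algebra_hom_def Hom_def)
  fix X Y Z f g
  assume f: "is_YB_Lie_algebra_hom C X Y f" and g: "is_YB_Lie_algebra_hom C Y Z g"
  then have XYZ: "is_YB_Lie_algebra C X" "is_YB_Lie_algebra C Y" "is_YB_Lie_algebra C Z"
    and [simp]: "f \<in> Arr C" "Dom C f = lie_obj X" "Cod C f = lie_obj Y"
      "g \<in> Arr C" "Dom C g = lie_obj Y" "Cod C g = lie_obj Z"
    and f_eq: "bracket Y \<cdot> (f \<boxtimes> f) = f \<cdot> bracket X" "lie_op Y \<cdot> (f \<boxtimes> f) = (f \<boxtimes> f) \<cdot> lie_op X"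
    and g_eq: "bracket Z \<cdot> (g \<boxtimes> g) = g \<cdot> bracket Y" "lie_op Z \<cdot> (g \<boxtimes> g) = (g \<boxtimes> g) \<cdot> lie_op Y"
    by (simp_all add: is_YB_Lie_algebra_hom_def Hom_def)
  note [simp] = arr[OF XYZ(1)] arr[OF XYZ(2)] arr[OF XYZ(3)]
  have "bracket Z \<cdot> ((g \<cdot> f) \<boxtimes> (g \<cdot> f)) = (g \<cdot> f) \<cdot> bracket X"
    using comp_reassoc[OF g_eq(1), of "f \<boxtimes> f"] by (simp add: f_eq)
  moreover have "lie_op Z \<cdot> ((g \<cdot> f) \<boxtimes> (g \<cdot> f)) = ((g \<cdot> f) \<boxtimes> (g \<cdot> f)) \<cdot> lie_op X"
    using comp_reassoc[OF g_eq(2), of "f \<boxtimes> f"] by (simp add: f_eq)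
  ultimately show "is_YB_Lie_algebra_hom C X Z (g \<cdot> f)"
    using XYZ by (simp add: is_YB_Lie_algebra_hom_def Hom_def)
qed

lemma P_functor:
  assumes pres: "has_preserved_equalizers C"
    and prim: "\<And>B. is_braided_bialgebra C B \<Longrightarrow> is_primitives C B (P B) (e B)"
  shows "is_braided_bialgebra_hom C B K f \<Longrightarrow> \<exists>!g. is_P_map C P e B K f g"
    "category_functor (BiAlg C) (YBLieAlg C) (P_obj C P e) (P_arr C P e)"
proof -
  have map: "(\<exists>!g. is_P_map C P e B K f g) \<and>
      (\<forall>g. is_P_map C P e B K f g \<longrightarrow> is_YB_Lie_algebra_hom C (P_obj C P e B) (P_obj C P e K) g)"
    if "is_braided_bialgebra_hom C B K f" for B K f
    using primitive_map[OF pres that prim prim] bialgebra_homD(9,10)[OF that]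
    by (auto simp: is_P_map_def P_obj_def)
  then show "is_braided_bialgebra_hom C B K f \<Longrightarrow> \<exists>!g. is_P_map C P e B K f g"
    by blast
  show "category_functor (BiAlg C) (YBLieAlg C) (P_obj C P e) (P_arr C P e)"
    unfolding P_arr_def BiAlg_def YBLieAlg_def
  proof (rule structured_functor)
    have e: "e B \<in> Hom C (P B) (bobj B)" if "is_braided_bialgebra C B" for B
      using equalizer_props[OF prim[OF that, unfolded is_primitives_def]] bialgebra_arr(4)[OF that]
      by (simp add: Hom_def)
    show "is_YB_Lie_algebra C (P_obj C P e B)" if "is_braided_bialgebra C B" for B
    proof -
      interpret braided_bialgebra C B by unfold_locales fact
      show ?thesis using primitive_YB_Lie[OF pres prim[OF that]] by (simp add: P_obj_def)
    qed
    show "is_P_map C P e B B (\<i> (bobj B)) (\<i> (lie_obj (P_obj C P e B)))"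
      if "is_braided_bialgebra C B" for B
      using in_HomD[OF e[OF that]] by (simp add: P_obj_def primitive_lie_def is_P_map_def Hom_def)
    show "is_P_map C P e X Z (g \<cdot> f) (g' \<cdot> f')"
      if f: "is_braided_bialgebra_hom C X Y f" and g: "is_braided_bialgebra_hom C Y Z g"
        and f': "is_P_map C P e X Y f f'" and g': "is_P_map C P e Y Z g g'" for X Y Z f g f' g'
    proof -
      note [simp] = bialgebra_homD(1-3)[OF f] bialgebra_homD(1-3)[OF g]
      note eX = in_HomD[OF e[OF bialgebra_homD(9)[OF f]]] and eY = in_HomD[OF e[OF bialgebra_homD(10)[OF f]]]
        and eZ = in_HomD[OF e[OF bialgebra_homD(10)[OF g]]]
      have [simp]: "f' \<in> Arr C" "Dom C f' = P X" "Cod C f' = P Y" "g' \<in> Arr C" "Dom C g' = P Y" "Cod C g' = P Z"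
        and eq: "e Y \<cdot> f' = f \<cdot> e X" "e Z \<cdot> g' = g \<cdot> e Y"
        using f' g' by (simp_all add: is_P_map_def Hom_def)
      show ?thesis
        using comp_reassoc[OF eq(2), of f'] eX eY eZ by (simp add: is_P_map_def Hom_def eq(1))
    qed
  qed (use map BiAlg_category YBLieAlg_category in \<open>auto simp: BiAlg_def YBLieAlg_def\<close>)
qed

end

section \<open>The opposite category\<close>

text \<open>Reversing arrows makes the constraints point the wrong way, so they are replaced by
  their inverses; the order of the tensor factors is kept.\<close>

definition opp :: "('o, 'm, 'z) additive_monoidal_category_scheme \<Rightarrow> ('o, 'm) additive_monoidal_category" where
  "opp C = \<lparr>Obj = Obj C, Arr = Arr C, Dom = Cod C, Cod = Dom C, Ide = Ide C, Comp = (\<lambda>g f. Comp C f g),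
     TensorO = TensorO C, Tensor = Tensor C, UnitO = UnitO C, Assoc = (\<lambda>A B D. Inv\<^bsub>C\<^esub> (Assoc C A B D)),
     LUnit = (\<lambda>A. Inv\<^bsub>C\<^esub> (LUnit C A)), RUnit = (\<lambda>A. Inv\<^bsub>C\<^esub> (RUnit C A)),
     Add = Add C, Zero = (\<lambda>A B. Zero C B A)\<rparr>"

lemma opp_simps [simp]:
  "Obj (opp C) = Obj C" "Arr (opp C) = Arr C" "Dom (opp C) = Cod C" "Cod (opp C) = Dom C"
  "Ide (opp C) = Ide C" "Comp (opp C) g f = Comp C f g" "TensorO (opp C) = TensorO C"
  "Tensor (opp C) = Tensor C" "UnitO (opp C) = UnitO C" "Assoc (opp C) A B D = Inv\<^bsub>C\<^esub> (Assoc C A B D)"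
  "LUnit (opp C) A = Inv\<^bsub>C\<^esub> (LUnit C A)" "RUnit (opp C) A = Inv\<^bsub>C\<^esub> (RUnit C A)"
  "Add (opp C) = Add C" "Zero (opp C) A B = Zero C B A"
  by (simp_all add: opp_def)

lemma Hom_opp [simp]: "Hom (opp C) A B = Hom C B A"
  by (auto simp: Hom_def)

lemma Inv_opp [simp]: "Inv\<^bsub>opp C\<^esub> f = Inv\<^bsub>C\<^esub> f"
  by (simp add: Inv_def conj_commute)

lemma is_iso_opp [simp]: "is_iso (opp C) f \<longleftrightarrow> is_iso C f"
  by (auto simp: is_iso_def)

lemma hom_group_opp [simp]: "hom_group (opp C) A B = hom_group C B A"
  by (simp add: hom_group_def)

lemma Minus_opp [simp]: "Minus (opp C) f g = Minus C f g"
  by (simp add: Minus_def)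

lemma is_equalizer_opp: "is_equalizer (opp C) E e f g \<longleftrightarrow> is_coequalizer C E e f g"
  by (auto simp: is_equalizer_def is_coequalizer_def)

lemma has_preserved_equalizers_opp: "has_preserved_coequalizers C \<Longrightarrow> has_preserved_equalizers (opp C)"
  by (simp add: has_preserved_equalizers_def has_preserved_coequalizers_def is_equalizer_opp)

definition dual_bialgebra :: "('o, 'm) bialgebra \<Rightarrow> ('o, 'm) bialgebra" where
  "dual_bialgebra B = \<lparr>bobj = bobj B, mul = comul B, unit = counit B, comul = mul B, counit = unit B,
     braid = braid B\<rparr>"

lemma dual_bialgebra_simps [simp]:
  "bobj (dual_bialgebra B) = bobj B" "mul (dual_bialgebra B) = comul B" "unit (dual_bialgebra B) = counit B"
  "comul (dual_bialgebra B) = mul B" "counit (dual_bialgebra B) = unit B" "braid (dual_bialgebra B) = braid B"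
  by (simp_all add: dual_bialgebra_def)

definition dual_colie :: "('o, 'm) yb_lie_coalgebra \<Rightarrow> ('o, 'm) yb_lie_algebra" where
  "dual_colie A = \<lparr>lie_obj = colie_obj A, lie_op = colie_op A, bracket = cobracket A\<rparr>"

lemma dual_colie_simps [simp]:
  "lie_obj (dual_colie A) = colie_obj A" "lie_op (dual_colie A) = colie_op A"
  "bracket (dual_colie A) = cobracket A"
  by (simp_all add: dual_colie_def)

section \<open>Algebraic structures in the opposite category\<close>

context additive_monoidal_category
begin

text \<open>Every coherence law of \<open>opp C\<close> is the inverse of the corresponding law of
  \<open>C\<close>, and naturality is that of the inverse constraints.\<close>

lemma monoidal_category_opp: "monoidal_category (opp C)"
proof unfold_locales
  fix f g h assume "f \<in> Arr (opp C)" "g \<in> Arr (opp C)" "h \<in> Arr (opp C)"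
  then show "\<a>\<^bsub>opp C\<^esub>[Cod (opp C) f, Cod (opp C) g, Cod (opp C) h] \<cdot>\<^bsub>opp C\<^esub> (f \<boxtimes>\<^bsub>opp C\<^esub> g \<boxtimes>\<^bsub>opp C\<^esub> h)
    = (f \<boxtimes>\<^bsub>opp C\<^esub> (g \<boxtimes>\<^bsub>opp C\<^esub> h)) \<cdot>\<^bsub>opp C\<^esub> \<a>\<^bsub>opp C\<^esub>[Dom (opp C) f, Dom (opp C) g, Dom (opp C) h]"
    using Inv_assoc_natural[of f g h] by simp
next
  fix f assume "f \<in> Arr (opp C)"
  then show "\<l>\<^bsub>opp C\<^esub>[Cod (opp C) f] \<cdot>\<^bsub>opp C\<^esub> (\<i>\<^bsub>opp C\<^esub> \<I>\<^bsub>opp C\<^esub> \<boxtimes>\<^bsub>opp C\<^esub> f) = f \<cdot>\<^bsub>opp C\<^esub> \<l>\<^bsub>opp C\<^esub>[Dom (opp C) f]"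
    "\<r>\<^bsub>opp C\<^esub>[Cod (opp C) f] \<cdot>\<^bsub>opp C\<^esub> (f \<boxtimes>\<^bsub>opp C\<^esub> \<i>\<^bsub>opp C\<^esub> \<I>\<^bsub>opp C\<^esub>) = f \<cdot>\<^bsub>opp C\<^esub> \<r>\<^bsub>opp C\<^esub>[Dom (opp C) f]"
    using Inv_lunit_natural[of f] Inv_runit_natural[of f] by simp_all
next
  fix A B D E assume "A \<in> Obj (opp C)" "B \<in> Obj (opp C)" "D \<in> Obj (opp C)" "E \<in> Obj (opp C)"
  then have obj: "A \<in> Obj C" "B \<in> Obj C" "D \<in> Obj C" "E \<in> Obj C" by simp_all
  have "Inv (\<a>[A, B, D \<boxdot> E] \<cdot> \<a>[A \<boxdot> B, D, E])
      = Inv ((\<i> A \<boxtimes> \<a>[B, D, E]) \<cdot> \<a>[A, B \<boxdot> D, E] \<cdot> (\<a>[A, B, D] \<boxtimes> \<i> E))"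
    using pentagon obj by simp
  also have "\<dots> = (Inv \<a>[A, B, D] \<boxtimes> \<i> E) \<cdot> Inv \<a>[A, B \<boxdot> D, E] \<cdot> (\<i> A \<boxtimes> Inv \<a>[B, D, E])"
    using obj by (simp add: comp_iso tensor_iso assoc_iso ide_iso)
  finally show "\<a>\<^bsub>opp C\<^esub>[A, B, D \<boxdot>\<^bsub>opp C\<^esub> E] \<cdot>\<^bsub>opp C\<^esub> \<a>\<^bsub>opp C\<^esub>[A \<boxdot>\<^bsub>opp C\<^esub> B, D, E]
    = (\<i>\<^bsub>opp C\<^esub> A \<boxtimes>\<^bsub>opp C\<^esub> \<a>\<^bsub>opp C\<^esub>[B, D, E]) \<cdot>\<^bsub>opp C\<^esub> \<a>\<^bsub>opp C\<^esub>[A, B \<boxdot>\<^bsub>opp C\<^esub> D, E]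
      \<cdot>\<^bsub>opp C\<^esub> (\<a>\<^bsub>opp C\<^esub>[A, B, D] \<boxtimes>\<^bsub>opp C\<^esub> \<i>\<^bsub>opp C\<^esub> E)"
    using obj by (simp add: comp_iso assoc_iso)
next
  fix A B assume "A \<in> Obj (opp C)" "B \<in> Obj (opp C)"
  then show "(\<i>\<^bsub>opp C\<^esub> A \<boxtimes>\<^bsub>opp C\<^esub> \<l>\<^bsub>opp C\<^esub>[B]) \<cdot>\<^bsub>opp C\<^esub> \<a>\<^bsub>opp C\<^esub>[A, \<I>\<^bsub>opp C\<^esub>, B] = \<r>\<^bsub>opp C\<^esub>[A] \<boxtimes>\<^bsub>opp C\<^esub> \<i>\<^bsub>opp C\<^esub> B"
    by (simp add: Inv_assoc_eqI[OF Inv_triangle])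
qed (auto simp: Hom_def intro: assoc_iso[THEN Inv_props(7)] lunit_iso[THEN Inv_props(7)] runit_iso[THEN Inv_props(7)])

lemma additive_monoidal_category_opp: "additive_monoidal_category (opp C)"
proof (intro additive_monoidal_category.intro additive_monoidal_category_axioms.intro monoidal_category_opp)
  show "\<exists>Z\<in>Obj (opp C). \<forall>A\<in>Obj (opp C). (\<exists>!f. f \<in> Hom (opp C) A Z) \<and> (\<exists>!f. f \<in> Hom (opp C) Z A)"
    using zero_object by (simp add: conj_commute)
next
  fix A B assume "A \<in> Obj (opp C)" "B \<in> Obj (opp C)"
  then obtain S i j p q where "S \<in> Obj C" "i \<in> Hom C A S" "j \<in> Hom C B S" "p \<in> Hom C S A" "q \<in> Hom C S B"
    "p \<cdot> i = \<i> A" "q \<cdot> j = \<i> B" "p \<cdot> j = Zero C B A" "q \<cdot> i = Zero C A B" "i \<cdot> p \<boxplus> j \<cdot> q = \<i> S"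
    using biproducts[of A B] by auto
  then show "\<exists>S\<in>Obj (opp C). \<exists>i\<in>Hom (opp C) A S. \<exists>j\<in>Hom (opp C) B S.
    \<exists>p\<in>Hom (opp C) S A. \<exists>q\<in>Hom (opp C) S B.
      p \<cdot>\<^bsub>opp C\<^esub> i = \<i>\<^bsub>opp C\<^esub> A \<and> q \<cdot>\<^bsub>opp C\<^esub> j = \<i>\<^bsub>opp C\<^esub> B \<and>
      p \<cdot>\<^bsub>opp C\<^esub> j = Zero (opp C) B A \<and> q \<cdot>\<^bsub>opp C\<^esub> i = Zero (opp C) A B \<and>
      i \<cdot>\<^bsub>opp C\<^esub> p \<boxplus>\<^bsub>opp C\<^esub> j \<cdot>\<^bsub>opp C\<^esub> q = \<i>\<^bsub>opp C\<^esub> S"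
    by (intro bexI[of _ S] bexI[of _ p] bexI[of _ q] bexI[of _ i] bexI[of _ j]) simp_all
qed (auto intro: hom_comm_group comp_add_left comp_add_right tensor_add_left tensor_add_right)

text \<open>Conjugation by an associator is self-dual, as the reversed composite with inverted
  constraints is the same arrow. Only the order of the two factors in \<open>t_op\<close> and
  \<open>w_op\<close> changes.\<close>

lemma YB_op_opp:
  assumes "V \<in> Obj C" "c \<in> Hom C (V \<boxdot> V) (V \<boxdot> V)"
  shows "on12 (opp C) V c = on12 C V c" "on23 (opp C) V c = on23 C V c"
    "t_op (opp C) V c = w_op C V c" "w_op (opp C) V c = t_op C V c"
    "on_middle (opp C) V c = on_middle C V c"
  using assms by (simp_all add: on12_def on23_def t_op_def w_op_def on_middle_def Hom_def)

text \<open>Both sides of the Yang-Baxter equation are palindromes, so reversing composition leaves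
  them unchanged.\<close>

lemma involutive_YB_operator_opp: "involutive_YB_operator (opp C) V c \<longleftrightarrow> involutive_YB_operator C V c"
proof -
  have "involutive_YB_operator (opp C) V c \<longleftrightarrow> involutive_YB_operator C V c"
    if "V \<in> Obj C" "c \<in> Hom C (V \<boxdot> V) (V \<boxdot> V)"
    using that in_HomD(1-3)[OF that(2)] by (auto simp: involutive_YB_operator_def YB_op_opp)
  then show ?thesis by (auto simp: involutive_YB_operator_def)
qed

text \<open>The axioms fall into dual pairs, and multiplicativity of \<open>\<Delta>\<close> is its
  own dual because \<open>on_middle\<close> is. What needs rearranging are the associativity,
  coassociativity, unit and counit laws, where inverted constraints have to change sides.\<close>

lemma bialgebra_opp:
  assumes B: "is_braided_bialgebra C B"
  shows "is_braided_bialgebra (opp C) (dual_bialgebra B)"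
proof -
  note arr = bialgebra_arr[OF B]
  note [simp] = arr(1) in_HomD(1-3)[OF arr(2)] in_HomD(1-3)[OF arr(3)] in_HomD(1-3)[OF arr(4)]
    in_HomD(1-3)[OF arr(5)] in_HomD(1-3)[OF arr(6)]
  have units: "unit_left (opp C) (dual_bialgebra B) = counit_left C B"
    "unit_right (opp C) (dual_bialgebra B) = counit_right C B"
    "counit_left (opp C) (dual_bialgebra B) = unit_left C B"
    "counit_right (opp C) (dual_bialgebra B) = unit_right C B"
    by (simp_all add: unit_left_def unit_right_def counit_left_def counit_right_def)
  have mid: "on_middle C (bobj B) (braid B) \<in> Arr C"
    "Dom C (on_middle C (bobj B) (braid B)) = bobj B \<boxdot> bobj B \<boxdot> (bobj B \<boxdot> bobj B)"
    "Cod C (on_middle C (bobj B) (braid B)) = bobj B \<boxdot> bobj B \<boxdot> (bobj B \<boxdot> bobj B)"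
    by (simp_all add: on_middle_def)
  let ?H = "bobj B"
  have mul: "mul B \<cdot> (mul B \<boxtimes> \<i> ?H) = mul B \<cdot> (\<i> ?H \<boxtimes> mul B) \<cdot> \<a>[?H, ?H, ?H]"
      "mul B \<cdot> (unit B \<boxtimes> \<i> ?H) = \<l>[?H]" "mul B \<cdot> (\<i> ?H \<boxtimes> unit B) = \<r>[?H]"
    and comul: "\<a>[?H, ?H, ?H] \<cdot> (comul B \<boxtimes> \<i> ?H) \<cdot> comul B = (\<i> ?H \<boxtimes> comul B) \<cdot> comul B"
      "\<l>[?H] \<cdot> (counit B \<boxtimes> \<i> ?H) \<cdot> comul B = \<i> ?H" "\<r>[?H] \<cdot> (\<i> ?H \<boxtimes> counit B) \<cdot> comul B = \<i> ?H"
    using B by (simp_all add: is_braided_bialgebra_def Let_def is_algebra_def is_coalgebra_def)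
  have "Inv \<a>[?H, ?H, ?H] \<cdot> (\<i> ?H \<boxtimes> comul B) \<cdot> comul B = (comul B \<boxtimes> \<i> ?H) \<cdot> comul B"
    by (rule Inv_assoc_eqI[OF comul(1)]) simp_all
  moreover have "(counit B \<boxtimes> \<i> ?H) \<cdot> comul B = Inv \<l>[?H]"
    by (rule iso_cancel_left[where h = "\<l>[?H]"]) (simp_all add: comul(2) lunit_iso)
  moreover have "(\<i> ?H \<boxtimes> counit B) \<cdot> comul B = Inv \<r>[?H]"
    by (rule iso_cancel_left[where h = "\<r>[?H]"]) (simp_all add: comul(3) runit_iso)
  ultimately have "is_algebra (opp C) ?H (comul B) (counit B)"
    using arr by (simp add: is_algebra_def)
  moreover have "is_coalgebra (opp C) ?H (mul B) (unit B)"
    using arr mul(1) comp_reassoc[OF mul(1), of "Inv \<a>[?H, ?H, ?H]"] comp_reassoc[OF mul(2), of "Inv \<l>[?H]"]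
      comp_reassoc[OF mul(3), of "Inv \<r>[?H]"]
    by (simp add: is_coalgebra_def)
  ultimately show ?thesis
    using B unfolding is_braided_bialgebra_def Let_def dual_bialgebra_simps units involutive_YB_operator_opp
    by (simp add: YB_op_opp[OF arr(1,6)] is_algebra_hom_def is_coalgebra_hom_def mid)
qed

lemma bialgebra_hom_opp:
  assumes "is_braided_bialgebra_hom C B K f"
  shows "is_braided_bialgebra_hom (opp C) (dual_bialgebra K) (dual_bialgebra B) f"
  using bialgebra_homD[OF assms] bialgebra_opp
  by (simp add: is_braided_bialgebra_hom_def is_algebra_hom_def is_coalgebra_hom_def Hom_def)

text \<open>The axioms match term by term, including the order of \<open>w_op\<close> and
  \<open>t_op\<close> in the cyclic sum. The one difference is that coalgebra antisymmetry is
  written as an expanded sum.\<close>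

lemma YB_Lie_coalgebra_opp:
  "is_YB_Lie_coalgebra C A \<longleftrightarrow> is_YB_Lie_algebra (opp C) (dual_colie A)"
proof -
  let ?K = "colie_obj A" and ?c = "colie_op A" and ?d = "cobracket A"
  have "is_YB_Lie_coalgebra C A \<longleftrightarrow> is_YB_Lie_algebra (opp C) (dual_colie A)"
    if "?K \<in> Obj C" "?c \<in> Hom C (?K \<boxdot> ?K) (?K \<boxdot> ?K)" "?d \<in> Hom C ?K (?K \<boxdot> ?K)"
  proof -
    note [simp] = that(1) in_HomD(1-3)[OF that(2)] in_HomD(1-3)[OF that(3)]
    have "(\<i> (?K \<boxdot> ?K) \<boxplus> ?c) \<cdot> ?d = ?d \<boxplus> ?c \<cdot> ?d"
      by (simp add: comp_add)
    then show ?thesis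
      using that by (auto simp: is_YB_Lie_coalgebra_def is_YB_Lie_algebra_def Let_def
          involutive_YB_operator_opp YB_op_opp)
  qed
  then show ?thesis
    by (auto simp: is_YB_Lie_coalgebra_def is_YB_Lie_algebra_def Let_def
          involutive_YB_operator_opp involutive_YB_operator_def)
qed

lemma YB_Lie_coalgebra_hom_opp:
  "is_YB_Lie_coalgebra_hom C A B f \<longleftrightarrow> is_YB_Lie_algebra_hom (opp C) (dual_colie B) (dual_colie A) f"
  by (auto simp: is_YB_Lie_coalgebra_hom_def is_YB_Lie_algebra_hom_def YB_Lie_coalgebra_opp)

lemma is_primitives_opp:
  "is_primitives (opp C) (dual_bialgebra B) Q q \<longleftrightarrow> is_indecomposables C B Q q"
  if "is_braided_bialgebra C B"
  using bialgebra_arr[OF that]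
  by (simp add: is_primitives_def is_indecomposables_def is_equalizer_opp unit_left_def unit_right_def
      counit_left_def counit_right_def in_HomD)

text \<open>The first two are equalities of predicates, so that the definite descriptions agree and
  the dual records are literally equal. Facts about primitives in \<open>opp C\<close> can then be
  rewritten into facts about indecomposables in \<open>C\<close>.\<close>

lemma induced_opp:
  "is_restricted_op (opp C) (dual_bialgebra B) Q q = is_induced_op C B Q q"
  "is_restricted_bracket (opp C) (dual_bialgebra B) Q q = is_induced_cobracket C B Q q"
  "primitive_lie (opp C) (dual_bialgebra B) Q q = dual_colie (indecomposable_colie C B Q q)"
  "commutator_lie (opp C) (dual_bialgebra B) = dual_colie (cocommutator_colie C B)"
proof -
  show *: "is_restricted_op (opp C) (dual_bialgebra B) Q q = is_induced_op C B Q q"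
    "is_restricted_bracket (opp C) (dual_bialgebra B) Q q = is_induced_cobracket C B Q q"
    by (auto simp: fun_eq_iff is_restricted_op_def is_induced_op_def is_restricted_bracket_def
        is_induced_cobracket_def commutator_lie_def cocommutator_colie_def)
  show "primitive_lie (opp C) (dual_bialgebra B) Q q = dual_colie (indecomposable_colie C B Q q)"
    "commutator_lie (opp C) (dual_bialgebra B) = dual_colie (cocommutator_colie C B)"
    by (simp_all add: primitive_lie_def indecomposable_colie_def dual_colie_def * commutator_lie_def
        cocommutator_colie_def)
qed

section \<open>Indecomposables and the functor \<open>Q\<close>, by duality\<close>

lemma indecomposables_colie:
  assumes pres: "has_preserved_coequalizers C" and B: "is_braided_bialgebra C B"
    and ind: "is_indecomposables C B Q q"
  shows ex1_induced_op: "\<exists>!c. is_induced_op C B Q q c"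
    and ex1_induced_cobracket: "\<exists>!d. is_induced_cobracket C B Q q d"
    and indecomposable_YB_Lie: "is_YB_Lie_coalgebra C (indecomposable_colie C B Q q)"
    and indecomposable_projection_hom:
      "is_YB_Lie_coalgebra_hom C (cocommutator_colie C B) (indecomposable_colie C B Q q) q"
proof -
  interpret dual: braided_bialgebra "opp C" "dual_bialgebra B"
    using additive_monoidal_category_opp bialgebra_opp[OF B]
    by (simp add: braided_bialgebra_def braided_bialgebra_axioms_def)
  note prim = ind[folded is_primitives_opp[OF B]]
  note dual.primitives_lie[OF has_preserved_equalizers_opp[OF pres] prim, unfolded induced_opp]
  then show "\<exists>!c. is_induced_op C B Q q c" "\<exists>!d. is_induced_cobracket C B Q q d"
    "is_YB_Lie_coalgebra C (indecomposable_colie C B Q q)"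
    "is_YB_Lie_coalgebra_hom C (cocommutator_colie C B) (indecomposable_colie C B Q q) q"
    by (simp_all add: YB_Lie_coalgebra_opp YB_Lie_coalgebra_hom_opp)
qed

lemma indecomposable_map:
  assumes pres: "has_preserved_coequalizers C" and f: "is_braided_bialgebra_hom C B K f"
    and q: "is_indecomposables C B Q q" and q': "is_indecomposables C K Q' q'"
  shows "\<exists>!g. g \<in> Hom C Q Q' \<and> g \<cdot> q = q' \<cdot> f"
    and "g \<in> Hom C Q Q' \<Longrightarrow> g \<cdot> q = q' \<cdot> f \<Longrightarrow>
      is_YB_Lie_coalgebra_hom C (indecomposable_colie C B Q q) (indecomposable_colie C K Q' q') g"
proof -
  interpret opp: additive_monoidal_category "opp C" by (rule additive_monoidal_category_opp)
  \<comment> \<open>In the opposite category \<open>f\<close> runs from the dual of \<open>K\<close>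
    to the dual of \<open>B\<close>, so \<open>q'\<close> takes the part of the source inclusion and
    \<open>q\<close> that of the target.\<close>
  note map = opp.primitive_map[OF has_preserved_equalizers_opp[OF pres] bialgebra_hom_opp[OF f]
      q'[folded is_primitives_opp[OF bialgebra_homD(10)[OF f]]]
      q[folded is_primitives_opp[OF bialgebra_homD(9)[OF f]]], unfolded induced_opp]
  show "\<exists>!g. g \<in> Hom C Q Q' \<and> g \<cdot> q = q' \<cdot> f"
    using map(1) by simp
  show "is_YB_Lie_coalgebra_hom C (indecomposable_colie C B Q q) (indecomposable_colie C K Q' q') g"
    if "g \<in> Hom C Q Q'" "g \<cdot> q = q' \<cdot> f"
    using map(2)[of g] that by (simp add: YB_Lie_coalgebra_hom_opp)
qed

lemma YBLieCoAlg_category: "category (YBLieCoAlg C)"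
  unfolding YBLieCoAlg_def
proof (rule structured_category)
  interpret opp: additive_monoidal_category "opp C" by (rule additive_monoidal_category_opp)
  interpret lie: category "YBLieAlg (opp C)" by (rule opp.YBLieAlg_category)
  note defs = YBLieAlg_def structured_category_simps Hom_def[of "structured_category _ _ _ _"]
  show "f \<in> Hom C (colie_obj X) (colie_obj Y)" if "is_YB_Lie_coalgebra_hom C X Y f" for X Y f
    using that by (simp add: is_YB_Lie_coalgebra_hom_def)
  show "is_YB_Lie_coalgebra_hom C X X (\<i> (colie_obj X))" if "is_YB_Lie_coalgebra C X" for X
    using lie.ide_hom[of "dual_colie X"] that
    by (simp add: defs YB_Lie_coalgebra_opp YB_Lie_coalgebra_hom_opp)
  show "is_YB_Lie_coalgebra_hom C X Z (g \<cdot> f)"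
    if "is_YB_Lie_coalgebra_hom C X Y f" "is_YB_Lie_coalgebra_hom C Y Z g" for X Y Z f g
    using lie.comp_hom[of "(dual_colie Z, dual_colie Y, g)" "(dual_colie Y, dual_colie X, f)"] that
    by (simp add: defs YB_Lie_coalgebra_hom_opp) (simp add: is_YB_Lie_algebra_hom_def)
qed

text \<open>Duality provides the induced maps and their morphism property through
  \<open>indecomposable_map\<close>. Identities and composites are handled in \<open>C\<close>
  itself by pasting squares, which keeps the variance of \<open>Q\<close> visible.\<close>

lemma Q_functor:
  assumes pres: "has_preserved_coequalizers C"
    and ind: "\<And>B. is_braided_bialgebra C B \<Longrightarrow> is_indecomposables C B (Q B) (q B)"
  shows "is_braided_bialgebra_hom C B K f \<Longrightarrow> \<exists>!g. is_Q_map C Q q B K f g"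
    "category_functor (BiAlg C) (YBLieCoAlg C) (Q_obj C Q q) (Q_arr C Q q)"
proof -
  have map: "(\<exists>!g. is_Q_map C Q q B K f g) \<and>
      (\<forall>g. is_Q_map C Q q B K f g \<longrightarrow> is_YB_Lie_coalgebra_hom C (Q_obj C Q q B) (Q_obj C Q q K) g)"
    if "is_braided_bialgebra_hom C B K f" for B K f
    using indecomposable_map[OF pres that ind ind] bialgebra_homD(9,10)[OF that]
    by (auto simp: is_Q_map_def Q_obj_def)
  then show "is_braided_bialgebra_hom C B K f \<Longrightarrow> \<exists>!g. is_Q_map C Q q B K f g"
    by blast
  show "category_functor (BiAlg C) (YBLieCoAlg C) (Q_obj C Q q) (Q_arr C Q q)"
    unfolding Q_arr_def BiAlg_def YBLieCoAlg_def
  proof (rule structured_functor)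
    have q: "q B \<in> Hom C (bobj B) (Q B)" if "is_braided_bialgebra C B" for B
      using ind[OF that] bialgebra_arr(2)[OF that]
      by (simp add: is_indecomposables_def is_coequalizer_def Hom_def)
    show "is_YB_Lie_coalgebra C (Q_obj C Q q B)" if "is_braided_bialgebra C B" for B
      using indecomposable_YB_Lie[OF pres that ind[OF that]] by (simp add: Q_obj_def)
    show "is_Q_map C Q q B B (\<i> (bobj B)) (\<i> (colie_obj (Q_obj C Q q B)))"
      if "is_braided_bialgebra C B" for B
      using in_HomD[OF q[OF that]] by (simp add: Q_obj_def indecomposable_colie_def is_Q_map_def Hom_def)
    show "is_Q_map C Q q X Z (g \<cdot> f) (g' \<cdot> f')"
      if f: "is_braided_bialgebra_hom C X Y f" and g: "is_braided_bialgebra_hom C Y Z g"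
        and f': "is_Q_map C Q q X Y f f'" and g': "is_Q_map C Q q Y Z g g'" for X Y Z f g f' g'
    proof -
      note [simp] = bialgebra_homD(1-3)[OF f] bialgebra_homD(1-3)[OF g]
      note qX = in_HomD[OF q[OF bialgebra_homD(9)[OF f]]] and qY = in_HomD[OF q[OF bialgebra_homD(10)[OF f]]]
        and qZ = in_HomD[OF q[OF bialgebra_homD(10)[OF g]]]
      have [simp]: "f' \<in> Arr C" "Dom C f' = Q X" "Cod C f' = Q Y" "g' \<in> Arr C" "Dom C g' = Q Y" "Cod C g' = Q Z"
        and eq: "f' \<cdot> q X = q Y \<cdot> f" "g' \<cdot> q Y = q Z \<cdot> g"
        using f' g' by (simp_all add: is_Q_map_def Hom_def)
      show ?thesis
        using comp_reassoc[OF eq(2), of f] qX qY qZ by (simp add: is_Q_map_def Hom_def eq(1))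
    qed
  qed (use map BiAlg_category YBLieCoAlg_category in \<open>auto simp: BiAlg_def YBLieCoAlg_def\<close>)
qed

end

theorem proposition6p6:
  fixes C :: "('o, 'm) additive_monoidal_category"
  assumes "additive_monoidal_category C"
    and "has_preserved_equalizers C"
    and "has_preserved_coequalizers C"
  shows
    "\<comment> \<open>(i)\<close>
     (\<forall>H P e. is_braided_bialgebra C H \<and> is_primitives C H P e \<longrightarrow>
        (\<exists>!c. is_restricted_op C H P e c) \<and>
        (\<exists>!b. is_restricted_bracket C H P e b) \<and>
        is_YB_Lie_algebra C (primitive_lie C H P e) \<and>
        is_YB_Lie_algebra_hom C (primitive_lie C H P e) (commutator_lie C H) e)
     \<and> \<comment> \<open>(ii)\<close>
     (\<forall>H Q q. is_braided_bialgebra C H \<and> is_indecomposables C H Q q \<longrightarrow>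
        (\<exists>!c. is_induced_op C H Q q c) \<and>
        (\<exists>!d. is_induced_cobracket C H Q q d) \<and>
        is_YB_Lie_coalgebra C (indecomposable_colie C H Q q) \<and>
        is_YB_Lie_coalgebra_hom C (cocommutator_colie C H) (indecomposable_colie C H Q q) q)
     \<and> \<comment> \<open>functoriality of P\<close>
     (\<forall>P e. (\<forall>H. is_braided_bialgebra C H \<longrightarrow> is_primitives C H (P H) (e H)) \<longrightarrow>
        (\<forall>H K f. is_braided_bialgebra_hom C H K f \<longrightarrow> (\<exists>!g. is_P_map C P e H K f g)) \<and>
        category_functor (BiAlg C) (YBLieAlg C) (P_obj C P e) (P_arr C P e))
     \<and> \<comment> \<open>functoriality of Q\<close>
     (\<forall>Q q. (\<forall>H. is_braided_bialgebra C H \<longrightarrow> is_indecomposables C H (Q H) (q H)) \<longrightarrow>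
        (\<forall>H K f. is_braided_bialgebra_hom C H K f \<longrightarrow> (\<exists>!g. is_Q_map C Q q H K f g)) \<and>
        category_functor (BiAlg C) (YBLieCoAlg C) (Q_obj C Q q) (Q_arr C Q q))"
proof -
  interpret additive_monoidal_category C by fact
  have "braided_bialgebra C B" if "is_braided_bialgebra C B" for B
    using that by unfold_locales
  note lie = braided_bialgebra.primitives_lie[OF this assms(2)]
  note colie = indecomposables_colie[OF assms(3)]
  show ?thesis
    using P_functor[OF assms(2)] Q_functor[OF assms(3)]
    by (intro conjI allI impI; (elim conjE)?) (auto intro!: lie colie)
qed

end
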